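(* Let $X^n$ be a tight sequence of random trajectory processes (with $X^n$ the random trajectory process of a random permutation process of $\mathfrak{S}_n$) that are $\epsilon_n$-stationary with $\epsilon_n \to 0$. Assume that $$\limsup_{t\to 0}\ \limsup_{n\to\infty}\ \frac{\mathbb{E}\left[(X^n(t)-X^n(0))^2\right]}{t^2} \le \frac{\pi^2}{3}.$$ Then the sequence converges in probability to the deterministic limit given by the Archimedean process.
   Context: $\mathfrak{S}_n$ is the symmetric group on $[n]=\{1,\dots,n\}$. A permutation process of $\mathfrak{S}_n$ of length $t_n$ is a sequence $(\sigma^n_t;\ t\in[t_n])$ of elements of $\mathfrak{S}_n$, with $\sigma^n_0$ always set to be the identity permutation; it may be random. The rescaled trajectory of particle $i\in[n]$ is the function $T^n_i:[0,1]\to[-1,1]$ with $T^n_i(t/t_n)=\frac{2\sigma^n_t(i)}{n}-1$ at the discrete times $t/t_n$, $t\in\{0,1,\dots,t_n\}$, linearly interpolated in between. Let $\mathbf{C}$ be the space of continuous functions $[0,1]\to[-1,1]$ with the topology of uniform convergence. The trajectory process of $\sigma^n$ is the trajectory of a particle chosen uniformly at random, i.e. the probability measure $X^n=\frac1n\sum_{i=1}^n\delta_{T^n_i}$ on $\mathbf{C}$; for a random permutation process it is a random probability measure on $\mathbf{C}$, called a random trajectory process. We write $X^n(t)$ for the value at time $t$ of a path sampled from $X^n$, and $\mathbb{E}[(X^n(t)-X^n(0))^2]$ is the expectation over both the random permutation process and the uniformly random particle, i.e. $\mathbb{E}\left[\frac1n\sum_{i=1}^n (T^n_i(t)-T^n_i(0))^2\right]$.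 Tightness and convergence in probability refer to $X^n$ as random elements of the space of Borel probability measures on $\mathbf{C}$ with the weak topology; convergence in probability to the Archimedean process means that $X^n$ converges in probability to the (deterministic) law of $\mathcal{A}$ on $\mathbf{C}$. For $\epsilon>0$, the $\epsilon$-shift of a trajectory $(x(t),\ 0\le t\le 1)$ makes the trajectory periodic with reversing boundary conditions: it is $\left((-1)^{\lfloor \epsilon+t\rfloor}\, x(\epsilon+t \bmod 1),\ 0\le t\le 1\right)$. A random trajectory process is called $\epsilon$-stationary if its distribution is invariant under the $\epsilon$-shift of all individual particle trajectories. The Archimedean measure is the unique probability measure on the plane all of whose projections onto lines through the origin have the uniform distribution on $[-1,1]$; its density, supported on the unit disk, is $\left(2\pi\sqrt{1-x^2-y^2}\right)^{-1}dx\,dy$. With $(\mathbf{A}_x,\mathbf{A}_y)$ distributed according to it, the Archimedean process is $\mathcal{A}(t)=\cos(\pi t)\,\mathbf{A}_x+\sin(\pi t)\,\mathbf{A}_y$, $0\le t\le 1$. *)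

theory Defs
  imports "HOL-Probability.Probability" "HOL-Combinatorics.Permutations"
begin

section \<open>The space of trajectories\<close>

typedef trajectory =
  "{x \<in> {0..1} \<rightarrow>\<^sub>E {-1..1}. continuous_on {0..1::real} x} :: (real \<Rightarrow> real) set"
  morphisms path Abs_trajectory
proof
  show "(\<lambda>t\<in>{0..1}. 0) \<in> {x \<in> {0..1} \<rightarrow>\<^sub>E {-1..1::real}. continuous_on {0..1::real} x}"
    by (auto intro: continuous_on_eq[OF continuous_on_const])
qed

lemma path_continuous: "continuous_on {0..1} (path x)"
  and path_range: "t \<in> {0..1} \<Longrightarrow> path x t \<in> {-1..1}"
  and path_extensional: "path x \<in> extensional {0..1}"
  using path[of x] by (auto simp: PiE_def)

lemma path_diff_bdd: "bdd_above ((\<lambda>t. \<bar>path x t - path y t\<bar>) ` {0..1})"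
proof (rule bdd_aboveI2)
  fix t :: real assume "t \<in> {0..1}"
  with path_range[of t x] path_range[of t y]
  show "\<bar>path x t - path y t\<bar> \<le> 2" by auto
qed

instantiation trajectory :: metric_space
begin

definition dist_trajectory :: "trajectory \<Rightarrow> trajectory \<Rightarrow> real" where
  "dist_trajectory x y = (SUP t\<in>{0..1}. \<bar>path x t - path y t\<bar>)"

definition uniformity_trajectory :: "(trajectory \<times> trajectory) filter" where
  "uniformity_trajectory = (INF e\<in>{0<..}. principal {(x, y). dist x y < e})"

definition open_trajectory :: "trajectory set \<Rightarrow> bool" where
  "open_trajectory U \<longleftrightarrow> (\<forall>x\<in>U. eventually (\<lambda>(x', y). x' = x \<longrightarrow> y \<in> U) uniformity)"

instance
proof
  have upper: "\<bar>path x t - path y t\<bar> \<le> dist x y" if "t \<in> {0..1}" for x y t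
    unfolding dist_trajectory_def by (rule cSUP_upper[OF that path_diff_bdd])
  show "dist x y = 0 \<longleftrightarrow> x = y" for x y :: trajectory
  proof
    assume "dist x y = 0"
    then have "path x t = path y t" if "t \<in> {0..1}" for t
      using upper[OF that, of x y] by simp
    then have "path x = path y"
      by (rule extensionalityI[OF path_extensional path_extensional])
    then show "x = y" by (simp add: path_inject)
  qed (simp add: dist_trajectory_def)
  show "dist x y \<le> dist x z + dist y z" for x y z :: trajectory
    unfolding dist_trajectory_def[of x y]
  proof (rule cSUP_least)
    fix t :: real assume t: "t \<in> {0..1}"
    show "\<bar>path x t - path y t\<bar> \<le> dist x z + dist y z"
      using upper[OF t, of x z] upper[OF t, of y z] by linarith
  qed simp
qed (simp_all add: uniformity_trajectory_def open_trajectory_def)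

end

definition is_trajectory :: "(real \<Rightarrow> real) \<Rightarrow> bool" where
  "is_trajectory f \<longleftrightarrow> continuous_on {0..1} f \<and> f ` {0..1} \<subseteq> {-1..1}"

text \<open>Functions that are not trajectories are sent to the zero path; this value is immaterial.\<close>

definition trajectory_of :: "(real \<Rightarrow> real) \<Rightarrow> trajectory" where
  "trajectory_of f =
     Abs_trajectory (if is_trajectory f then restrict f {0..1} else (\<lambda>t\<in>{0..1}. 0))"

lemma path_trajectory_of:
  assumes "is_trajectory f" "t \<in> {0..1}"
  shows "path (trajectory_of f) t = f t"
proof -
  have "continuous_on {0..1} (restrict f {0..1})"
    using assms(1) unfolding is_trajectory_def
    by (auto intro: continuous_on_eq[of _ f])
  then have "path (Abs_trajectory (restrict f {0..1})) = restrict f {0..1}"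
    using assms(1) by (intro Abs_trajectory_inverse) (auto simp: is_trajectory_def)
  then show ?thesis
    using assms by (simp add: trajectory_of_def)
qed

section \<open>Random elements of the space of probability measures\<close>

text \<open>\<open>space (prob_algebra borel)\<close> is the set of Borel probability measures; only this carrier
  set of \<^const>\<open>prob_algebra\<close> is used. The topology is the coarsest one
  for which integration of every bounded continuous function is continuous.\<close>

definition weak_topology :: "'a::topological_space measure topology" where
  "weak_topology = topology_generated_by
     {{\<mu> \<in> space (prob_algebra borel). (\<integral>x. f x \<partial>\<mu>) \<in> U} | (f :: 'a \<Rightarrow> real) U.
        continuous_on UNIV f \<and> bounded (range f) \<and> open U}"

definition borel_of :: "'b topology \<Rightarrow> 'b measure" where
  "borel_of T = sigma (topspace T) {U. openin T U}"

text \<open>Sequences are indexed by \<open>n \<ge> 1\<close>, and the \<open>n\<close>-th random element lives on its own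
  probability space \<open>M n\<close>.\<close>

definition tight_sequence ::
    "'b topology \<Rightarrow> (nat \<Rightarrow> 'a measure) \<Rightarrow> (nat \<Rightarrow> 'a \<Rightarrow> 'b) \<Rightarrow> bool" where
  "tight_sequence T M X \<longleftrightarrow>
     (\<forall>\<delta>>0. \<exists>K. compactin T K \<and>
        (\<forall>n\<ge>1. measure (M n) {\<omega> \<in> space (M n). X n \<omega> \<in> K} \<ge> 1 - \<delta>))"

text \<open>Convergence in probability to a constant. For metrizable \<open>T\<close> one may take the
  balls around \<open>l\<close> as the neighbourhoods \<open>U\<close>.\<close>

definition converges_in_probability ::
    "'b topology \<Rightarrow> (nat \<Rightarrow> 'a measure) \<Rightarrow> (nat \<Rightarrow> 'a \<Rightarrow> 'b) \<Rightarrow> 'b \<Rightarrow> bool" where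
  "converges_in_probability T M X l \<longleftrightarrow>
     l \<in> topspace T \<and>
     (\<forall>U. openin T U \<and> l \<in> U \<longrightarrow>
        (\<lambda>n. measure (M n) {\<omega> \<in> space (M n). X n \<omega> \<notin> U}) \<longlonglongrightarrow> 0)"

section \<open>Permutation processes and trajectory processes\<close>

text \<open>The argument order is time, sample point for \<open>\<sigma>\<close>; only the times \<open>0, \<dots>, T\<close> matter.\<close>

definition random_permutation_process ::
    "nat \<Rightarrow> nat \<Rightarrow> 'a measure \<Rightarrow> (nat \<Rightarrow> 'a \<Rightarrow> nat \<Rightarrow> nat) \<Rightarrow> bool" where
  "random_permutation_process n T M \<sigma> \<longleftrightarrow>
     prob_space M \<and> T \<ge> 1 \<and>
     (\<forall>t\<le>T. \<sigma> t \<in> measurable M (count_space {p. p permutes {1..n}})) \<and>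
     (\<forall>\<omega>\<in>space M. \<sigma> 0 \<omega> = id)"

text \<open>The offset \<open>c \<in> [0,1]\<close> fixes where the label \<open>j\<close> is placed in its cell
  \<open>[2(j-1)/n - 1, 2j/n - 1]\<close>. The offset \<open>c = 0\<close> gives \<open>2j/n - 1\<close>. That grid is not symmetric
  about \<open>0\<close>: the average position of the particles is \<open>1/n\<close> at every time, so the sign reversal
  in the \<open>\<epsilon>\<close>-shift can never preserve the distribution. Stationarity under the shift is only
  possible for the symmetric grid \<open>c = 1/2\<close>, where the label \<open>n + 1 - j\<close> is placed opposite
  to \<open>j\<close>.\<close>

definition rescale :: "real \<Rightarrow> nat \<Rightarrow> nat \<Rightarrow> real" where
  "rescale c n j = 2 * (real j - c) / real n - 1"

text \<open>Linear interpolation of the values at the times \<open>k / T\<close>; at \<open>u = 1\<close> the term with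
  \<open>Suc k = Suc T\<close> has coefficient \<open>0\<close>.\<close>

definition particle_trajectory ::
    "real \<Rightarrow> nat \<Rightarrow> nat \<Rightarrow> (nat \<Rightarrow> nat \<Rightarrow> nat) \<Rightarrow> nat \<Rightarrow> trajectory" where
  "particle_trajectory c n T s i = trajectory_of (\<lambda>u.
     let k = nat \<lfloor>u * real T\<rfloor>; r = frac (u * real T)
     in (1 - r) * rescale c n (s k i) + r * rescale c n (s (Suc k) i))"

definition trajectory_process ::
    "real \<Rightarrow> nat \<Rightarrow> nat \<Rightarrow> (nat \<Rightarrow> nat \<Rightarrow> nat) \<Rightarrow> trajectory measure" where
  "trajectory_process c n T s =
     distr (measure_pmf (pmf_of_set {1..n})) borel (particle_trajectory c n T s)"

definition random_trajectory_process ::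
    "real \<Rightarrow> nat \<Rightarrow> 'a measure \<Rightarrow> ('a \<Rightarrow> trajectory measure) \<Rightarrow> bool" where
  "random_trajectory_process c n M X \<longleftrightarrow>
     (\<exists>T \<sigma>. random_permutation_process n T M \<sigma> \<and>
        (\<forall>\<omega>\<in>space M. X \<omega> = trajectory_process c n T (\<lambda>t. \<sigma> t \<omega>)))"

section \<open>Stationarity\<close>

definition shift_fun :: "real \<Rightarrow> (real \<Rightarrow> real) \<Rightarrow> real \<Rightarrow> real" where
  "shift_fun \<epsilon> x t = (-1) powi \<lfloor>\<epsilon> + t\<rfloor> * x (frac (\<epsilon> + t))"

definition shift :: "real \<Rightarrow> trajectory \<Rightarrow> trajectory" where
  "shift \<epsilon> x = trajectory_of (shift_fun \<epsilon> (path x))"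

text \<open>A shifted path may jump where the sign changes, and is then not in the path space. As the
  random trajectory process is supported on continuous paths, invariance of its distribution
  includes that almost all shifted paths are continuous.\<close>

definition stationary :: "real \<Rightarrow> 'a measure \<Rightarrow> ('a \<Rightarrow> trajectory measure) \<Rightarrow> bool" where
  "stationary \<epsilon> M X \<longleftrightarrow>
     (AE \<omega> in M. AE x in X \<omega>. is_trajectory (shift_fun \<epsilon> (path x))) \<and>
     distr M (borel_of weak_topology) (\<lambda>\<omega>. distr (X \<omega>) borel (shift \<epsilon>)) =
     distr M (borel_of weak_topology) X"

section \<open>The Archimedean process\<close>

definition archimedean_measure :: "(real \<times> real) measure" where
  "archimedean_measure = density lborel (\<lambda>(x, y).
     ennreal (if x\<^sup>2 + y\<^sup>2 < 1 then 1 / (2 * pi * sqrt (1 - x\<^sup>2 - y\<^sup>2)) else 0))"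

definition archimedean_process :: "trajectory measure" where
  "archimedean_process = distr archimedean_measure borel
     (\<lambda>(a, b). trajectory_of (\<lambda>t. cos (pi * t) * a + sin (pi * t) * b))"

end

theory Submission
  imports Defs "HOL-Real_Asymp.Real_Asymp"
begin

text \<open>In \<open>L\<^sup>2\<close> of the annealed law, the values \<open>X(t)\<close> have norm \<open>1/\<surd>3\<close> and, by stationarity, mutual
  angles \<open>\<theta>(s,t)\<close> depending only on \<open>t - s\<close>. The energy bound says \<open>\<theta>(s,t) \<le> \<pi> (t - s)\<close>, while
  \<open>X(1) = -X(0)\<close> says \<open>\<theta>(0,1) = \<pi>\<close>; hence \<open>X\<close> moves along a great circle, that is,
  \<open>X(t) = cos (\<pi> t) X(0) + sin (\<pi> t) X(1/2)\<close> in the limit. Each \<open>X(t)\<close> is uniform on \<open>[-1,1]\<close>,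
  even conditionally on the permutation process, so all projections of \<open>(X(0), X(1/2))\<close> are
  uniform. This determines the integrals of the functions \<open>exp (\<alpha> a + \<beta> b)\<close>, whose span is dense in
  the continuous functions on the square, so the law of the pair is the Archimedean measure. The
  limits are taken along the whole sequence in terms of second moments and tightness, without
  passing to subsequential limits.\<close>

section \<open>Angles of a stationary process\<close>

text \<open>The constant pi^2/3 is critical: a uniform variable on [-1,1] has second moment 1/3, and
  half a turn of a circle of squared radius 1/3 in unit time has squared speed pi^2/3. The half turn
  is forced, since for 0 < \<epsilon> < 1 the shift of a path is continuous only if X(1) = -X(0).
  Two obstacles shape the argument. For fixed n stationarity acts only along multiples of
  \<open>\<epsilon> n\<close>, so times are rounded down to such multiples, at the cost of a mean
  modulus of continuity that tightness makes uniformly small. And as the limit is deterministic, the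
  law averaged over the permutation process does not suffice: integrals against the random measure
  itself must concentrate. At time 0 they are not random at all, because the particles fill the
  grid; stationarity, applied to absolute deviations and not only to means, carries this to all
  times. All later replacements are L^1 errors, for which the averaged law is enough. Exponentials
  are the test functions because each depends on a single projection of (X(0), X(1/2)), where the
  marginal law is known, and because their products are again exponentials.\<close>

lemma arccos_triangle:
  fixes a b c :: real
  assumes psd: "\<And>u v w. 0 \<le> u\<^sup>2 + v\<^sup>2 + w\<^sup>2 + 2 * u * v * a + 2 * v * w * b + 2 * u * w * c"
  shows "arccos c \<le> arccos a + arccos b"
proof -
  have a1: "\<bar>a\<bar> \<le> 1" using psd[of 1 1 0] psd[of 1 "-1" 0] by (simp add: abs_le_iff)
  have b1: "\<bar>b\<bar> \<le> 1" using psd[of 0 1 1] psd[of 0 "-1" 1] by (simp add: abs_le_iff)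
  have c1: "\<bar>c\<bar> \<le> 1" using psd[of 1 0 1] psd[of "-1" 0 1] by (simp add: abs_le_iff)
  define A B where "A = sqrt (1 - a\<^sup>2)" and "B = sqrt (1 - b\<^sup>2)"
  have A2: "A\<^sup>2 = 1 - a\<^sup>2" and B2: "B\<^sup>2 = 1 - b\<^sup>2" and A0: "A \<ge> 0" and B0: "B \<ge> 0"
    using a1 b1 by (auto simp: A_def B_def abs_square_le_1)
  \<comment> \<open>The choice v = -(u a + w b) minimises the form over v: it projects the two outer
    unit vectors onto the complement of the middle one, leaving a form with diagonal A^2, B^2 and
    off-diagonal entry c - a b.\<close>
  have q: "0 \<le> u\<^sup>2 * A\<^sup>2 + w\<^sup>2 * B\<^sup>2 + 2 * u * w * (c - a * b)" for u w
    using psd[of u "- (u * a + w * b)" w] unfolding A2 B2 by (simp add: power2_eq_square algebra_simps)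
  \<comment> \<open>The right-hand side is cos (arccos a + arccos b), as A and B are the sines of
    the two angles. If A or B is 0, the form is linear in one variable, which forces c = a b;
    otherwise (u, w) = (B, A) gives the bound.\<close>
  have "c \<ge> a * b - A * B"
  proof (cases "A * B = 0")
    case True
    define d where "d = c - a * b"
    have "d = 0"
    proof -
      have "A = 0 \<or> B = 0" using True by simp
      then show ?thesis
      proof
        assume "A = 0"
        then have *: "0 \<le> w\<^sup>2 * B\<^sup>2 + 2 * u * w * d" for u w using q[of u w] by (simp add: d_def)
        show ?thesis
          using *[where w=1 and u="- (B\<^sup>2+1)/d"] zero_le_power2[of B]
          by (cases "d = 0") (auto simp del: zero_le_power2)
      next
        assume "B = 0"
        then have *: "0 \<le> u\<^sup>2 * A\<^sup>2 + 2 * u * w * d" for u w using q[of u w] by (simp add: d_def)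
        show ?thesis
          using *[where u=1 and w="- (A\<^sup>2+1)/d"] zero_le_power2[of A]
          by (cases "d = 0") (auto simp del: zero_le_power2)
      qed
    qed
    then have "c = a * b" by (simp add: d_def)
    then show ?thesis using True by linarith
  next
    case False
    then have "A * B > 0" using A0 B0 by (simp add: less_le)
    moreover have "0 \<le> 2 * (A * B) * (A * B + (c - a * b))"
      using q[of B A] by (simp add: power2_eq_square algebra_simps)
    ultimately have "0 \<le> A * B + (c - a * b)" by (simp add: zero_le_mult_iff)
    then show ?thesis by simp
  qed
  then have cos_le: "cos (arccos a + arccos b) \<le> c"
    using a1 b1 by (simp add: cos_add cos_arccos_abs sin_arccos_abs A_def B_def)
  have nn: "0 \<le> arccos a + arccos b"
    using a1 b1 arccos_lbound[of a] arccos_lbound[of b] by simp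
  show ?thesis
  proof (cases "arccos a + arccos b \<le> pi")
    case True
    have "arccos c \<le> arccos (cos (arccos a + arccos b))"
      using cos_le c1 by (intro arccos_le_arccos) auto
    also have "\<dots> = arccos a + arccos b" using True nn by (simp add: arccos_cos)
    finally show ?thesis .
  next
    case False
    then show ?thesis using arccos_ubound[of c] c1 by (simp add: abs_le_iff)
  qed
qed

lemma arccos_le_if_cos_le:
  assumes "cos y \<le> x" "x \<le> 1" "0 \<le> y" "y \<le> pi"
  shows "arccos x \<le> y"
proof -
  have "arccos x \<le> arccos (cos y)"
    using assms cos_ge_minus_one[of y] by (intro arccos_le_arccos) auto
  then show ?thesis using assms by (simp add: arccos_cos)
qed

text \<open>The values of the process at times \<open>s\<close> and \<open>t\<close> span asymptotically the angle
  \<open>\<theta>(s,t)\<close> in \<open>L\<^sup>2\<close>. The energy bound makes every short step cost at most \<open>\<pi>\<close> times its length,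
  while the antiperiodicity forces \<open>\<theta>(0,1) = \<pi>\<close>, so there is equality in the triangle inequality.\<close>

lemma stationary_kernel_limit:
  fixes c :: "nat \<Rightarrow> real \<Rightarrow> real \<Rightarrow> real"
  assumes sym: "\<And>n s t. c n s t = c n t s"
    and psd: "\<And>n r s t u v w. 1 \<le> n \<Longrightarrow> {r, s, t} \<subseteq> {0..1} \<Longrightarrow> 0 \<le> u\<^sup>2 * c n r r + v\<^sup>2 * c n s s + w\<^sup>2 * c n t t
       + 2 * u * v * c n r s + 2 * v * w * c n s t + 2 * u * w * c n r t"
    and diag: "\<And>t. t \<in> {0..1} \<Longrightarrow> (\<lambda>n. c n t t) \<longlonglongrightarrow> 1/3"
    and stat: "\<And>s h. 0 \<le> s \<Longrightarrow> 0 \<le> h \<Longrightarrow> s + h \<le> 1 \<Longrightarrow> (\<lambda>n. c n s (s + h) - c n 0 h) \<longlonglongrightarrow> 0"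
    and energy: "\<And>\<eta>. 0 < \<eta> \<Longrightarrow> eventually (\<lambda>h. eventually (\<lambda>n.
        c n 0 0 + c n h h - 2 * c n 0 h \<le> (pi\<^sup>2 / 3 + \<eta>) * h\<^sup>2) sequentially) (at_right 0)"
    and anti: "eventually (\<lambda>n. c n 0 1 = - c n 0 0 \<and> c n 1 1 = c n 0 0) sequentially"
    and st: "0 \<le> s" "s \<le> t" "t \<le> 1"
  shows "(\<lambda>n. c n s t) \<longlonglongrightarrow> cos (pi * (t - s)) / 3"
proof -
  \<comment> \<open>Normalising by the actual second moments, which only tend to 1/3, makes D a Gram
    matrix of unit vectors for each large n, so the triangle inequality for angles holds without
    error terms.\<close>
  define D where "D n s t = c n s t / sqrt (c n s s * c n t t)" for n s t
  have sqrt_ninth: "sqrt (1/3 * (1/3)) = (1/3::real)"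
    by (rule real_sqrt_unique) (simp_all add: power2_eq_square)
  define \<theta> where "\<theta> n s t = arccos (D n s t)" for n s t
  have pos: "eventually (\<lambda>n. c n t t > 0) sequentially" if "t \<in> {0..1}" for t
    using order_tendstoD(1)[OF diag[OF that], of 0] by simp
  have D_psd: "0 \<le> u\<^sup>2 + v\<^sup>2 + w\<^sup>2 + 2 * u * v * D n r s + 2 * v * w * D n s t + 2 * u * w * D n r t"
    if "{r, s, t} \<subseteq> {0..1}" "c n r r > 0" "c n s s > 0" "c n t t > 0" "1 \<le> n" for n r s t u v w
    using psd[OF that(5,1), of "u / sqrt (c n r r)" "v / sqrt (c n s s)" "w / sqrt (c n t t)"] that
    by (simp add: D_def power_divide real_sqrt_mult mult.assoc)
  have tri: "eventually (\<lambda>n. \<theta> n r t \<le> \<theta> n r s + \<theta> n s t) sequentially"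
    if "r \<in> {0..1}" "s \<in> {0..1}" "t \<in> {0..1}" for r s t
    using pos[OF that(1)] pos[OF that(2)] pos[OF that(3)] eventually_ge_at_top[of 1]
    by eventually_elim (use that in \<open>auto simp: \<theta>_def intro!: arccos_triangle D_psd\<close>)
  have D1: "eventually (\<lambda>n. \<bar>D n s t\<bar> \<le> 1) sequentially" if "s \<in> {0..1}" "t \<in> {0..1}" for s t
    using pos[OF that(1)] pos[OF that(2)] eventually_ge_at_top[of 1]
  proof eventually_elim
    case (elim n)
    show ?case using D_psd[of s t t n 1 1 0] D_psd[of s t t n 1 "-1" 0] elim that by (simp add: abs_le_iff)
  qed
  have refl: "eventually (\<lambda>n. \<theta> n t t = 0) sequentially" if "t \<in> {0..1}" for t
    using pos[OF that] by eventually_elim (simp add: \<theta>_def D_def)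
  \<comment> \<open>Stationarity and the energy bound give c n s (s + h) \<ge> 1/3 - (pi^2/3 +
    \<eta>) h^2 / 2 up to o(1). Division by 1/3 turns pi^2/3 + \<eta> into pi^2 + 3 \<eta>, and the
    strict gap to B^2 absorbs the o(1).\<close>
  have c_bound: "eventually (\<lambda>n. D n s (s + h) > 1 - B\<^sup>2 * h\<^sup>2 / 2) sequentially"
    if B: "B\<^sup>2 > pi\<^sup>2 + 3 * \<eta>" and "h > 0" "0 \<le> s" "s + h \<le> 1"
      and ev: "eventually (\<lambda>n. c n 0 0 + c n h h - 2 * c n 0 h \<le> (pi\<^sup>2 / 3 + \<eta>) * h\<^sup>2) sequentially" for B \<eta> s h
  proof -
    have mem: "s \<in> {0..1}" "s + h \<in> {0..1}" "h \<in> {0..1}" "0 \<in> {0..1::real}" using that by auto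
    have "(\<lambda>n. ((c n 0 0 + c n h h) / 2 - (pi\<^sup>2 / 3 + \<eta>) * h\<^sup>2 / 2 + (c n s (s + h) - c n 0 h)) / sqrt (c n s s * c n (s + h) (s + h)))
        \<longlonglongrightarrow> ((1/3 + 1/3) / 2 - (pi\<^sup>2 / 3 + \<eta>) * h\<^sup>2 / 2 + 0) / sqrt (1/3 * (1/3))"
      using mem that by (intro tendsto_intros diag stat) auto
    moreover have "((1/3 + 1/3) / 2 - (pi\<^sup>2 / 3 + \<eta>) * h\<^sup>2 / 2 + 0) / sqrt (1/3 * (1/3)) > 1 - B\<^sup>2 * h\<^sup>2 / 2"
    proof -
      have "(pi\<^sup>2 + 3 * \<eta>) * h\<^sup>2 < B\<^sup>2 * h\<^sup>2" using B \<open>h > 0\<close> by (intro mult_strict_right_mono) auto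
      then show ?thesis unfolding sqrt_ninth by (simp add: field_simps)
    qed
    ultimately have "eventually (\<lambda>n. ((c n 0 0 + c n h h) / 2 - (pi\<^sup>2 / 3 + \<eta>) * h\<^sup>2 / 2 + (c n s (s + h) - c n 0 h)) / sqrt (c n s s * c n (s + h) (s + h)) > 1 - B\<^sup>2 * h\<^sup>2 / 2) sequentially"
      by (rule order_tendstoD(1))
    with ev pos[OF mem(1)] pos[OF mem(2)] show ?thesis
    proof eventually_elim
      case (elim n)
      note elim(4)
      also have "((c n 0 0 + c n h h) / 2 - (pi\<^sup>2 / 3 + \<eta>) * h\<^sup>2 / 2 + (c n s (s + h) - c n 0 h)) / sqrt (c n s s * c n (s + h) (s + h)) \<le> D n s (s + h)"
        unfolding D_def using elim(1-3) by (intro divide_right_mono) (auto simp: field_simps)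
      finally show ?case .
    qed
  qed
  have step: "eventually (\<lambda>h. \<forall>s. 0 \<le> s \<and> s + h \<le> 1 \<longrightarrow> eventually (\<lambda>n. \<theta> n s (s + h) \<le> A * h) sequentially) (at_right 0)"
    if "A > pi" for A
  proof -
    \<comment> \<open>Two margins are needed: B above pi absorbs \<eta> and the convergence in n,
      and A above B is needed because 1 - cos (A h) equals A^2 h^2 / 2 only to leading order. The
      choice of \<eta> makes 3 \<eta> half of B^2 - pi^2.\<close>
    obtain B where B: "pi < B" "B < A" using dense[OF \<open>A > pi\<close>] by blast
    define \<eta> where "\<eta> = (B\<^sup>2 - pi\<^sup>2) / 6"
    have "pi\<^sup>2 < B\<^sup>2" using B by (intro power_strict_mono) auto
    then have \<eta>: "\<eta> > 0" "B\<^sup>2 > pi\<^sup>2 + 3 * \<eta>" by (auto simp: \<eta>_def field_simps)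
    have "B\<^sup>2 < A\<^sup>2" using B by (intro power_strict_mono) (auto intro: less_imp_le order.trans[OF pi_ge_zero])
    then have "eventually (\<lambda>h. cos (A * h) < 1 - B\<^sup>2 * h\<^sup>2 / 2) (at_right 0)"
    proof -
      have "((\<lambda>h. (1 - cos (A * h)) / h\<^sup>2) \<longlongrightarrow> A\<^sup>2 / 2) (at_right 0)"
        by (real_asymp simp: field_simps power2_eq_square)
      then have "eventually (\<lambda>h. (1 - cos (A * h)) / h\<^sup>2 > B\<^sup>2 / 2) (at_right 0)"
        by (rule order_tendstoD(1)) (use \<open>B\<^sup>2 < A\<^sup>2\<close> in simp)
      moreover have "eventually (\<lambda>h::real. h > 0) (at_right 0)" by (simp add: eventually_at_right_less)
      ultimately show ?thesis by eventually_elim (simp add: field_simps)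
    qed
    \<comment> \<open>The bound pi / A keeps A h in the interval on which arccos inverts
      cos.\<close>
    moreover have "eventually (\<lambda>h::real. h > 0 \<and> h < pi / A) (at_right 0)"
      using \<open>A > pi\<close> pi_gt_zero less_trans[OF pi_gt_zero \<open>A > pi\<close>]
      by (intro eventually_conj eventually_at_right_less eventually_at_rightI[of 0 "pi/A"]) auto
    ultimately show ?thesis using energy[OF \<eta>(1)]
    proof eventually_elim
      case (elim h)
      show ?case
      proof (intro allI impI)
        fix s assume s: "0 \<le> s \<and> s + h \<le> 1"
        have "A > 0" using \<open>A > pi\<close> pi_gt_zero by linarith
        have Ah: "0 \<le> A * h" "A * h \<le> pi" using \<open>A > 0\<close> elim(2) by (auto simp: field_simps)
        have "eventually (\<lambda>n. D n s (s + h) > 1 - B\<^sup>2 * h\<^sup>2 / 2) sequentially"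
          using elim s \<eta>(2) by (intro c_bound[of \<eta>]) auto
        moreover have "eventually (\<lambda>n. \<bar>D n s (s + h)\<bar> \<le> 1) sequentially"
          using s elim(2) by (intro D1) auto
        ultimately show "eventually (\<lambda>n. \<theta> n s (s + h) \<le> A * h) sequentially"
        proof eventually_elim
          case (elim n)
          then show ?case unfolding \<theta>_def using \<open>cos (A * h) < _\<close> Ah
            by (intro arccos_le_if_cos_le) auto
        qed
      qed
    qed
  qed
  have upper: "eventually (\<lambda>n. \<theta> n s t \<le> A * (t - s)) sequentially"
    if "A > pi" "0 \<le> s" "s \<le> t" "t \<le> 1" for A s t
  proof (cases "s = t")
    case True
    then show ?thesis using refl[of t] that by (auto elim: eventually_mono)
  next
    case False
    define d where "d = t - s"
    have "d > 0" using False that by (simp add: d_def)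
    \<comment> \<open>The admissible step size does not depend on the starting point. The threshold
      in n does, which is harmless because only m steps are chained.\<close>
    obtain h0 where h0: "h0 > 0" "\<And>h. 0 < h \<Longrightarrow> h < h0 \<Longrightarrow> \<forall>s. 0 \<le> s \<and> s + h \<le> 1 \<longrightarrow> eventually (\<lambda>n. \<theta> n s (s + h) \<le> A * h) sequentially"
      using step[OF \<open>A > pi\<close>] unfolding eventually_at_right_field by auto
    obtain m :: nat where m: "real m > d / h0" using reals_Archimedean2 by blast
    have "m > 0" using m \<open>d > 0\<close> h0(1) by (metis divide_pos_pos gr0I of_nat_0 order_less_asym)
    define h where "h = d / real m"
    have h: "0 < h" "h < h0" using \<open>m > 0\<close> \<open>d > 0\<close> m h0(1) by (auto simp: h_def field_simps)
    have "j \<le> m \<Longrightarrow> eventually (\<lambda>n. \<theta> n s (s + real j * h) \<le> A * (real j * h)) sequentially" for j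
    proof (induction j)
      case 0
      then show ?case using refl[of s] that by (auto elim: eventually_mono)
    next
      case (Suc j)
      have le: "s + real j * h + h \<le> 1"
      proof -
        have "(real j + 1) * h \<le> real m * h" using Suc.prems h by (intro mult_right_mono) auto
        also have "real m * h = d" using \<open>m > 0\<close> by (simp add: h_def)
        finally show ?thesis using that by (simp add: d_def algebra_simps)
      qed
      have ge: "0 \<le> s + real j * h" using that h by simp
      have "eventually (\<lambda>n. \<theta> n (s + real j * h) (s + real j * h + h) \<le> A * h) sequentially"
        using h0(2)[OF h] le ge by auto
      moreover have "eventually (\<lambda>n. \<theta> n s (s + real j * h) \<le> A * (real j * h)) sequentially"
        using Suc by simp
      moreover have "eventually (\<lambda>n. \<theta> n s (s + real j * h + h) \<le> \<theta> n s (s + real j * h) + \<theta> n (s + real j * h) (s + real j * h + h)) sequentially"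
        using le ge h that by (intro tri) auto
      ultimately show ?case
        by eventually_elim (simp add: algebra_simps)
    qed
    from this[of m] have "eventually (\<lambda>n. \<theta> n s (s + real m * h) \<le> A * (real m * h)) sequentially" by simp
    moreover have "real m * h = t - s" using \<open>m > 0\<close> by (simp add: h_def d_def)
    ultimately show ?thesis by simp
  qed
  have ends: "eventually (\<lambda>n. \<theta> n 0 1 = pi) sequentially"
    using anti pos[of 0, simplified] by eventually_elim (simp add: \<theta>_def D_def)
  have "(\<lambda>n. \<theta> n s t) \<longlonglongrightarrow> pi * (t - s)"
  proof (rule order_tendstoI)
    fix a assume "a < pi * (t - s)"
    \<comment> \<open>The angles over [0,s] and [t,1] exceed pi s and pi (1 - t) by at most e in
      total, so the angle over [s,t] falls short of pi (t - s) by at most e, half of the available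
      gap.\<close>
    define e where "e = (pi * (t - s) - a) / 2"
    have "e > 0" using \<open>a < _\<close> by (simp add: e_def)
    have "eventually (\<lambda>n. \<theta> n 0 s \<le> (pi + e) * (s - 0)) sequentially"
         "eventually (\<lambda>n. \<theta> n t 1 \<le> (pi + e) * (1 - t)) sequentially"
      using \<open>e > 0\<close> st by (intro upper; simp)+
    moreover have "eventually (\<lambda>n. \<theta> n 0 1 \<le> \<theta> n 0 s + \<theta> n s 1) sequentially"
      "eventually (\<lambda>n. \<theta> n s 1 \<le> \<theta> n s t + \<theta> n t 1) sequentially"
      using st by (intro tri; simp)+
    ultimately show "eventually (\<lambda>n. a < \<theta> n s t) sequentially" using ends
    proof eventually_elim
      case (elim n)
      then have "pi \<le> (pi + e) * s + \<theta> n s t + (pi + e) * (1 - t)" by simp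
      then have "\<theta> n s t \<ge> pi * (t - s) - e * (1 - (t - s))" by (simp add: algebra_simps)
      moreover have "e * (1 - (t - s)) \<le> e * 1" using \<open>e > 0\<close> st by (intro mult_left_mono) auto
      moreover have "a = pi * (t - s) - 2 * e" by (simp add: e_def field_simps)
      ultimately show ?case using \<open>e > 0\<close> by linarith
    qed
  next
    fix a assume "pi * (t - s) < a"
    define e where "e = (a - pi * (t - s)) / 2"
    have "e > 0" using \<open>_ < a\<close> by (simp add: e_def)
    have "eventually (\<lambda>n. \<theta> n s t \<le> (pi + e) * (t - s)) sequentially"
      using \<open>e > 0\<close> st by (intro upper) auto
    moreover have "(pi + e) * (t - s) < a"
    proof -
      have "e * (t - s) \<le> e * 1" using \<open>e > 0\<close> st by (intro mult_left_mono) auto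
      moreover have "a = pi * (t - s) + 2 * e" by (simp add: e_def field_simps)
      ultimately show ?thesis using \<open>e > 0\<close> by (simp add: algebra_simps)
    qed
    ultimately show "eventually (\<lambda>n. \<theta> n s t < a) sequentially"
      by (auto elim: eventually_mono)
  qed
  then have "(\<lambda>n. cos (\<theta> n s t)) \<longlonglongrightarrow> cos (pi * (t - s))" by (intro tendsto_intros)
  moreover have "(\<lambda>n. sqrt (c n s s * c n t t)) \<longlonglongrightarrow> sqrt (1/3 * (1/3))"
    using st by (intro tendsto_intros diag) auto
  then have "(\<lambda>n. sqrt (c n s s * c n t t)) \<longlonglongrightarrow> 1/3"
    unfolding sqrt_ninth .
  ultimately have lim: "(\<lambda>n. cos (\<theta> n s t) * sqrt (c n s s * c n t t)) \<longlonglongrightarrow> cos (pi * (t - s)) / 3"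
    using tendsto_mult[of "\<lambda>n. cos (\<theta> n s t)" "cos (pi * (t - s))" sequentially "\<lambda>n. sqrt (c n s s * c n t t)" "1/3"]
    by simp
  have "eventually (\<lambda>n. cos (\<theta> n s t) * sqrt (c n s s * c n t t) = c n s t) sequentially"
  proof -
    have "s \<in> {0..1}" "t \<in> {0..1}" using st by auto
    from D1[OF this] pos[OF this(1)] pos[OF this(2)] show ?thesis
      by eventually_elim (simp add: \<theta>_def cos_arccos_abs D_def)
  qed
  with lim show ?thesis by (rule Lim_transform_eventually)
qed

section \<open>The space of trajectories\<close>

lemma abs_path_diff_le_dist:
  assumes "t \<in> {0..1}"
  shows "\<bar>path x t - path y t\<bar> \<le> dist x y"
  unfolding dist_trajectory_def by (rule cSUP_upper[OF assms path_diff_bdd])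

lemma dist_trajectory_le:
  assumes "\<And>t. t \<in> {0..1} \<Longrightarrow> \<bar>path x t - path y t\<bar> \<le> e"
  shows "dist x y \<le> e"
  unfolding dist_trajectory_def by (rule cSUP_least) (use assms in auto)

lemma abs_path_le: "t \<in> {0..1} \<Longrightarrow> \<bar>path x t\<bar> \<le> 1"
  using path_range[of t x] by (auto simp: abs_le_iff)

lemma continuous_on_if_abs_diff_le:
  fixes f :: "'a::metric_space \<Rightarrow> real"
  assumes "\<And>x y. \<bar>f x - f y\<bar> \<le> L * dist x y" "0 \<le> L"
  shows "continuous_on S f"
  using assms by (intro lipschitz_on_continuous_on[of L] lipschitz_onI) (auto simp: dist_real_def)

lemma continuous_on_path_eval:
  assumes "t \<in> {0..1}"
  shows "continuous_on S (\<lambda>x. path x t)"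
  using abs_path_diff_le_dist[OF assms] by (intro continuous_on_if_abs_diff_le[of _ 1]) auto

lemma borel_measurable_path_eval [measurable]:
  assumes "t \<in> {0..1}"
  shows "(\<lambda>x. path x t) \<in> borel_measurable borel"
  using continuous_on_path_eval[OF assms] by (rule borel_measurable_continuous_onI)

text \<open>Modulus of continuity of the path. For h < 0 the index set is empty and the supremum
  carries no information, hence the side conditions \<open>0 \<le> h\<close> below.\<close>

definition modulus :: "real \<Rightarrow> trajectory \<Rightarrow> real" where
  "modulus h x = (SUP p\<in>{p\<in>{0..1}\<times>{0..1}. \<bar>fst p - snd p\<bar> \<le> h}. \<bar>path x (fst p) - path x (snd p)\<bar>)"

lemma modulus_upper:
  assumes "s \<in> {0..1}" "t \<in> {0..1}" "\<bar>s - t\<bar> \<le> h"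
  shows "\<bar>path x s - path x t\<bar> \<le> modulus h x"
proof -
  have "bdd_above ((\<lambda>p. \<bar>path x (fst p) - path x (snd p)\<bar>) ` {p\<in>{0..1}\<times>{0..1}. \<bar>fst p - snd p\<bar> \<le> h})"
  proof (rule bdd_aboveI2)
    fix p :: "real \<times> real" assume "p \<in> {p\<in>{0..1}\<times>{0..1}. \<bar>fst p - snd p\<bar> \<le> h}"
    then have "fst p \<in> {0..1}" "snd p \<in> {0..1}" by (auto simp: mem_Times_iff)
    from this[THEN abs_path_le, of x] show "\<bar>path x (fst p) - path x (snd p)\<bar> \<le> 2" by linarith
  qed
  from cSUP_upper[OF _ this, of "(s, t)"] show ?thesis
    using assms by (simp add: modulus_def)
qed

lemma modulus_least:
  assumes "0 \<le> h" "\<And>s t. s \<in> {0..1} \<Longrightarrow> t \<in> {0..1} \<Longrightarrow> \<bar>s - t\<bar> \<le> h \<Longrightarrow> \<bar>path x s - path x t\<bar> \<le> e"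
  shows "modulus h x \<le> e"
proof -
  have "(0, 0) \<in> {p\<in>{0..1}\<times>{0..1::real}. \<bar>fst p - snd p\<bar> \<le> h}" using assms(1) by simp
  then show ?thesis
    unfolding modulus_def by (intro cSUP_least) (blast, use assms(2) in \<open>auto simp: mem_Times_iff\<close>)
qed

lemma modulus_nonneg: "0 \<le> h \<Longrightarrow> 0 \<le> modulus h x"
  using modulus_upper[of 0 0 h x] by simp

lemma modulus_le_2:
  assumes "0 \<le> h"
  shows "modulus h x \<le> 2"
proof (rule modulus_least[OF assms])
  fix s t :: real assume "s \<in> {0..1}" "t \<in> {0..1}"
  from this[THEN abs_path_le, of x] show "\<bar>path x s - path x t\<bar> \<le> 2" by linarith
qed

lemma modulus_mono: "0 \<le> h \<Longrightarrow> h \<le> h' \<Longrightarrow> modulus h x \<le> modulus h' x"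
  by (rule modulus_least) (auto intro: modulus_upper)

text \<open>Moving a path by d changes each increment by at most 2 d. Together with the bound 2 this
  makes the mean modulus a weakly continuous functional of the law, so that compactness of a set of
  measures can act on it.\<close>

lemma continuous_on_modulus:
  assumes "0 \<le> h"
  shows "continuous_on S (modulus h)"
proof (rule continuous_on_if_abs_diff_le)
  have *: "modulus h x \<le> modulus h y + 2 * dist x y" for x y
  proof (rule modulus_least[OF assms])
    fix s t :: real assume st: "s \<in> {0..1}" "t \<in> {0..1}" "\<bar>s - t\<bar> \<le> h"
    show "\<bar>path x s - path x t\<bar> \<le> modulus h y + 2 * dist x y"
      using modulus_upper[OF st, of y] abs_path_diff_le_dist[OF st(1), of x y]
        abs_path_diff_le_dist[OF st(2), of x y] by linarith
  qed
  show "\<bar>modulus h x - modulus h y\<bar> \<le> 2 * dist x y" for x y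
    using *[of x y] *[of y x] by (simp add: dist_commute abs_le_iff)
qed simp

lemma borel_measurable_modulus [measurable]: "0 \<le> h \<Longrightarrow> modulus h \<in> borel_measurable borel"
  by (rule borel_measurable_continuous_onI) (rule continuous_on_modulus)

lemma modulus_tendsto_0: "(\<lambda>k. modulus (1 / (real k + 1)) x) \<longlonglongrightarrow> 0"
proof (rule LIMSEQ_I)
  fix e :: real assume "e > 0"
  have "uniformly_continuous_on {0..1} (path x)"
    by (intro compact_uniformly_continuous path_continuous) auto
  then obtain d where d: "d > 0" "\<And>s t. s \<in> {0..1} \<Longrightarrow> t \<in> {0..1} \<Longrightarrow> dist t s < d \<Longrightarrow> dist (path x t) (path x s) < e / 2"
    unfolding uniformly_continuous_on_def using \<open>e > 0\<close> by (meson half_gt_zero)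
  have "eventually (\<lambda>k. 1 / (real k + 1) < d) sequentially"
    using d(1) by real_asymp
  then obtain N where N: "\<And>k. k \<ge> N \<Longrightarrow> 1 / (real k + 1) < d" by (auto simp: eventually_at_top_linorder)
  have "modulus (1 / (real k + 1)) x \<le> e / 2" if "k \<ge> N" for k
    by (rule modulus_least) (use N[OF that] d(2) in \<open>force simp: dist_real_def\<close>)+
  then show "\<exists>N. \<forall>k\<ge>N. norm (modulus (1 / (real k + 1)) x - 0) < e"
    using \<open>e > 0\<close> by (intro exI[of _ N]) (fastforce simp: modulus_nonneg)
qed

lemma trajectory_of_cong:
  assumes "\<And>t. t \<in> {0..1} \<Longrightarrow> f t = g t"
  shows "trajectory_of f = trajectory_of g"
proof -
  have "is_trajectory f \<longleftrightarrow> is_trajectory g"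
    unfolding is_trajectory_def
    using continuous_on_cong[OF refl assms, of "{0..1}" "\<lambda>t. t"] image_cong[OF refl assms, of "{0..1}" "\<lambda>t. t"]
    by simp
  moreover have "restrict f {0..1} = restrict g {0..1}" using assms by (rule restrict_ext)
  ultimately show ?thesis by (simp add: trajectory_of_def)
qed

section \<open>Weak topology\<close>

lemma openin_weak_topology:
  fixes f :: "'a::topological_space \<Rightarrow> real"
  assumes "continuous_on UNIV f" "bounded (range f)" "open U"
  shows "openin weak_topology {\<mu> \<in> space (prob_algebra borel). (\<integral>x. f x \<partial>\<mu>) \<in> U}"
  unfolding weak_topology_def
  by (rule topology_generated_by_Basis) (use assms in blast)

lemma topspace_weak_topology: "topspace weak_topology = space (prob_algebra borel)"
proof
  show "topspace (weak_topology :: 'a measure topology) \<subseteq> space (prob_algebra borel)"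
    unfolding weak_topology_def topology_generated_by_topspace by blast
  \<comment> \<open>The constant function 0 with U = UNIV exhibits the whole carrier as a subbasic
    open set.\<close>
  have "openin (weak_topology :: 'a measure topology) {\<mu> \<in> space (prob_algebra borel). (\<integral>x. (\<lambda>_. 0::real) x \<partial>\<mu>) \<in> UNIV}"
    by (rule openin_weak_topology) auto
  then show "space (prob_algebra borel) \<subseteq> topspace (weak_topology :: 'a measure topology)"
    using openin_subset by force
qed

text \<open>Stationarity is an equality of laws on \<open>borel_of weak_topology\<close>. This lemma
  makes the integral of a bounded continuous function an observable to which that equality
  applies.\<close>

lemma measurable_weak_integral:
  fixes f :: "'a::topological_space \<Rightarrow> real"
  assumes "continuous_on UNIV f" "bounded (range f)"
  shows "(\<lambda>\<mu>. \<integral>x. f x \<partial>\<mu>) \<in> borel_measurable (borel_of weak_topology)"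
proof (rule borel_measurableI)
  fix U :: "real set" assume "open U"
  then have op: "openin weak_topology {\<mu> \<in> space (prob_algebra borel). (\<integral>x. f x \<partial>\<mu>) \<in> U}"
    using assms by (intro openin_weak_topology)
  have sub: "{U. openin (weak_topology :: 'a measure topology) U} \<subseteq> Pow (topspace weak_topology)"
    using openin_subset by blast
  have "space (borel_of (weak_topology :: 'a measure topology)) = space (prob_algebra borel)"
    using sub by (simp add: borel_of_def topspace_weak_topology)
  then have "(\<lambda>\<mu>. \<integral>x. f x \<partial>\<mu>) -` U \<inter> space (borel_of weak_topology)
      = {\<mu> \<in> space (prob_algebra borel). (\<integral>x. f x \<partial>\<mu>) \<in> U}" by auto
  also have "\<dots> \<in> sets (borel_of weak_topology)"
    unfolding borel_of_def using sub op by (simp add: sigma_sets.Basic)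
  finally show "(\<lambda>\<mu>. \<integral>x. f x \<partial>\<mu>) -` U \<inter> space (borel_of weak_topology) \<in> sets (borel_of weak_topology)" .
qed

text \<open>Dini's argument: on a compact set of measures the mean modulus decreases to \<open>0\<close> uniformly.\<close>

lemma compactin_modulus:
  assumes K: "compactin weak_topology K" and "0 < e"
  obtains h where "0 < h" "\<And>\<mu>. \<mu> \<in> K \<Longrightarrow> (\<integral>x. modulus h x \<partial>\<mu>) < e"
proof -
  define U where "U k = {\<mu> \<in> space (prob_algebra borel). (\<integral>x. modulus (1 / (real k + 1)) x \<partial>\<mu>) \<in> {..<e}}" for k :: nat
  have op: "openin weak_topology (U k)" for k
    unfolding U_def
    by (intro openin_weak_topology continuous_on_modulus boundedI[of _ 2])
       (auto simp: modulus_nonneg modulus_le_2)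
  have K_sub: "K \<subseteq> space (prob_algebra borel)"
    using compactin_subset_topspace[OF K] by (simp add: topspace_weak_topology)
  have "K \<subseteq> \<Union>(range U)"
  proof
    fix \<mu> assume "\<mu> \<in> K"
    then have \<mu>: "\<mu> \<in> space (prob_algebra borel)" using K_sub by blast
    then interpret \<mu>: prob_space \<mu> by (simp add: space_prob_algebra)
    have [measurable_cong]: "sets \<mu> = sets borel" using \<mu> by (simp add: space_prob_algebra)
    have "(\<lambda>k. \<integral>x. modulus (1 / (real k + 1)) x \<partial>\<mu>) \<longlonglongrightarrow> (\<integral>x. 0 \<partial>\<mu>)"
      by (rule integral_dominated_convergence[where w="\<lambda>_. 2"])
         (auto simp: modulus_tendsto_0 modulus_nonneg modulus_le_2)
    then have "eventually (\<lambda>k. (\<integral>x. modulus (1 / (real k + 1)) x \<partial>\<mu>) < e) sequentially"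
      using \<open>0 < e\<close> by (intro order_tendstoD(2)) auto
    then obtain k where "(\<integral>x. modulus (1 / (real k + 1)) x \<partial>\<mu>) < e"
      by (auto dest: eventually_happens)
    then show "\<mu> \<in> \<Union>(range U)" using \<mu> by (auto simp: U_def)
  qed
  with K obtain \<F> where \<F>: "finite \<F>" "\<F> \<subseteq> range U" "K \<subseteq> \<Union>\<F>"
    using op unfolding compactin_def by (metis rangeE)
  then obtain I where I: "finite I" "\<F> = U ` I" by (meson finite_subset_image)
  \<comment> \<open>The sets U k increase with k, since the modulus is monotone in h, so the largest
    index of the subcover serves all of K. \<open>insert 0\<close> keeps the argument of
    \<open>Max\<close> nonempty when the subcover is empty.\<close>
  define N where "N = Max (insert 0 I)"
  show thesis
  proof (rule that)
    show "0 < 1 / (real N + 1)" by simp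
    fix \<mu> assume "\<mu> \<in> K"
    then obtain k where k: "k \<in> I" "\<mu> \<in> U k" using \<F>(3) I(2) by blast
    then have "\<mu> \<in> space (prob_algebra borel)" by (simp add: U_def)
    then interpret \<mu>: prob_space \<mu> by (simp add: space_prob_algebra)
    have [measurable_cong]: "sets \<mu> = sets borel" using \<open>\<mu> \<in> space _\<close> by (simp add: space_prob_algebra)
    have int: "integrable \<mu> (modulus (1 / (real j + 1)))" for j :: nat
      by (rule \<mu>.integrable_const_bound[where B=2]) (auto simp: modulus_nonneg modulus_le_2)
    have "k \<le> N" using k I by (simp add: N_def)
    then have "(\<integral>x. modulus (1 / (real N + 1)) x \<partial>\<mu>) \<le> (\<integral>x. modulus (1 / (real k + 1)) x \<partial>\<mu>)"
      by (intro integral_mono int modulus_mono) (auto simp: field_simps)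
    also have "\<dots> < e" using k(2) by (simp add: U_def)
    finally show "(\<integral>x. modulus (1 / (real N + 1)) x \<partial>\<mu>) < e" .
  qed
qed

section \<open>Trajectories of particles\<close>

lemma rescale_mem:
  assumes "j \<in> {1..n}" "0 \<le> c" "c \<le> 1"
  shows "rescale c n j \<in> {-1..1}"
proof -
  have "0 \<le> 2 * (real j - c) / real n" "2 * (real j - c) / real n \<le> 2"
    using assms by (auto simp: field_simps)
  then show ?thesis by (simp add: rescale_def)
qed

text \<open>As a sum of clipped ramps the interpolation is visibly continuous in v, which floor and
  frac hide. At v = T the value \<open>a (Suc T)\<close> occurs on the left only with weight
  0.\<close>

lemma linear_interpolation_eq_sum:
  fixes a :: "nat \<Rightarrow> real"
  assumes "0 \<le> v" "v \<le> real T"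
  shows "(1 - frac v) * a (nat \<lfloor>v\<rfloor>) + frac v * a (Suc (nat \<lfloor>v\<rfloor>))
     = a 0 + (\<Sum>j<T. (a (Suc j) - a j) * max 0 (min 1 (v - real j)))"
  using assms
proof (induction T)
  case 0
  then show ?case by simp
next
  case (Suc T)
  show ?case
  proof (cases "v \<le> real T")
    case True
    then show ?thesis using Suc by simp
  next
    case False
    have "(\<Sum>j<T. (a (Suc j) - a j) * max 0 (min 1 (v - real j))) = (\<Sum>j<T. a (Suc j) - a j)"
      using False by (intro sum.cong) auto
    also have "\<dots> = a T - a 0" by (rule sum_lessThan_telescope)
    finally have *: "(\<Sum>j<T. (a (Suc j) - a j) * max 0 (min 1 (v - real j))) = a T - a 0" .
    show ?thesis
    proof (cases "v = real (Suc T)")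
      case True
      then have fr: "frac v = 0" and fl: "nat \<lfloor>v\<rfloor> = Suc T" by (auto simp: frac_eq_0_iff)
      show ?thesis unfolding fr fl using * by (simp add: True)
    next
      case False
      then have fl: "\<lfloor>v\<rfloor> = int T" using \<open>\<not> v \<le> real T\<close> Suc.prems by (intro floor_unique) auto
      then have "v - real T = frac v" by (simp add: frac_def)
      then have m: "max 0 (min 1 (v - real T)) = frac v" by (simp add: frac_lt_1 less_imp_le)
      show ?thesis unfolding sum.lessThan_Suc * m fl by (simp add: algebra_simps)
    qed
  qed
qed

lemma is_trajectory_particle:
  assumes s: "\<And>k. k \<le> T \<Longrightarrow> s k permutes {1..n}" and i: "i \<in> {1..n}" and c: "0 \<le> c" "c \<le> 1"
  shows "is_trajectory (\<lambda>u. let k = nat \<lfloor>u * real T\<rfloor>; r = frac (u * real T)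
     in (1 - r) * rescale c n (s k i) + r * rescale c n (s (Suc k) i))"
    (is "is_trajectory ?f")
  unfolding is_trajectory_def
proof
  define a where "a k = rescale c n (s k i)" for k
  have uT: "0 \<le> u * real T" "u * real T \<le> real T" if "u \<in> {0..1}" for u
    using that by (auto simp: mult_left_le_one_le)
  have f_eq: "?f u = a 0 + (\<Sum>j<T. (a (Suc j) - a j) * max 0 (min 1 (u * real T - real j)))" if "u \<in> {0..1}" for u
    using linear_interpolation_eq_sum[OF uT[OF that], of a] by (simp add: a_def Let_def)
  have "continuous_on {0..1} (\<lambda>u. a 0 + (\<Sum>j<T. (a (Suc j) - a j) * max 0 (min 1 (u * real T - real j))))"
    by (intro continuous_intros)
  then show "continuous_on {0..1} ?f" by (rule continuous_on_eq) (simp only: f_eq)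
  have a: "a k \<in> {-1..1}" if "k \<le> T" for k
    unfolding a_def using permutes_in_image[OF s[OF that], of i] i c by (intro rescale_mem) auto
  show "?f ` {0..1} \<subseteq> {-1..1}"
  proof (rule image_subsetI)
    fix u :: real assume u: "u \<in> {0..1}"
    define k r where "k = nat \<lfloor>u * real T\<rfloor>" and "r = frac (u * real T)"
    have r: "0 \<le> r" "r \<le> 1" by (simp_all add: r_def frac_lt_1 less_imp_le)
    have k: "k \<le> T" using uT[OF u] by (simp add: k_def nat_le_iff floor_le_iff)
    have "(1 - r) * a k + r * a (Suc k) \<in> {-1..1}"
    \<comment> \<open>\<open>s (Suc T)\<close> need not be a permutation. The index k = T occurs
      only when u T = T, and then r = 0; for r \<noteq> 0 both values are grid positions and the
      interpolation is a convex combination of them.\<close>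
    proof (cases "r = 0")
      case True
      then show ?thesis using a[OF k] by simp
    next
      case False
      have "k \<noteq> T"
      proof
        assume "k = T"
        have "real k \<le> u * real T" using uT[OF u] by (simp add: k_def)
        then have "u * real T = real T" using uT[OF u] \<open>k = T\<close> by simp
        then have "r = frac (real T)" by (simp only: r_def)
        then show False using False by simp
      qed
      then have "a (Suc k) \<in> {-1..1}" using k by (intro a) auto
      then show ?thesis
        using a[OF k] r convex_real_interval(5)[of "-1" "1::real", unfolded convex_def]
        by (auto simp only: real_scaleR_def)
    qed
    then show "?f u \<in> {-1..1}" by (simp add: Let_def k_def r_def a_def)
  qed
qed

lemma path_particle_trajectory_0:
  assumes "\<And>k. k \<le> T \<Longrightarrow> s k permutes {1..n}" "i \<in> {1..n}" "0 \<le> c" "c \<le> 1"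
  shows "path (particle_trajectory c n T s i) 0 = rescale c n (s 0 i)"
  unfolding particle_trajectory_def
  by (subst path_trajectory_of[OF is_trajectory_particle]) (use assms in auto)

text \<open>The successor of the last time enters the interpolation formula only with weight 0.
  Hence a trajectory is a function of the finite sequence of permutations at times 0, ...,
  T.\<close>

lemma particle_trajectory_cong:
  assumes "\<And>k. k \<le> T \<Longrightarrow> s k = s' k"
  shows "particle_trajectory c n T s i = particle_trajectory c n T s' i"
  unfolding particle_trajectory_def
proof (rule trajectory_of_cong)
  fix u :: real assume u: "u \<in> {0..1}"
  define k r where "k = nat \<lfloor>u * real T\<rfloor>" and "r = frac (u * real T)"
  have uT: "0 \<le> u * real T" "u * real T \<le> real T"
    using u by (auto simp: mult_left_le_one_le)
  then have k: "k \<le> T" by (simp add: k_def nat_le_iff floor_le_iff)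
  have "r = 0 \<or> Suc k \<le> T"
  proof (cases "k = T")
    case True
    have "real k \<le> u * real T" using uT by (simp add: k_def)
    then have "u * real T = real T" using uT True by simp
    then have "r = frac (real T)" by (simp only: r_def)
    then show ?thesis by simp
  qed (use k in simp)
  then show "(let k = nat \<lfloor>u * real T\<rfloor>; r = frac (u * real T)
       in (1 - r) * rescale c n (s k i) + r * rescale c n (s (Suc k) i)) =
     (let k = nat \<lfloor>u * real T\<rfloor>; r = frac (u * real T)
       in (1 - r) * rescale c n (s' k i) + r * rescale c n (s' (Suc k) i))"
    unfolding Let_def k_def[symmetric] r_def[symmetric] using assms k by auto
qed

lemma trajectory_process_prob_algebra:
  "trajectory_process c n T s \<in> space (prob_algebra borel)"
  unfolding trajectory_process_def space_prob_algebra
  by (auto intro!: prob_space.prob_space_distr measure_pmf.prob_space_axioms)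

section \<open>Discrete random measures\<close>

text \<open>Measurability with respect to the discrete \<open>\<sigma>\<close>-algebra holds because a permutation process has
  finitely many values; it makes every functional of \<open>X\<close> measurable.\<close>

locale discrete_random_measure = prob_space M for M +
  fixes X :: "'a \<Rightarrow> 'b::topological_space measure"
  assumes X_measurable: "X \<in> M \<rightarrow>\<^sub>M count_space (space (prob_algebra borel))"
begin

text \<open>The mean measure of X. For trajectories it averages over the process and the particle at
  once, like the expectation in the energy condition; integrals against \<open>X \<omega>\<close>
  for fixed \<omega> are called quenched below.\<close>

definition annealed :: "'b measure" where
  "annealed = M \<bind> X"

lemma measurable_compose_X:
  assumes "\<And>\<mu>. \<mu> \<in> space (prob_algebra borel) \<Longrightarrow> F \<mu> \<in> space N"
  shows "(\<lambda>\<omega>. F (X \<omega>)) \<in> M \<rightarrow>\<^sub>M N"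
  by (rule measurable_compose[OF X_measurable]) (use assms in auto)

lemma borel_measurable_compose_X: "(\<lambda>\<omega>. F (X \<omega>)) \<in> borel_measurable M"
  by (rule measurable_compose_X) simp

lemma X_in: "\<omega> \<in> space M \<Longrightarrow> X \<omega> \<in> space (prob_algebra borel)"
  using measurable_space[OF X_measurable] by simp

lemma prob_space_X: "\<omega> \<in> space M \<Longrightarrow> prob_space (X \<omega>)"
  and sets_X: "\<omega> \<in> space M \<Longrightarrow> sets (X \<omega>) = sets borel"
  using X_in by (auto simp: space_prob_algebra)

lemma X_kernel: "X \<in> M \<rightarrow>\<^sub>M subprob_algebra borel"
  using measurable_compose_X[of "\<lambda>\<mu>. \<mu>" "subprob_algebra borel"]
  by (simp add: space_prob_algebra space_subprob_algebra prob_space_imp_subprob_space)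

lemma prob_space_annealed: "prob_space annealed"
  unfolding annealed_def by (rule prob_space_bind[OF _ X_kernel]) (simp add: prob_space_X)

lemma sets_annealed [simp, measurable_cong]: "sets annealed = sets borel"
  unfolding annealed_def by (rule sets_bind[OF _ not_empty]) (simp add: sets_X)

lemma AE_annealed:
  assumes "Measurable.pred borel P"
  shows "(AE x in annealed. P x) \<longleftrightarrow> (AE \<omega> in M. AE x in X \<omega>. P x)"
  unfolding annealed_def by (rule AE_bind[OF X_kernel assms])

lemma integral_annealed:
  fixes f :: "'b \<Rightarrow> real"
  assumes "f \<in> borel_measurable borel" "\<And>x. \<bar>f x\<bar> \<le> B"
  shows "(\<integral>x. f x \<partial>annealed) = (\<integral>\<omega>. (\<integral>x. f x \<partial>X \<omega>) \<partial>M)"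
  unfolding annealed_def
  by (rule integral_bind[where B=B and B'=1 and K=borel])
     (use assms X_kernel prob_space_X in \<open>auto simp: finite_measure_axioms prob_space.emeasure_space_1\<close>)

lemma integrable_annealed:
  fixes f :: "'b \<Rightarrow> real"
  assumes "f \<in> borel_measurable borel" "\<And>x. \<bar>f x\<bar> \<le> B"
  shows "integrable annealed f"
proof -
  interpret A: prob_space annealed by (rule prob_space_annealed)
  show ?thesis using assms by (intro A.integrable_const_bound[where B=B]) auto
qed

lemma integrable_X:
  fixes f :: "'b \<Rightarrow> real"
  assumes "\<omega> \<in> space M" "f \<in> borel_measurable borel" "\<And>x. \<bar>f x\<bar> \<le> B"
  shows "integrable (X \<omega>) f"
proof -
  interpret A: prob_space "X \<omega>" by (rule prob_space_X[OF assms(1)])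
  show ?thesis using assms(2,3) sets_X[OF assms(1)]
    by (intro A.integrable_const_bound[where B=B]) (auto cong: measurable_cong_sets)
qed

lemma abs_integral_X_le:
  fixes f :: "'b \<Rightarrow> real"
  assumes "\<omega> \<in> space M" "f \<in> borel_measurable borel" "\<And>x. \<bar>f x\<bar> \<le> B"
  shows "\<bar>\<integral>x. f x \<partial>X \<omega>\<bar> \<le> B"
proof -
  interpret A: prob_space "X \<omega>" by (rule prob_space_X[OF assms(1)])
  have "\<bar>\<integral>x. f x \<partial>X \<omega>\<bar> \<le> (\<integral>x. \<bar>f x\<bar> \<partial>X \<omega>)" by (rule integral_abs_bound)
  also have "\<dots> \<le> (\<integral>x. B \<partial>X \<omega>)"
    using assms by (intro integral_mono integrable_abs integrable_X) auto
  finally show ?thesis by (simp add: A.prob_space)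
qed

lemma integrable_integral_X:
  fixes f :: "'b \<Rightarrow> real"
  assumes "f \<in> borel_measurable borel" "\<And>x. \<bar>f x\<bar> \<le> B"
  shows "integrable M (\<lambda>\<omega>. \<integral>x. f x \<partial>X \<omega>)"
  by (rule integrable_const_bound[where B=B])
     (use abs_integral_X_le[OF _ assms] borel_measurable_compose_X in auto)

text \<open>The quenched integrals of f and g differ by at most the quenched integral of \<bar>f -
  g\<bar>, whose mean over M is an annealed integral. So a test function may be replaced inside a
  quenched deviation at a cost that is measured under the annealed law only.\<close>

lemma mean_deviation_approx:
  fixes f g :: "'b \<Rightarrow> real"
  assumes f: "f \<in> borel_measurable borel" "\<And>x. \<bar>f x\<bar> \<le> B"
    and g: "g \<in> borel_measurable borel" "\<And>x. \<bar>g x\<bar> \<le> B'"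
  shows "(\<integral>\<omega>. \<bar>(\<integral>x. f x \<partial>X \<omega>) - a\<bar> \<partial>M)
    \<le> (\<integral>\<omega>. \<bar>(\<integral>x. g x \<partial>X \<omega>) - b\<bar> \<partial>M) + (\<integral>x. \<bar>f x - g x\<bar> \<partial>annealed) + \<bar>a - b\<bar>"
proof -
  have [measurable]: "f \<in> borel_measurable borel" "g \<in> borel_measurable borel" by fact+
  have fg: "(\<lambda>x. \<bar>f x - g x\<bar>) \<in> borel_measurable borel" "\<And>x. \<bar>\<bar>f x - g x\<bar>\<bar> \<le> B + B'"
    using f(2) g(2) by (auto intro!: order.trans[OF abs_triangle_ineq4] add_mono)
  have int_f: "integrable M (\<lambda>\<omega>. \<bar>(\<integral>x. f x \<partial>X \<omega>) - a\<bar>)"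
    by (intro integrable_abs Bochner_Integration.integrable_diff integrable_integral_X[OF f]) simp
  have int_g: "integrable M (\<lambda>\<omega>. \<bar>(\<integral>x. g x \<partial>X \<omega>) - b\<bar>)"
    by (intro integrable_abs Bochner_Integration.integrable_diff integrable_integral_X[OF g]) simp
  have "(\<integral>\<omega>. \<bar>(\<integral>x. f x \<partial>X \<omega>) - a\<bar> \<partial>M)
     \<le> (\<integral>\<omega>. \<bar>(\<integral>x. g x \<partial>X \<omega>) - b\<bar> + (\<integral>x. \<bar>f x - g x\<bar> \<partial>X \<omega>) + \<bar>a - b\<bar> \<partial>M)"
  proof (intro integral_mono int_f Bochner_Integration.integrable_add int_g integrable_integral_X[OF fg])
    fix \<omega> assume \<omega>: "\<omega> \<in> space M"
    have "(\<integral>x. f x \<partial>X \<omega>) - (\<integral>x. g x \<partial>X \<omega>) = (\<integral>x. f x - g x \<partial>X \<omega>)"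
      using integrable_X[OF \<omega> f] integrable_X[OF \<omega> g] by simp
    then have "\<bar>(\<integral>x. f x \<partial>X \<omega>) - (\<integral>x. g x \<partial>X \<omega>)\<bar> \<le> (\<integral>x. \<bar>f x - g x\<bar> \<partial>X \<omega>)"
      by (simp only: integral_abs_bound)
    then show "\<bar>(\<integral>x. f x \<partial>X \<omega>) - a\<bar> \<le> \<bar>(\<integral>x. g x \<partial>X \<omega>) - b\<bar> + (\<integral>x. \<bar>f x - g x\<bar> \<partial>X \<omega>) + \<bar>a - b\<bar>"
      by linarith
  qed simp
  also have "\<dots> = (\<integral>\<omega>. \<bar>(\<integral>x. g x \<partial>X \<omega>) - b\<bar> \<partial>M) + (\<integral>\<omega>. (\<integral>x. \<bar>f x - g x\<bar> \<partial>X \<omega>) \<partial>M) + \<bar>a - b\<bar>"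
    using int_g integrable_integral_X[OF fg] by (simp add: prob_space)
  finally show ?thesis by (simp add: integral_annealed[OF fg])
qed

end

text \<open>\<open>X \<omega>\<close> depends only on the permutations at times 0, ..., T, which
  take finitely many joint values r. Hence {X \<in> A} is a finite union of events prescribing all
  these permutations, whatever the set A of measures.\<close>

lemma random_trajectory_process_discrete:
  assumes "random_trajectory_process c n M X"
  shows "discrete_random_measure M X"
proof -
  from assms obtain T \<sigma> where rp: "random_permutation_process n T M \<sigma>"
    and X: "\<And>\<omega>. \<omega> \<in> space M \<Longrightarrow> X \<omega> = trajectory_process c n T (\<lambda>t. \<sigma> t \<omega>)"
    by (auto simp: random_trajectory_process_def)
  interpret prob_space M using rp by (simp add: random_permutation_process_def)
  define S where "S = {p. p permutes {1..n}}"
  have \<sigma>: "\<sigma> t \<in> M \<rightarrow>\<^sub>M count_space S" if "t \<le> T" for t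
    using rp that by (simp add: random_permutation_process_def S_def)
  have "finite S" unfolding S_def by (rule finite_permutations) simp
  have X_meas: "{\<omega> \<in> space M. X \<omega> \<in> A} \<in> sets M" for A
  proof -
    define R where "R = {r \<in> {..T} \<rightarrow>\<^sub>E S. trajectory_process c n T r \<in> A}"
    have "finite R" unfolding R_def using \<open>finite S\<close> by (intro finite_subset[OF _ finite_PiE[of "{..T}" "\<lambda>_. S"]]) auto
    have "{\<omega> \<in> space M. X \<omega> \<in> A} = (\<Union>r\<in>R. {\<omega> \<in> space M. \<forall>t\<in>{..T}. \<sigma> t \<omega> = r t})"
    proof (intro equalityI subsetI)
      fix \<omega> assume \<omega>: "\<omega> \<in> {\<omega> \<in> space M. X \<omega> \<in> A}"
      define r where "r = restrict (\<lambda>t. \<sigma> t \<omega>) {..T}"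
      have "trajectory_process c n T r = X \<omega>"
      proof -
        have "particle_trajectory c n T r = particle_trajectory c n T (\<lambda>t. \<sigma> t \<omega>)"
          by (rule ext, rule particle_trajectory_cong) (simp add: r_def)
        then show ?thesis using X \<omega> by (simp add: trajectory_process_def)
      qed
      moreover have "r \<in> {..T} \<rightarrow>\<^sub>E S"
        using \<omega> measurable_space[OF \<sigma>] by (auto simp: r_def)
      ultimately have "r \<in> R" using \<omega> by (simp add: R_def)
      then show "\<omega> \<in> (\<Union>r\<in>R. {\<omega> \<in> space M. \<forall>t\<in>{..T}. \<sigma> t \<omega> = r t})"
        using \<omega> by (intro UN_I[of r]) (auto simp: r_def)
    next
      fix \<omega> assume "\<omega> \<in> (\<Union>r\<in>R. {\<omega> \<in> space M. \<forall>t\<in>{..T}. \<sigma> t \<omega> = r t})"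
      then obtain r where r: "r \<in> R" "\<omega> \<in> space M" "\<And>t. t \<le> T \<Longrightarrow> \<sigma> t \<omega> = r t" by auto
      have "particle_trajectory c n T r = particle_trajectory c n T (\<lambda>t. \<sigma> t \<omega>)"
        by (rule ext, rule particle_trajectory_cong) (simp add: r)
      then have "trajectory_process c n T r = X \<omega>"
        using X[OF r(2)] by (simp add: trajectory_process_def)
      then show "\<omega> \<in> {\<omega> \<in> space M. X \<omega> \<in> A}" using r by (simp add: R_def)
    qed
    also have "\<dots> \<in> sets M"
    proof (intro sets.finite_UN \<open>finite R\<close> sets.sets_Collect_finite_All)
      fix r t assume r: "r \<in> R" and t: "t \<in> {..T}"
      then have "r t \<in> S" by (auto simp: R_def)
      have "\<sigma> t -` {r t} \<inter> space M \<in> sets M"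
        by (rule measurable_sets[OF \<sigma>]) (use t \<open>r t \<in> S\<close> in auto)
      also have "\<sigma> t -` {r t} \<inter> space M = {\<omega> \<in> space M. \<sigma> t \<omega> = r t}" by auto
      finally show "{\<omega> \<in> space M. \<sigma> t \<omega> = r t} \<in> sets M" .
    qed simp
    finally show ?thesis .
  qed
  show ?thesis
  proof
    show "X \<in> M \<rightarrow>\<^sub>M count_space (space (prob_algebra borel))"
    proof (rule measurableI)
      fix A :: "trajectory measure set"
      have "X -` A \<inter> space M = {\<omega> \<in> space M. X \<omega> \<in> A}" by auto
      then show "X -` A \<inter> space M \<in> sets M" using X_meas by simp
    qed (simp add: X trajectory_process_prob_algebra)
  qed
qed

text \<open>As \<open>\<sigma> 0\<close> is the identity, every grid position is occupied exactly
  once at time 0, so the time-0 marginal is the same for all \<omega>. The concentration of quenched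
  integrals at other times is derived from this.\<close>

lemma random_trajectory_process_initial:
  fixes \<phi> :: "real \<Rightarrow> real"
  assumes "random_trajectory_process c n M X" "1 \<le> n" "0 \<le> c" "c \<le> 1" "\<omega> \<in> space M"
    and [measurable]: "\<phi> \<in> borel_measurable borel"
  shows "(\<integral>x. \<phi> (path x 0) \<partial>X \<omega>) = (\<Sum>i=1..n. \<phi> (rescale c n i)) / real n"
proof -
  from assms obtain T \<sigma> where rp: "random_permutation_process n T M \<sigma>"
    and X: "X \<omega> = trajectory_process c n T (\<lambda>t. \<sigma> t \<omega>)"
    by (auto simp: random_trajectory_process_def)
  have perm: "\<sigma> t \<omega> permutes {1..n}" if "t \<le> T" for t
  proof -
    have "\<sigma> t \<in> M \<rightarrow>\<^sub>M count_space {p. p permutes {1..n}}"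
      using rp that by (simp add: random_permutation_process_def)
    from measurable_space[OF this assms(5)] show ?thesis by simp
  qed
  have init: "\<sigma> 0 \<omega> = id" using rp assms(5) by (simp add: random_permutation_process_def)
  have "(\<integral>x. \<phi> (path x 0) \<partial>X \<omega>) = (\<integral>i. \<phi> (path (particle_trajectory c n T (\<lambda>t. \<sigma> t \<omega>) i) 0) \<partial>measure_pmf (pmf_of_set {1..n}))"
    unfolding X trajectory_process_def by (subst integral_distr) auto
  also have "\<dots> = (\<Sum>i=1..n. \<phi> (path (particle_trajectory c n T (\<lambda>t. \<sigma> t \<omega>) i) 0)) / real n"
    using assms(2) by (subst integral_pmf_of_set) auto
  also have "(\<Sum>i=1..n. \<phi> (path (particle_trajectory c n T (\<lambda>t. \<sigma> t \<omega>) i) 0)) = (\<Sum>i=1..n. \<phi> (rescale c n i))"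
    by (intro sum.cong refl, subst path_particle_trajectory_0[OF perm])
       (use assms init in auto)
  finally show ?thesis .
qed

text \<open>Each cell of length 2/n contains its grid point, because c \<in> [0,1], and by the mean
  value theorem a point z at which \<phi> equals its cell average. The Lipschitz bound compares the
  two at a cost of 4 L / n^2 per cell; the final halving passes from length 2 to the uniform
  law.\<close>

lemma rescale_Riemann_sum:
  fixes \<phi> \<Phi> :: "real \<Rightarrow> real"
  assumes n: "1 \<le> n" and c: "0 \<le> c" "c \<le> 1"
    and der: "\<And>u. -1 \<le> u \<Longrightarrow> u \<le> 1 \<Longrightarrow> (\<Phi> has_real_derivative \<phi> u) (at u)"
    and lip: "\<And>u v. u \<in> {-1..1} \<Longrightarrow> v \<in> {-1..1} \<Longrightarrow> \<bar>\<phi> u - \<phi> v\<bar> \<le> L * \<bar>u - v\<bar>" and "0 \<le> L"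
  shows "\<bar>(\<Sum>i=1..n. \<phi> (rescale c n i)) / real n - (\<Phi> 1 - \<Phi> (-1)) / 2\<bar> \<le> 2 * L / real n"
proof -
  define y where "y i = 2 * real i / real n - 1" for i :: nat
  have step: "\<bar>2 / real n * \<phi> (rescale c n i) - (\<Phi> (y i) - \<Phi> (y (i - 1)))\<bar> \<le> 4 * L / (real n)\<^sup>2" if i: "i \<in> {1..n}" for i
  proof -
    have y: "y i - y (i - 1) = 2 / real n" "-1 \<le> y (i - 1)" "y i \<le> 1"
      using i by (auto simp: y_def field_simps of_nat_diff)
    have lt: "y (i - 1) < y i" using y n by (smt (verit) divide_pos_pos of_nat_0_less_iff less_le_trans zero_less_one)
    have "\<exists>z. y (i - 1) < z \<and> z < y i \<and> \<Phi> (y i) - \<Phi> (y (i - 1)) = (y i - y (i - 1)) * \<phi> z"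
      by (rule MVT2[OF lt]) (use der y in auto)
    then obtain z where z: "y (i - 1) < z" "z < y i" "\<Phi> (y i) - \<Phi> (y (i - 1)) = 2 / real n * \<phi> z"
      using y(1) by auto
    have r: "y (i - 1) \<le> rescale c n i" "rescale c n i \<le> y i"
      using i c by (auto simp: y_def rescale_def field_simps of_nat_diff)
    have "\<bar>\<phi> (rescale c n i) - \<phi> z\<bar> \<le> L * \<bar>rescale c n i - z\<bar>"
      using r z y by (intro lip) auto
    also have "\<dots> \<le> L * (2 / real n)" using r z y \<open>0 \<le> L\<close> by (intro mult_left_mono) auto
    finally have "2 / real n * \<bar>\<phi> (rescale c n i) - \<phi> z\<bar> \<le> 2 / real n * (L * (2 / real n))"
      by (intro mult_left_mono) auto
    moreover have "2 / real n * \<bar>\<phi> (rescale c n i) - \<phi> z\<bar> = \<bar>2 / real n * \<phi> (rescale c n i) - (\<Phi> (y i) - \<Phi> (y (i - 1)))\<bar>"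
      unfolding z(3) by (simp only: right_diff_distrib[symmetric] abs_mult) simp
    ultimately show ?thesis by (simp add: power2_eq_square)
  qed
  have tele: "(\<Sum>i=1..n. \<Phi> (y i) - \<Phi> (y (i - 1))) = \<Phi> 1 - \<Phi> (-1)"
  proof -
    have "(\<Sum>i=1..m. \<Phi> (y i) - \<Phi> (y (i - 1))) = \<Phi> (y m) - \<Phi> (y 0)" for m
      by (induction m) auto
    from this[of n] show ?thesis using n by (simp add: y_def)
  qed
  have "\<bar>(\<Sum>i=1..n. 2 / real n * \<phi> (rescale c n i)) - (\<Phi> 1 - \<Phi> (-1))\<bar>
     = \<bar>\<Sum>i=1..n. 2 / real n * \<phi> (rescale c n i) - (\<Phi> (y i) - \<Phi> (y (i - 1)))\<bar>"
    unfolding tele[symmetric] by (simp only: sum_subtractf)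
  also have "\<dots> \<le> (\<Sum>i=1..n. 4 * L / (real n)\<^sup>2)"
    by (rule order.trans[OF sum_abs sum_mono[OF step]])
  also have "\<dots> = 4 * L / real n" using n by (simp add: power2_eq_square)
  finally have "\<bar>2 / real n * (\<Sum>i=1..n. \<phi> (rescale c n i)) - (\<Phi> 1 - \<Phi> (-1))\<bar> \<le> 4 * L / real n"
    by (simp add: sum_distrib_left)
  then have "\<bar>(1/2) * (2 / real n * (\<Sum>i=1..n. \<phi> (rescale c n i)) - (\<Phi> 1 - \<Phi> (-1)))\<bar> \<le> (1/2) * (4 * L / real n)"
    unfolding abs_mult by simp
  then show ?thesis by (simp add: algebra_simps diff_divide_distrib)
qed

text \<open>Maps built with \<open>trajectory_of\<close> jump to a default path when their argument
  is no trajectory, so they are not continuous. They are continuous on the closed set of good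
  arguments and constant outside it.\<close>

lemma borel_measurable_closed_piecewise:
  fixes f :: "'a::topological_space \<Rightarrow> 'b::metric_space"
  assumes "closed A" "continuous_on A f" "\<And>x. x \<notin> A \<Longrightarrow> f x = z"
  shows "f \<in> borel_measurable borel"
proof -
  have pred: "{x \<in> space borel. x \<in> A} \<in> sets borel" using assms(1) by simp
  have "(\<lambda>x. if x \<in> A then f x else z) \<in> borel_measurable borel"
    unfolding measurable_If_restrict_space_iff[OF pred]
    using borel_measurable_continuous_on_restrict[OF assms(2)] by simp
  moreover have "(\<lambda>x. if x \<in> A then f x else z) = f" using assms(3) by auto
  ultimately show ?thesis by simp
qed

text \<open>The antiperiodic extension of a path to the real line. On it the shift acts as a
  translation, so shifts can be iterated without tracking when a time leaves [0,1]. At r = 1 it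
  gives -x(0), the value of the path only if the path is antiperiodic.\<close>

definition extend :: "trajectory \<Rightarrow> real \<Rightarrow> real" where
  "extend x r = (-1) powi \<lfloor>r\<rfloor> * path x (frac r)"

lemma frac_mem: "frac r \<in> {0..1}"
  by (simp add: frac_lt_1 less_imp_le)

lemma continuous_on_extend: "continuous_on S (\<lambda>x. extend x r)"
  unfolding extend_def by (intro continuous_intros continuous_on_path_eval frac_mem)

lemma abs_extend_le: "\<bar>extend x r\<bar> \<le> 1"
  using abs_path_le[OF frac_mem] by (simp add: extend_def abs_mult power_int_abs)

lemma extend_eq_path:
  assumes "path x 1 = - path x 0" "r \<in> {0..1}"
  shows "extend x r = path x r"
proof (cases "r = 1")
  case False
  then have "\<lfloor>r\<rfloor> = 0" using assms(2) by (intro floor_unique) auto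
  moreover have "frac r = r" using False assms(2) by (simp add: frac_eq)
  ultimately show ?thesis by (simp add: extend_def)
qed (use assms(1) in \<open>simp add: extend_def\<close>)

lemma extend_shift:
  assumes "is_trajectory (shift_fun \<epsilon> (path x))"
  shows "extend (shift \<epsilon> x) r = extend x (r + \<epsilon>)"
proof -
  have r: "r + \<epsilon> = (\<epsilon> + frac r) + of_int \<lfloor>r\<rfloor>" by (simp add: frac_def)
  have frac_shift: "frac (a + of_int z) = frac a" for a :: real and z by (simp add: frac_def)
  have fl: "\<lfloor>r + \<epsilon>\<rfloor> = \<lfloor>r\<rfloor> + \<lfloor>\<epsilon> + frac r\<rfloor>" unfolding r by simp
  have fr: "frac (r + \<epsilon>) = frac (\<epsilon> + frac r)" unfolding r by (rule frac_shift)
  have "path (shift \<epsilon> x) (frac r) = shift_fun \<epsilon> (path x) (frac r)"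
    unfolding shift_def using assms frac_mem by (rule path_trajectory_of)
  then show ?thesis
    by (simp add: extend_def fl fr shift_fun_def power_int_add mult.assoc)
qed

text \<open>The shifted path consists of x(\<epsilon> + t) before the seam t = 1 - \<epsilon> and of
  -x(\<epsilon> + t - 1) from there on. The one-sided limits at the seam are x(1) and -x(0), so
  continuity there is exactly antiperiodicity. This is how stationarity yields X(1) = -X(0).\<close>

lemma is_trajectory_shift_iff:
  assumes \<epsilon>: "0 < \<epsilon>" "\<epsilon> < 1"
  shows "is_trajectory (shift_fun \<epsilon> (path x)) \<longleftrightarrow> path x 1 = - path x 0"
proof
  have lo: "shift_fun \<epsilon> (path x) t = path x (\<epsilon> + t)" if "t \<in> {0..<1 - \<epsilon>}" for t
  proof -
    have "\<lfloor>\<epsilon> + t\<rfloor> = 0" using that \<epsilon> by (intro floor_unique) auto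
    then show ?thesis by (simp add: shift_fun_def frac_def)
  qed
  have hi: "shift_fun \<epsilon> (path x) t = - path x (\<epsilon> + t - 1)" if "t \<in> {1 - \<epsilon>..1}" for t
  proof -
    have "\<lfloor>\<epsilon> + t\<rfloor> = 1" using that \<epsilon> by (intro floor_unique) auto
    then show ?thesis by (simp add: shift_fun_def frac_def)
  qed
  have cont: "continuous_on {0..1 - \<epsilon>} (\<lambda>t. path x (\<epsilon> + t))"
    by (rule continuous_on_compose2[OF path_continuous]) (use \<epsilon> in \<open>auto intro!: continuous_intros\<close>)
  have hi_end: "shift_fun \<epsilon> (path x) (1 - \<epsilon>) = - path x 0" using hi[of "1 - \<epsilon>"] \<epsilon> by simp
  {
    assume *: "is_trajectory (shift_fun \<epsilon> (path x))"
    have cl: "closure {0..<1 - \<epsilon>} = {0..1 - \<epsilon>}" using \<epsilon> by (simp add: closure_atLeastLessThan)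
    have "continuous_on {0..1 - \<epsilon>} (shift_fun \<epsilon> (path x))"
      using * \<epsilon> by (auto simp: is_trajectory_def intro: continuous_on_subset)
    then have "continuous_on (closure {0..<1 - \<epsilon>}) (\<lambda>t. shift_fun \<epsilon> (path x) t - path x (\<epsilon> + t))"
      unfolding cl using cont by (intro continuous_intros)
    then have "shift_fun \<epsilon> (path x) (1 - \<epsilon>) - path x (\<epsilon> + (1 - \<epsilon>)) = 0"
      by (rule continuous_constant_on_closure) (use lo \<epsilon> cl in auto)
    then show "path x 1 = - path x 0" using hi_end by simp
  next
    assume *: "path x 1 = - path x 0"
    have "continuous_on {0..1 - \<epsilon>} (shift_fun \<epsilon> (path x))"
    proof (rule continuous_on_eq[OF cont])
      fix t assume "t \<in> {0..1 - \<epsilon>}"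
      then show "path x (\<epsilon> + t) = shift_fun \<epsilon> (path x) t"
        using lo[of t] hi_end * by (cases "t = 1 - \<epsilon>") auto
    qed
    moreover have "continuous_on {1 - \<epsilon>..1} (shift_fun \<epsilon> (path x))"
    proof (rule continuous_on_eq)
      show "continuous_on {1 - \<epsilon>..1} (\<lambda>t. - path x (\<epsilon> + t - 1))"
        by (intro continuous_on_minus continuous_on_compose2[OF path_continuous])
           (use \<epsilon> in \<open>auto intro!: continuous_intros\<close>)
    qed (simp add: hi)
    ultimately have "continuous_on ({0..1 - \<epsilon>} \<union> {1 - \<epsilon>..1}) (shift_fun \<epsilon> (path x))"
      by (intro continuous_on_closed_Un) auto
    moreover have "{0..1 - \<epsilon>} \<union> {1 - \<epsilon>..1} = {0..1}" using \<epsilon> by auto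
    moreover have "\<bar>shift_fun \<epsilon> (path x) t\<bar> \<le> 1" for t
      using abs_path_le[OF frac_mem] by (simp add: shift_fun_def abs_mult power_int_abs)
    ultimately show "is_trajectory (shift_fun \<epsilon> (path x))"
      by (auto simp: is_trajectory_def abs_le_iff minus_le_iff)
  }
qed

lemma closed_antiperiodic: "closed {x. path x 1 = - path x 0}"
  by (intro closed_Collect_eq continuous_intros continuous_on_path_eval) auto

text \<open>On the closed set of antiperiodic paths the shift does not increase distances, since it
  only rearranges values and changes signs; outside that set it is constantly the default
  path.\<close>

lemma borel_measurable_shift:
  assumes \<epsilon>: "0 < \<epsilon>" "\<epsilon> < 1"
  shows "shift \<epsilon> \<in> borel_measurable borel"
proof (rule borel_measurable_closed_piecewise[OF closed_antiperiodic])
  have "dist (shift \<epsilon> x) (shift \<epsilon> y) \<le> dist x y"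
    if "path x 1 = - path x 0" "path y 1 = - path y 0" for x y
  proof (rule dist_trajectory_le)
    fix t :: real assume t: "t \<in> {0..1}"
    have "path (shift \<epsilon> z) t = shift_fun \<epsilon> (path z) t" if "path z 1 = - path z 0" for z
      unfolding shift_def using t that is_trajectory_shift_iff[OF \<epsilon>] by (intro path_trajectory_of) auto
    then have "\<bar>path (shift \<epsilon> x) t - path (shift \<epsilon> y) t\<bar>
        = \<bar>(-1) powi \<lfloor>\<epsilon> + t\<rfloor> * (path x (frac (\<epsilon> + t)) - path y (frac (\<epsilon> + t)))\<bar>"
      using that by (simp add: shift_fun_def right_diff_distrib)
    also have "\<dots> \<le> dist x y"
      using abs_path_diff_le_dist[OF frac_mem] by (simp add: abs_mult power_int_abs)
    finally show "\<bar>path (shift \<epsilon> x) t - path (shift \<epsilon> y) t\<bar> \<le> dist x y" .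
  qed
  then show "continuous_on {x. path x 1 = - path x 0} (shift \<epsilon>)"
    by (intro lipschitz_on_continuous_on[of 1] lipschitz_onI) auto
  show "shift \<epsilon> x = Abs_trajectory (\<lambda>t\<in>{0..1}. 0)" if "x \<notin> {x. path x 1 = - path x 0}" for x
    using that is_trajectory_shift_iff[OF \<epsilon>] by (simp add: shift_def trajectory_of_def)
qed

section \<open>Stationary processes\<close>

locale random_trajectories = discrete_random_measure M X
  for M :: "'a measure" and X :: "'a \<Rightarrow> trajectory measure"
begin

text \<open>The inner product of the values at s and t in L^2 of the annealed law, without centring
  or normalisation.\<close>

definition corr :: "real \<Rightarrow> real \<Rightarrow> real" where
  "corr s t = (\<integral>x. path x s * path x t \<partial>annealed)"

lemma corr_commute: "corr s t = corr t s"
  by (simp add: corr_def mult.commute)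

lemma integrable_path_mult:
  assumes "s \<in> {0..1}" "t \<in> {0..1}"
  shows "integrable annealed (\<lambda>x. path x s * path x t)"
  by (rule integrable_annealed[where B=1])
     (use assms abs_path_le in \<open>auto simp: abs_mult intro!: mult_le_one\<close>)

text \<open>Used in three ways: positivity of the left side makes \<open>corr\<close> positive
  semidefinite, weights -1, 1 give the energy, and weights -cos, -sin, 1 give the squared distance
  from a great circle.\<close>

lemma integral_quadratic:
  assumes "r \<in> {0..1}" "s \<in> {0..1}" "t \<in> {0..1}"
  shows "(\<integral>x. (u * path x r + v * path x s + w * path x t)\<^sup>2 \<partial>annealed)
    = u\<^sup>2 * corr r r + v\<^sup>2 * corr s s + w\<^sup>2 * corr t t
      + 2 * u * v * corr r s + 2 * v * w * corr s t + 2 * u * w * corr r t"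
proof -
  note int [simp] = integrable_path_mult[OF assms(1) assms(1)] integrable_path_mult[OF assms(2) assms(2)]
    integrable_path_mult[OF assms(3) assms(3)] integrable_path_mult[OF assms(1) assms(2)]
    integrable_path_mult[OF assms(2) assms(3)] integrable_path_mult[OF assms(1) assms(3)]
  have "(u * path x r + v * path x s + w * path x t)\<^sup>2
     = u\<^sup>2 * (path x r * path x r) + v\<^sup>2 * (path x s * path x s) + w\<^sup>2 * (path x t * path x t)
      + 2 * u * v * (path x r * path x s) + 2 * v * w * (path x s * path x t) + 2 * u * w * (path x r * path x t)" for x
    by (simp add: power2_eq_square algebra_simps)
  then show ?thesis by (simp add: corr_def)
qed

end

text \<open>The bound \<epsilon> < 1 places the seam of the shifted path inside (0,1). Along a
  sequence with \<open>\<epsilon> n\<close> tending to 0 it holds for all large n.\<close>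

locale stationary_random_trajectories = random_trajectories M X
  for M :: "'a measure" and X :: "'a \<Rightarrow> trajectory measure" +
  fixes \<epsilon> :: real
  assumes stationary: "stationary \<epsilon> M X" and \<epsilon>: "0 < \<epsilon>" "\<epsilon> < 1"
begin

lemma AE_X_antiperiodic: "AE \<omega> in M. AE x in X \<omega>. path x 1 = - path x 0"
  using stationary by (simp add: stationary_def is_trajectory_shift_iff[OF \<epsilon>])

lemma AE_antiperiodic: "AE x in annealed. path x 1 = - path x 0"
proof -
  have "Measurable.pred borel (\<lambda>x. path x 1 = - path x 0)"
    using closed_antiperiodic by (simp add: pred_def)
  then show ?thesis using AE_X_antiperiodic by (simp add: AE_annealed)
qed

text \<open>Stationarity concerns the law of the random measure, so nonlinear functions F of a
  quenched integral are invariant as well; F u = \<bar>u - l\<bar> is what later transports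
  concentration in time. Two times r and s are needed for second moments.\<close>

lemma integral_shift_invariant:
  fixes G :: "real \<times> real \<Rightarrow> real" and F :: "real \<Rightarrow> real"
  assumes G: "continuous_on UNIV G" and F: "F \<in> borel_measurable borel"
  shows "(\<integral>\<omega>. F (\<integral>x. G (extend x r, extend x s) \<partial>X \<omega>) \<partial>M)
    = (\<integral>\<omega>. F (\<integral>x. G (extend x (r + \<epsilon>), extend x (s + \<epsilon>)) \<partial>X \<omega>) \<partial>M)"
proof -
  note [measurable] = F
  define g where "g x = G (extend x r, extend x s)" for x
  have g: "continuous_on UNIV g"
    unfolding g_def
    by (rule continuous_on_compose2[OF G]) (auto intro!: continuous_intros continuous_on_extend)
  have "bounded (G ` ({-1..1} \<times> {-1..1}))"
    by (intro compact_imp_bounded compact_continuous_image continuous_on_subset[OF G] compact_Times) auto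
  moreover have "range g \<subseteq> G ` ({-1..1} \<times> {-1..1})"
    using abs_extend_le by (auto simp: g_def abs_le_iff minus_le_iff)
  ultimately have "bounded (range g)" by (rule bounded_subset)
  have sp: "space (borel_of (weak_topology :: trajectory measure topology)) = space (prob_algebra borel)"
    using openin_subset[of weak_topology] unfolding borel_of_def topspace_weak_topology[symmetric]
    by (intro space_measure_of) blast
  note [measurable] = measurable_weak_integral[OF g \<open>bounded (range g)\<close>]
  have S: "shift \<epsilon> \<in> borel_measurable borel" by (rule borel_measurable_shift[OF \<epsilon>])
  have [measurable]: "X \<in> M \<rightarrow>\<^sub>M borel_of weak_topology"
    using measurable_compose_X[of "\<lambda>\<mu>. \<mu>" "borel_of weak_topology"] by (simp add: sp)
  have [measurable]: "(\<lambda>\<omega>. distr (X \<omega>) borel (shift \<epsilon>)) \<in> M \<rightarrow>\<^sub>M borel_of weak_topology"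
  proof (rule measurable_compose_X)
    fix \<mu> :: "trajectory measure" assume "\<mu> \<in> space (prob_algebra borel)"
    then show "distr \<mu> borel (shift \<epsilon>) \<in> space (borel_of weak_topology)"
      using S unfolding sp
      by (auto simp: space_prob_algebra intro!: prob_space.prob_space_distr cong: measurable_cong_sets)
  qed
  have "(\<integral>\<omega>. F (\<integral>x. g x \<partial>X \<omega>) \<partial>M) = (\<integral>\<mu>. F (\<integral>x. g x \<partial>\<mu>) \<partial>distr M (borel_of weak_topology) X)"
    by (subst integral_distr) auto
  also have "\<dots> = (\<integral>\<mu>. F (\<integral>x. g x \<partial>\<mu>) \<partial>distr M (borel_of weak_topology) (\<lambda>\<omega>. distr (X \<omega>) borel (shift \<epsilon>)))"
    using stationary by (simp add: stationary_def)
  also have "\<dots> = (\<integral>\<omega>. F (\<integral>x. g x \<partial>distr (X \<omega>) borel (shift \<epsilon>)) \<partial>M)"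
    by (subst integral_distr) auto
  also have "\<dots> = (\<integral>\<omega>. F (\<integral>x. G (extend x (r + \<epsilon>), extend x (s + \<epsilon>)) \<partial>X \<omega>) \<partial>M)"
  proof (rule integral_cong_AE)
    show "AE \<omega> in M. F (\<integral>x. g x \<partial>distr (X \<omega>) borel (shift \<epsilon>)) = F (\<integral>x. G (extend x (r + \<epsilon>), extend x (s + \<epsilon>)) \<partial>X \<omega>)"
      using AE_X_antiperiodic
    proof (rule AE_mp, intro AE_I2 impI)
      fix \<omega> assume \<omega>: "\<omega> \<in> space M" and ae: "AE x in X \<omega>. path x 1 = - path x 0"
      note [measurable_cong] = sets_X[OF \<omega>]
      note [measurable] = S borel_measurable_continuous_onI[OF g]
      have ext: "(\<lambda>x. G (extend x (r + \<epsilon>), extend x (s + \<epsilon>))) \<in> borel_measurable borel"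
        by (intro borel_measurable_continuous_onI continuous_on_compose2[OF G])
           (auto intro!: continuous_intros continuous_on_extend)
      have "(\<integral>x. g x \<partial>distr (X \<omega>) borel (shift \<epsilon>)) = (\<integral>x. g (shift \<epsilon> x) \<partial>X \<omega>)"
        by (subst integral_distr) auto
      also have "\<dots> = (\<integral>x. G (extend x (r + \<epsilon>), extend x (s + \<epsilon>)) \<partial>X \<omega>)"
      proof (rule integral_cong_AE)
        show "AE x in X \<omega>. g (shift \<epsilon> x) = G (extend x (r + \<epsilon>), extend x (s + \<epsilon>))"
          using ae by eventually_elim (simp add: g_def extend_shift is_trajectory_shift_iff[OF \<epsilon>])
      qed (use ext in measurable)
      finally show "F (\<integral>x. g x \<partial>distr (X \<omega>) borel (shift \<epsilon>)) = F (\<integral>x. G (extend x (r + \<epsilon>), extend x (s + \<epsilon>)) \<partial>X \<omega>)"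
        by simp
    qed
  qed (rule borel_measurable_compose_X)+
  finally show ?thesis by (simp add: g_def)
qed

text \<open>The k shifts are performed on the antiperiodic extension, where intermediate times are
  unrestricted. Only at the two ends, where all times lie in [0,1], is the extension replaced by the
  path itself.\<close>

lemma integral_path_invariant:
  fixes G :: "real \<times> real \<Rightarrow> real" and F :: "real \<Rightarrow> real"
  assumes G: "continuous_on UNIV G" and F: "F \<in> borel_measurable borel"
    and r: "0 \<le> r" "r + real k * \<epsilon> \<le> 1" and s: "0 \<le> s" "s + real k * \<epsilon> \<le> 1"
  shows "(\<integral>\<omega>. F (\<integral>x. G (path x r, path x s) \<partial>X \<omega>) \<partial>M)
    = (\<integral>\<omega>. F (\<integral>x. G (path x (r + real k * \<epsilon>), path x (s + real k * \<epsilon>)) \<partial>X \<omega>) \<partial>M)"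
proof -
  have ext: "(\<integral>\<omega>. F (\<integral>x. G (extend x r, extend x s) \<partial>X \<omega>) \<partial>M)
      = (\<integral>\<omega>. F (\<integral>x. G (path x r, path x s) \<partial>X \<omega>) \<partial>M)" if "r \<in> {0..1}" "s \<in> {0..1}" for r s
  proof (rule integral_cong_AE)
    show "AE \<omega> in M. F (\<integral>x. G (extend x r, extend x s) \<partial>X \<omega>) = F (\<integral>x. G (path x r, path x s) \<partial>X \<omega>)"
      using AE_X_antiperiodic
    proof (rule AE_mp, intro AE_I2 impI)
      fix \<omega> assume \<omega>: "\<omega> \<in> space M" and ae: "AE x in X \<omega>. path x 1 = - path x 0"
      note [measurable_cong] = sets_X[OF \<omega>]
      have "(\<lambda>x. G (extend x r, extend x s)) \<in> borel_measurable borel"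
        "(\<lambda>x. G (path x r, path x s)) \<in> borel_measurable borel"
        by (intro borel_measurable_continuous_onI continuous_on_compose2[OF G],
            use that in \<open>auto intro!: continuous_intros continuous_on_extend continuous_on_path_eval\<close>)+
      then have "(\<integral>x. G (extend x r, extend x s) \<partial>X \<omega>) = (\<integral>x. G (path x r, path x s) \<partial>X \<omega>)"
        by (intro integral_cong_AE AE_mp[OF ae AE_I2]) (use that in \<open>auto simp: extend_eq_path\<close>)
      then show "F (\<integral>x. G (extend x r, extend x s) \<partial>X \<omega>) = F (\<integral>x. G (path x r, path x s) \<partial>X \<omega>)" by simp
    qed
  qed (rule borel_measurable_compose_X)+
  have "(\<integral>\<omega>. F (\<integral>x. G (extend x r, extend x s) \<partial>X \<omega>) \<partial>M)
    = (\<integral>\<omega>. F (\<integral>x. G (extend x (r + real k * \<epsilon>), extend x (s + real k * \<epsilon>)) \<partial>X \<omega>) \<partial>M)"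
  proof (induction k)
    case (Suc k)
    then show ?case
      using integral_shift_invariant[OF G F, of "r + real k * \<epsilon>" "s + real k * \<epsilon>"]
      by (simp add: algebra_simps)
  qed simp
  moreover have "0 \<le> real k * \<epsilon>" using \<epsilon> by simp
  ultimately show ?thesis using ext[of r s] ext[of "r + real k * \<epsilon>" "s + real k * \<epsilon>"] r s by simp
qed

lemma obtain_multiple:
  assumes "0 \<le> t"
  obtains k where "real k * \<epsilon> \<le> t" "t - real k * \<epsilon> \<le> \<epsilon>"
proof
  have le: "real (nat \<lfloor>t / \<epsilon>\<rfloor>) \<le> t / \<epsilon>" "t / \<epsilon> \<le> real (nat \<lfloor>t / \<epsilon>\<rfloor>) + 1"
    using assms \<epsilon> by (auto simp: of_nat_nat)
  show "real (nat \<lfloor>t / \<epsilon>\<rfloor>) * \<epsilon> \<le> t" using le(1) \<epsilon> by (simp add: field_simps)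
  show "t - real (nat \<lfloor>t / \<epsilon>\<rfloor>) * \<epsilon> \<le> \<epsilon>" using le(2) \<epsilon> by (simp add: field_simps)
qed

lemma integral_modulus_nonneg: "0 \<le> h \<Longrightarrow> 0 \<le> (\<integral>x. modulus h x \<partial>annealed)"
  by (intro Bochner_Integration.integral_nonneg modulus_nonneg)

lemma integrable_modulus: "0 \<le> h \<Longrightarrow> integrable annealed (modulus h)"
  by (rule integrable_annealed[where B=2]) (auto simp: modulus_nonneg modulus_le_2)

lemma corr_antiperiodic: "corr 0 1 = - corr 0 0" "corr 1 1 = corr 0 0"
proof -
  have "corr 0 1 = (\<integral>x. - (path x 0 * path x 0) \<partial>annealed)"
    unfolding corr_def by (intro integral_cong_AE AE_mp[OF AE_antiperiodic AE_I2]) auto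
  then show "corr 0 1 = - corr 0 0" by (simp add: corr_def)
  show "corr 1 1 = corr 0 0"
    unfolding corr_def by (intro integral_cong_AE AE_mp[OF AE_antiperiodic AE_I2]) auto
qed

lemma corr_invariant:
  assumes "0 \<le> r" "r + real k * \<epsilon> \<le> 1" "0 \<le> s" "s + real k * \<epsilon> \<le> 1"
  shows "corr (r + real k * \<epsilon>) (s + real k * \<epsilon>) = corr r s"
proof -
  have eq: "corr r s = (\<integral>\<omega>. (\<integral>x. path x r * path x s \<partial>X \<omega>) \<partial>M)" if "r \<in> {0..1}" "s \<in> {0..1}" for r s
    unfolding corr_def
    by (rule integral_annealed[where B=1])
       (use that abs_path_le in \<open>auto simp: abs_mult intro!: mult_le_one\<close>)
  have "0 \<le> real k * \<epsilon>" using \<epsilon> by simp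
  then show ?thesis
    using integral_path_invariant[of "\<lambda>p. fst p * snd p" "\<lambda>u. u" r k s] assms
    by (simp add: eq continuous_intros)
qed

text \<open>With s' the multiple of \<epsilon> just below s, the kernel at (s', s' + h) equals that
  at (0, h). Moving both times by at most \<epsilon> changes one factor of the product after the
  other while the remaining factor is at most 1, hence the constant 2.\<close>

lemma corr_approx_stationary:
  assumes "0 \<le> s" "0 \<le> h" "s + h \<le> 1"
  shows "\<bar>corr s (s + h) - corr 0 h\<bar> \<le> 2 * (\<integral>x. modulus \<epsilon> x \<partial>annealed)"
proof -
  obtain k where k: "real k * \<epsilon> \<le> s" "s - real k * \<epsilon> \<le> \<epsilon>" by (rule obtain_multiple[OF assms(1)])
  define s' where "s' = real k * \<epsilon>"
  have s': "0 \<le> s'" "s' \<le> s" "s - s' \<le> \<epsilon>" using k \<epsilon> by (auto simp: s'_def)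
  have "corr 0 h = corr s' (s' + h)"
    using corr_invariant[of 0 k h] s' assms by (simp add: s'_def add.commute)
  moreover have "\<bar>corr s (s + h) - corr s' (s' + h)\<bar> \<le> (\<integral>x. 2 * modulus \<epsilon> x \<partial>annealed)"
  proof -
    have mem: "s \<in> {0..1}" "s + h \<in> {0..1}" "s' \<in> {0..1}" "s' + h \<in> {0..1}" using assms s' by auto
    note int = integrable_path_mult[OF mem(1,2)] integrable_path_mult[OF mem(3,4)]
    have "corr s (s + h) - corr s' (s' + h) = (\<integral>x. path x s * path x (s + h) - path x s' * path x (s' + h) \<partial>annealed)"
      using int by (simp add: corr_def)
    also have "\<bar>\<dots>\<bar> \<le> (\<integral>x. \<bar>path x s * path x (s + h) - path x s' * path x (s' + h)\<bar> \<partial>annealed)"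
      by (rule integral_abs_bound)
    also have "\<dots> \<le> (\<integral>x. 2 * modulus \<epsilon> x \<partial>annealed)"
    proof (rule integral_mono)
      fix x
      have "path x s * path x (s + h) - path x s' * path x (s' + h)
          = (path x s - path x s') * path x (s + h) + path x s' * (path x (s + h) - path x (s' + h))"
        by (simp add: algebra_simps)
      also have "\<bar>\<dots>\<bar> \<le> \<bar>path x s - path x s'\<bar> * \<bar>path x (s + h)\<bar> + \<bar>path x s'\<bar> * \<bar>path x (s + h) - path x (s' + h)\<bar>"
        by (metis abs_mult abs_triangle_ineq)
      also have "\<dots> \<le> modulus \<epsilon> x * 1 + 1 * modulus \<epsilon> x"
        using mem s' by (intro add_mono mult_mono modulus_upper abs_path_le) (auto simp: modulus_nonneg less_imp_le[OF \<epsilon>(1)])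
      finally show "\<bar>path x s * path x (s + h) - path x s' * path x (s' + h)\<bar> \<le> 2 * modulus \<epsilon> x" by simp
    qed (use int integrable_modulus \<epsilon> in auto)
    finally show ?thesis .
  qed
  ultimately show ?thesis by simp
qed

text \<open>At a multiple t' of \<epsilon> the mean absolute deviation equals that at time 0, where
  it is a deterministic Riemann sum error. Rounding t down to t' costs L times the mean
  modulus.\<close>

lemma marginal_deviation_le:
  fixes \<phi> \<Phi> :: "real \<Rightarrow> real"
  assumes rtp: "random_trajectory_process c n M X" and n: "1 \<le> n" and c: "0 \<le> c" "c \<le> 1"
    and cont: "continuous_on UNIV \<phi>"
    and der: "\<And>u. -1 \<le> u \<Longrightarrow> u \<le> 1 \<Longrightarrow> (\<Phi> has_real_derivative \<phi> u) (at u)"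
    and lip: "\<And>u v. u \<in> {-1..1} \<Longrightarrow> v \<in> {-1..1} \<Longrightarrow> \<bar>\<phi> u - \<phi> v\<bar> \<le> L * \<bar>u - v\<bar>" and "0 \<le> L"
    and t: "t \<in> {0..1}"
  shows "(\<integral>\<omega>. \<bar>(\<integral>x. \<phi> (path x t) \<partial>X \<omega>) - (\<Phi> 1 - \<Phi> (-1)) / 2\<bar> \<partial>M)
    \<le> 2 * L / real n + L * (\<integral>x. modulus \<epsilon> x \<partial>annealed)"
proof -
  define l where "l = (\<Phi> 1 - \<Phi> (-1)) / 2"
  have [measurable]: "\<phi> \<in> borel_measurable borel" using cont by (rule borel_measurable_continuous_onI)
  obtain k where k: "real k * \<epsilon> \<le> t" "t - real k * \<epsilon> \<le> \<epsilon>" by (rule obtain_multiple[of t]) (use t in auto)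
  define t' where "t' = real k * \<epsilon>"
  have t': "t' \<in> {0..1}" "t' \<le> t" "\<bar>t - t'\<bar> \<le> \<epsilon>" using k \<epsilon> t by (auto simp: t'_def)
  have mem: "path x u \<in> {-1..1}" if "u \<in> {0..1}" for x u using path_range[OF that] .
  have bound: "\<bar>\<phi> (path x u)\<bar> \<le> \<bar>\<phi> 0\<bar> + L" if "u \<in> {0..1}" for x u
  proof -
    have "\<bar>\<phi> (path x u) - \<phi> 0\<bar> \<le> L * \<bar>path x u - 0\<bar>" using mem[OF that] by (intro lip) auto
    also have "\<dots> \<le> L * 1" using abs_path_le[OF that, of x] \<open>0 \<le> L\<close> by (intro mult_left_mono) auto
    finally show ?thesis by linarith
  qed
  have "(\<integral>\<omega>. \<bar>(\<integral>x. \<phi> (path x t) \<partial>X \<omega>) - l\<bar> \<partial>M)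
      \<le> (\<integral>\<omega>. \<bar>(\<integral>x. \<phi> (path x t') \<partial>X \<omega>) - l\<bar> \<partial>M) + (\<integral>x. \<bar>\<phi> (path x t) - \<phi> (path x t')\<bar> \<partial>annealed) + \<bar>l - l\<bar>"
    using t t' bound
    by (intro mean_deviation_approx[where B="\<bar>\<phi> 0\<bar> + L" and B'="\<bar>\<phi> 0\<bar> + L"]) auto
  moreover have "(\<integral>\<omega>. \<bar>(\<integral>x. \<phi> (path x t') \<partial>X \<omega>) - l\<bar> \<partial>M) \<le> 2 * L / real n"
  proof -
    have "(\<integral>\<omega>. \<bar>(\<integral>x. \<phi> (path x t') \<partial>X \<omega>) - l\<bar> \<partial>M) = (\<integral>\<omega>. \<bar>(\<integral>x. \<phi> (path x 0) \<partial>X \<omega>) - l\<bar> \<partial>M)"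
      using integral_path_invariant[of "\<lambda>p. \<phi> (fst p)" "\<lambda>u. \<bar>u - l\<bar>" 0 k 0] t'
      by (simp add: t'_def continuous_on_compose2[OF cont] continuous_intros)
    also have "\<dots> \<le> (\<integral>\<omega>. 2 * L / real n \<partial>M)"
    proof (rule integral_mono)
      fix \<omega> assume "\<omega> \<in> space M"
      then show "\<bar>(\<integral>x. \<phi> (path x 0) \<partial>X \<omega>) - l\<bar> \<le> 2 * L / real n"
        unfolding l_def using rescale_Riemann_sum[OF n c der lip \<open>0 \<le> L\<close>]
        by (subst random_trajectory_process_initial[OF rtp n c]) auto
    next
      show "integrable M (\<lambda>\<omega>. \<bar>(\<integral>x. \<phi> (path x 0) \<partial>X \<omega>) - l\<bar>)"
        using bound
        by (intro integrable_abs Bochner_Integration.integrable_diff integrable_integral_X[where B="\<bar>\<phi> 0\<bar> + L"]) auto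
    qed simp
    finally show ?thesis by (simp add: prob_space)
  qed
  moreover have "(\<integral>x. \<bar>\<phi> (path x t) - \<phi> (path x t')\<bar> \<partial>annealed) \<le> (\<integral>x. L * modulus \<epsilon> x \<partial>annealed)"
  proof (rule integral_mono)
    fix x
    have "\<bar>\<phi> (path x t) - \<phi> (path x t')\<bar> \<le> L * \<bar>path x t - path x t'\<bar>"
      using t t' mem by (intro lip) auto
    also have "\<dots> \<le> L * modulus \<epsilon> x" using t t' \<open>0 \<le> L\<close> by (intro mult_left_mono modulus_upper) auto
    finally show "\<bar>\<phi> (path x t) - \<phi> (path x t')\<bar> \<le> L * modulus \<epsilon> x" .
  next
    show "integrable annealed (\<lambda>x. \<bar>\<phi> (path x t) - \<phi> (path x t')\<bar>)"
      using t t' bound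
      by (intro integrable_abs Bochner_Integration.integrable_diff integrable_annealed[where B="\<bar>\<phi> 0\<bar> + L"]) auto
  qed (use integrable_modulus \<epsilon> in auto)
  ultimately show ?thesis by (simp add: l_def)
qed

end

section \<open>The Archimedean process\<close>

text \<open>With the sheared coordinate integrated first, the shear is a translation in the inner
  integral.\<close>

lemma nn_integral_shear_fst:
  fixes f :: "real \<times> real \<Rightarrow> ennreal"
  assumes [measurable]: "f \<in> borel_measurable borel"
  shows "(\<integral>\<^sup>+p. f (fst p + a * snd p, snd p) \<partial>lborel) = (\<integral>\<^sup>+p. f p \<partial>lborel)"
proof -
  have [measurable]: "f \<in> borel_measurable (borel \<Otimes>\<^sub>M borel)"
    unfolding borel_prod by fact
  have "(\<integral>\<^sup>+p. f (fst p + a * snd p, snd p) \<partial>(lborel \<Otimes>\<^sub>M lborel))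
      = (\<integral>\<^sup>+y. \<integral>\<^sup>+x. f (x + a * y, y) \<partial>lborel \<partial>lborel)"
    by (subst lborel_pair.nn_integral_snd[symmetric]) auto
  also have "\<dots> = (\<integral>\<^sup>+y. \<integral>\<^sup>+x. f (x, y) \<partial>lborel \<partial>lborel)"
  proof (rule nn_integral_cong)
    fix y :: real
    have "(\<integral>\<^sup>+x. f (x, y) \<partial>lborel) = ennreal \<bar>1\<bar> * (\<integral>\<^sup>+x. f (a * y + 1 * x, y) \<partial>lborel)"
      by (rule nn_integral_real_affine) auto
    then show "(\<integral>\<^sup>+x. f (x + a * y, y) \<partial>lborel) = (\<integral>\<^sup>+x. f (x, y) \<partial>lborel)"
      by (simp add: add.commute)
  qed
  also have "\<dots> = (\<integral>\<^sup>+p. f p \<partial>(lborel \<Otimes>\<^sub>M lborel))"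
    by (rule lborel_pair.nn_integral_snd) auto
  finally show ?thesis by (simp only: lborel_prod)
qed

lemma nn_integral_shear_snd:
  fixes f :: "real \<times> real \<Rightarrow> ennreal"
  assumes [measurable]: "f \<in> borel_measurable borel"
  shows "(\<integral>\<^sup>+p. f (fst p, snd p + a * fst p) \<partial>lborel) = (\<integral>\<^sup>+p. f p \<partial>lborel)"
proof -
  have [measurable]: "f \<in> borel_measurable (borel \<Otimes>\<^sub>M borel)"
    unfolding borel_prod by fact
  have "(\<integral>\<^sup>+p. f (fst p, snd p + a * fst p) \<partial>(lborel \<Otimes>\<^sub>M lborel))
      = (\<integral>\<^sup>+x. \<integral>\<^sup>+y. f (x, y + a * x) \<partial>lborel \<partial>lborel)"
    by (subst lborel.nn_integral_fst[symmetric]) auto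
  also have "\<dots> = (\<integral>\<^sup>+x. \<integral>\<^sup>+y. f (x, y) \<partial>lborel \<partial>lborel)"
  proof (rule nn_integral_cong)
    fix x :: real
    have "(\<integral>\<^sup>+y. f (x, y) \<partial>lborel) = ennreal \<bar>1\<bar> * (\<integral>\<^sup>+y. f (x, a * x + 1 * y) \<partial>lborel)"
      by (rule nn_integral_real_affine) auto
    then show "(\<integral>\<^sup>+y. f (x, y + a * x) \<partial>lborel) = (\<integral>\<^sup>+y. f (x, y) \<partial>lborel)"
      by (simp add: add.commute)
  qed
  also have "\<dots> = (\<integral>\<^sup>+p. f p \<partial>(lborel \<Otimes>\<^sub>M lborel))"
    by (rule lborel.nn_integral_fst) auto
  finally show ?thesis by (simp only: lborel_prod)
qed

text \<open>A rotation by an angle other than \<open>\<pi>\<close> is a product of three shears.\<close>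

lemma nn_integral_rotation:
  fixes f :: "real \<times> real \<Rightarrow> ennreal"
  assumes f: "f \<in> borel_measurable borel" and cs: "c\<^sup>2 + s\<^sup>2 = 1" "c \<noteq> -1"
  shows "(\<integral>\<^sup>+p. f (c * fst p + s * snd p, c * snd p - s * fst p) \<partial>lborel) = (\<integral>\<^sup>+p. f p \<partial>lborel)"
proof -
  \<comment> \<open>This is the tangent of half the rotation angle; the shears have coefficients a,
    -s, a. It is infinite for the angle \<pi>, which is the reason for excluding c = -1.\<close>
  define a where "a = s / (1 + c)"
  have "a * s = (1 - c\<^sup>2) / (1 + c)" using cs by (simp add: a_def power2_eq_square algebra_simps)
  also have "1 - c\<^sup>2 = (1 - c) * (1 + c)" by (simp add: power2_eq_square algebra_simps)
  finally have as: "a * s = 1 - c" using cs by simp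
  have ac: "a * (1 + c) = s" using cs by (simp add: a_def)
  define S where "S p = (fst p + a * snd p, snd p)" for p :: "real \<times> real"
  define T where "T p = (fst p, snd p + (- s) * fst p)" for p :: "real \<times> real"
  have [measurable]: "S \<in> borel_measurable borel" "T \<in> borel_measurable borel"
    unfolding S_def T_def by (intro borel_measurable_continuous_onI continuous_intros)+
  note [measurable] = f
  have "S (T (S p)) = (c * fst p + s * snd p, c * snd p - s * fst p)" for p
  proof -
    have c: "1 - a * s = c" using as by simp
    have 1: "snd (S (T (S p))) = (1 - a * s) * snd p - s * fst p"
      by (simp add: S_def T_def algebra_simps)
    have 2: "fst (S (T (S p))) = (1 - a * s) * fst p + (a * (1 + (1 - a * s))) * snd p"
      by (simp add: S_def T_def algebra_simps)
    show ?thesis using 1 2 unfolding c ac by (simp add: prod_eq_iff)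
  qed
  then have "(\<integral>\<^sup>+p. f (c * fst p + s * snd p, c * snd p - s * fst p) \<partial>lborel) = (\<integral>\<^sup>+p. f (S (T (S p))) \<partial>lborel)"
    by simp
  also have "\<dots> = (\<integral>\<^sup>+p. f (S (T p)) \<partial>lborel)"
    using nn_integral_shear_fst[of "\<lambda>p. f (S (T p))" a, folded S_def] by simp
  also have "\<dots> = (\<integral>\<^sup>+p. f (S p) \<partial>lborel)"
    using nn_integral_shear_snd[of "\<lambda>p. f (S p)" "- s", folded T_def] by simp
  also have "\<dots> = (\<integral>\<^sup>+p. f p \<partial>lborel)"
    using nn_integral_shear_fst[of f a, folded S_def] by simp
  finally show ?thesis .
qed

text \<open>The mass of the Archimedean density over the vertical line at x, where r^2 = 1 - x^2.
  The antiderivative arcsin (y/r) / (2 pi) has total increment 1/2 whatever r is, which is why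
  projections have constant density. The integrand is unbounded at \<plusminus>r, so the fundamental
  theorem is used in its form for nonnegative functions with limits at the ends.\<close>

lemma arcsine_law_mass:
  assumes "r > 0"
  shows "(\<integral>\<^sup>+y. ennreal (if y\<^sup>2 < r\<^sup>2 then 1 / (2 * pi * sqrt (r\<^sup>2 - y\<^sup>2)) else 0) \<partial>lborel) = ennreal (1 / 2)"
proof -
  define f where "f y = 1 / (2 * pi * sqrt (r\<^sup>2 - y\<^sup>2))" for y
  define F where "F y = arcsin (y / r) / (2 * pi)" for y
  have iff: "y\<^sup>2 < r\<^sup>2 \<longleftrightarrow> - r < y \<and> y < r" for y
    using abs_le_square_iff[of r y] assms by (auto simp: not_le[symmetric])
  then have sq: "y\<^sup>2 < r\<^sup>2" if "- r < y" "y < r" for y using that by simp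
  have cont: "continuous_on {-r..r} F"
    unfolding F_def using assms by (intro continuous_intros) (auto simp: field_simps)
  have der: "DERIV F y :> f y" if "- r < y" "y < r" for y
  proof -
    have "sqrt (1 - (y / r)\<^sup>2) = sqrt (r\<^sup>2 - y\<^sup>2) / r"
      using assms by (simp add: power_divide diff_divide_eq_iff real_sqrt_divide field_simps real_sqrt_mult)
    moreover have "sqrt (r\<^sup>2 - y\<^sup>2) > 0" using sq[OF that] by simp
    ultimately show ?thesis
      unfolding F_def f_def using assms that
      by (auto intro!: derivative_eq_intros simp: field_simps)
  qed
  have F: "F (- r) = - 1 / 4" "F r = 1 / 4" using assms by (simp_all add: F_def)
  have FTC: "set_integrable lborel (einterval (ereal (- r)) (ereal r)) f"
      "(LBINT y=ereal (- r)..ereal r. f y) = 1 / 4 - (- 1 / 4)"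
  proof -
    have ends: "((F \<circ> real_of_ereal) \<longlongrightarrow> - 1 / 4) (at_right (ereal (- r)))"
        "((F \<circ> real_of_ereal) \<longlongrightarrow> 1 / 4) (at_left (ereal r))"
    proof -
      have "(F \<longlongrightarrow> F (-r)) (at (-r) within {-r..r})" "(F \<longlongrightarrow> F r) (at r within {-r..r})"
        using cont assms by (auto simp: continuous_on_def)
      then show "((F \<circ> real_of_ereal) \<longlongrightarrow> - 1 / 4) (at_right (ereal (- r)))"
          "((F \<circ> real_of_ereal) \<longlongrightarrow> 1 / 4) (at_left (ereal r))"
        unfolding ereal_tendsto_simps using F assms
        by (simp_all add: at_within_Icc_at_right at_within_Icc_at_left)
    qed
    have nn: "AE y in lborel. ereal (- r) < ereal y \<longrightarrow> ereal y < ereal r \<longrightarrow> 0 \<le> f y"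
      by (auto simp: f_def intro!: AE_I2 divide_nonneg_nonneg mult_nonneg_nonneg less_imp_le[OF sq])
    have isC: "isCont f y" if "ereal (- r) < ereal y" "ereal y < ereal r" for y
      unfolding f_def using sq[of y] that by (intro continuous_intros) auto
    have D: "DERIV F y :> f y" if "ereal (- r) < ereal y" "ereal y < ereal r" for y
      using der that by simp
    have lr: "ereal (- r) < ereal r" using assms by simp
    note I = interval_integral_FTC_nonneg[where F=F and f=f, OF lr D isC nn ends]
    show "set_integrable lborel (einterval (ereal (- r)) (ereal r)) f" by (rule I(1))
    show "(LBINT y=ereal (- r)..ereal r. f y) = 1 / 4 - (- 1 / 4)" by (rule I(2))
  qed
  have eq: "(if y\<^sup>2 < r\<^sup>2 then 1 / (2 * pi * sqrt (r\<^sup>2 - y\<^sup>2)) else 0) = indicator {-r<..<r} y *\<^sub>R f y" for y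
    unfolding iff by (simp add: f_def indicator_def)
  have "integrable lborel (\<lambda>y. indicator {-r<..<r} y *\<^sub>R f y)"
    using FTC(1) by (simp add: set_integrable_def)
  moreover have "(\<integral>y. indicator {-r<..<r} y *\<^sub>R f y \<partial>lborel) = 1 / 2"
    using FTC(2) assms by (simp add: interval_lebesgue_integral_def set_lebesgue_integral_def)
  moreover have "0 \<le> indicator {-r<..<r} y *\<^sub>R f y" for y
    unfolding eq[symmetric] by simp
  ultimately show ?thesis
    unfolding eq by (subst nn_integral_eq_integral) (auto simp only: AE_I2)
qed

lemma borel_measurable_archimedean_density [measurable]:
  "(\<lambda>p::real\<times>real. ennreal (if (fst p)\<^sup>2 + (snd p)\<^sup>2 < 1 then 1 / (2 * pi * sqrt (1 - (fst p)\<^sup>2 - (snd p)\<^sup>2)) else 0))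
     \<in> borel_measurable borel"
  unfolding borel_prod[symmetric] by measurable

lemma archimedean_measure_alt:
  "archimedean_measure = density lborel (\<lambda>p. ennreal
     (if (fst p)\<^sup>2 + (snd p)\<^sup>2 < 1 then 1 / (2 * pi * sqrt (1 - (fst p)\<^sup>2 - (snd p)\<^sup>2)) else 0))"
  by (simp add: archimedean_measure_def case_prod_unfold)

lemma sets_archimedean_measure [simp, measurable_cong]: "sets archimedean_measure = sets borel"
  by (simp add: archimedean_measure_def)

text \<open>The density is rotation invariant, so the projection onto the direction (c, s) can be
  rotated to the first coordinate. The fibre over each x in (-1,1) then has mass 1/2.\<close>

lemma nn_integral_archimedean_projection:
  fixes h :: "real \<Rightarrow> ennreal"
  assumes [measurable]: "h \<in> borel_measurable borel" and cs: "c\<^sup>2 + s\<^sup>2 = 1" "c \<noteq> -1"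
  shows "(\<integral>\<^sup>+p. h (c * fst p + s * snd p) \<partial>archimedean_measure)
       = (\<integral>\<^sup>+u. h u * indicator {-1<..<1} u \<partial>lborel) / 2"
proof -
  define \<rho> where "\<rho> p = ennreal (if (fst p)\<^sup>2 + (snd p)\<^sup>2 < 1 then 1 / (2 * pi * sqrt (1 - (fst p)\<^sup>2 - (snd p)\<^sup>2)) else 0)"
    for p :: "real \<times> real"
  have [measurable]: "\<rho> \<in> borel_measurable borel" unfolding \<rho>_def by measurable
  then have [measurable]: "\<rho> \<in> borel_measurable (borel \<Otimes>\<^sub>M borel)" by (simp add: borel_prod)
  have [measurable]: "(\<lambda>p. h (fst p)) \<in> borel_measurable (borel :: (real \<times> real) measure)"
    "(\<lambda>p. h (c * fst p + s * snd p)) \<in> borel_measurable (borel :: (real \<times> real) measure)"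
    unfolding borel_prod[symmetric] by measurable
  have rot: "\<rho> (c * fst p + s * snd p, c * snd p - s * fst p) = \<rho> p" for p
  proof -
    have "(c * fst p + s * snd p)\<^sup>2 + (c * snd p - s * fst p)\<^sup>2 = (c\<^sup>2 + s\<^sup>2) * ((fst p)\<^sup>2 + (snd p)\<^sup>2)"
      by (simp add: power2_eq_square algebra_simps)
    then show ?thesis using cs by (simp add: \<rho>_def diff_diff_eq)
  qed
  have inner: "(\<integral>\<^sup>+y. \<rho> (x, y) \<partial>lborel) = indicator {-1<..<1} x / 2" for x
  proof (cases "x \<in> {-1<..<1}")
    case True
    then have "x\<^sup>2 < 1" by (simp add: abs_square_less_1 abs_less_iff)
    then have "(\<integral>\<^sup>+y. \<rho> (x, y) \<partial>lborel) = ennreal (1 / 2)"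
    proof -
      have sq: "(sqrt (1 - x\<^sup>2))\<^sup>2 = 1 - x\<^sup>2" using \<open>x\<^sup>2 < 1\<close> by simp
      have "\<rho> (x, y) = ennreal (if y\<^sup>2 < (sqrt (1 - x\<^sup>2))\<^sup>2
          then 1 / (2 * pi * sqrt ((sqrt (1 - x\<^sup>2))\<^sup>2 - y\<^sup>2)) else 0)" for y
        unfolding sq by (auto simp: \<rho>_def)
      then show ?thesis using arcsine_law_mass[of "sqrt (1 - x\<^sup>2)"] \<open>x\<^sup>2 < 1\<close> by simp
    qed
    then show ?thesis using True by (simp add: divide_ennreal_def)
  next
    case False
    then have "x\<^sup>2 \<ge> 1" using abs_square_less_1[of x] by (auto simp: abs_less_iff not_less)
    then have "\<not> x\<^sup>2 + y\<^sup>2 < 1" for y using zero_le_power2[of y] by linarith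
    then have "\<rho> (x, y) = 0" for y by (simp add: \<rho>_def)
    then show ?thesis using False by simp
  qed
  have "(\<integral>\<^sup>+p. h (c * fst p + s * snd p) \<partial>archimedean_measure)
      = (\<integral>\<^sup>+p. \<rho> p * h (c * fst p + s * snd p) \<partial>lborel)"
    unfolding archimedean_measure_alt \<rho>_def[symmetric] by (subst nn_integral_density) auto
  also have "\<dots> = (\<integral>\<^sup>+p. \<rho> p * h (fst p) \<partial>lborel)"
    using nn_integral_rotation[OF _ cs, of "\<lambda>p. \<rho> p * h (fst p)"] by (simp add: rot)
  also have "\<dots> = (\<integral>\<^sup>+p. \<rho> p * h (fst p) \<partial>(lborel \<Otimes>\<^sub>M lborel))" by (simp only: lborel_prod)
  also have "\<dots> = (\<integral>\<^sup>+x. \<integral>\<^sup>+y. \<rho> (x, y) * h x \<partial>lborel \<partial>lborel)"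
    by (subst lborel.nn_integral_fst[symmetric]) auto
  also have "\<dots> = (\<integral>\<^sup>+x. h x * indicator {-1<..<1} x / 2 \<partial>lborel)"
    by (intro nn_integral_cong, subst nn_integral_multc)
       (auto simp: inner ennreal_times_divide mult.commute)
  also have "\<dots> = (\<integral>\<^sup>+x. h x * indicator {-1<..<1} x \<partial>lborel) / 2"
    by (simp add: nn_integral_divide)
  finally show ?thesis .
qed

lemma integral_archimedean_projection:
  fixes h H :: "real \<Rightarrow> real"
  assumes [measurable]: "h \<in> borel_measurable borel" and nonneg: "\<And>u. 0 \<le> h u"
    and H: "\<And>u. -1 \<le> u \<Longrightarrow> u \<le> 1 \<Longrightarrow> (H has_real_derivative h u) (at u)"
    and cs: "c\<^sup>2 + s\<^sup>2 = 1" "c \<noteq> -1"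
  shows "(\<integral>p. h (c * fst p + s * snd p) \<partial>archimedean_measure) = (H 1 - H (-1)) / 2"
proof -
  have [measurable]: "(\<lambda>p. h (c * fst p + s * snd p)) \<in> borel_measurable (borel :: (real \<times> real) measure)"
    unfolding borel_prod[symmetric] by measurable
  have H_le: "H (-1) \<le> H 1"
    by (rule DERIV_nonneg_imp_nondecreasing) (use H nonneg in auto)
  have "(\<integral>\<^sup>+p. ennreal (h (c * fst p + s * snd p)) \<partial>archimedean_measure)
     = (\<integral>\<^sup>+u. ennreal (h u) * indicator {-1<..<1} u \<partial>lborel) / 2"
    using nn_integral_archimedean_projection[OF _ cs, of "\<lambda>u. ennreal (h u)"] by simp
  also have "(\<integral>\<^sup>+u. ennreal (h u) * indicator {-1<..<1} u \<partial>lborel) = (\<integral>\<^sup>+u. ennreal (h u) * indicator {-1..1} u \<partial>lborel)"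
    by (intro nn_integral_cong_AE AE_mp[OF AE_lborel_singleton[of "-1::real"] AE_mp[OF AE_lborel_singleton[of "1::real"] AE_I2]])
       (auto simp: indicator_def)
  also have "\<dots> = ennreal (H 1 - H (-1))"
    by (rule nn_integral_FTC_Icc) (use H nonneg in \<open>auto intro: DERIV_subset\<close>)
  also have "\<dots> / 2 = ennreal ((H 1 - H (-1)) / 2)"
    using H_le by (simp add: ennreal_divide_numeral)
  finally have *: "(\<integral>\<^sup>+p. ennreal (h (c * fst p + s * snd p)) \<partial>archimedean_measure) = ennreal ((H 1 - H (-1)) / 2)" .
  show "(\<integral>p. h (c * fst p + s * snd p) \<partial>archimedean_measure) = (H 1 - H (-1)) / 2"
    using * by (subst integral_eq_nn_integral) (auto simp: nonneg H_le)
qed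

lemma prob_space_archimedean_measure: "prob_space archimedean_measure"
proof
  have "emeasure archimedean_measure (space archimedean_measure) = (\<integral>\<^sup>+p. 1 \<partial>archimedean_measure)"
    by simp
  also have "\<dots> = 1"
    using nn_integral_archimedean_projection[of "\<lambda>_. 1" 1 0] by (simp add: ennreal_divide_self)
  finally show "emeasure archimedean_measure (space archimedean_measure) = 1" .
qed

lemma AE_archimedean_disk: "AE p in archimedean_measure. (fst p)\<^sup>2 + (snd p)\<^sup>2 < 1"
  unfolding archimedean_measure_alt by (subst AE_density) (simp_all only: measurable_lborel2 borel_measurable_archimedean_density, auto)

section \<open>Great-circle paths and their distance from a trajectory\<close>

definition arch_fun :: "real \<times> real \<Rightarrow> real \<Rightarrow> real" where
  "arch_fun p t = cos (pi * t) * fst p + sin (pi * t) * snd p"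

text \<open>Clipping makes every value of \<open>arch_path\<close> a trajectory; on the unit disk it has no effect.\<close>

definition arch_path :: "real \<times> real \<Rightarrow> trajectory" where
  "arch_path p = trajectory_of (\<lambda>t. max (-1) (min 1 (arch_fun p t)))"

lemma continuous_on_arch_fun: "continuous_on S (arch_fun p)"
  unfolding arch_fun_def by (intro continuous_intros)

lemma path_arch_path:
  assumes "t \<in> {0..1}"
  shows "path (arch_path p) t = max (-1) (min 1 (arch_fun p t))"
  unfolding arch_path_def
  by (rule path_trajectory_of[OF _ assms])
     (auto simp: is_trajectory_def intro!: continuous_intros continuous_on_arch_fun)

lemma abs_arch_fun_diff_le: "\<bar>arch_fun p t - arch_fun q t\<bar> \<le> 2 * dist p q"
proof -
  have "arch_fun p t - arch_fun q t = cos (pi * t) * (fst p - fst q) + sin (pi * t) * (snd p - snd q)"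
    by (simp add: arch_fun_def algebra_simps)
  also have "\<bar>\<dots>\<bar> \<le> \<bar>cos (pi * t)\<bar> * \<bar>fst p - fst q\<bar> + \<bar>sin (pi * t)\<bar> * \<bar>snd p - snd q\<bar>"
    by (metis abs_mult abs_triangle_ineq)
  also have "\<dots> \<le> 1 * dist p q + 1 * dist p q"
    using dist_fst_le[of p q] dist_snd_le[of p q]
    by (intro add_mono mult_mono) (auto simp: dist_real_def)
  finally show ?thesis by simp
qed

lemma clip_diff_le: "\<bar>max (-1) (min 1 u) - max (-1) (min 1 v)\<bar> \<le> \<bar>u - v\<bar>" for u v :: real
  by (auto simp: max_def min_def)

lemma continuous_on_arch_path: "continuous_on S arch_path"
proof (rule lipschitz_on_continuous_on[of 2], rule lipschitz_onI)
  fix p q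
  show "dist (arch_path p) (arch_path q) \<le> 2 * dist p q"
    by (rule dist_trajectory_le)
       (use clip_diff_le abs_arch_fun_diff_le order.trans in \<open>simp add: path_arch_path; blast\<close>)
qed simp

text \<open>Each coordinate contributes speed at most \<pi>. The point p ranges over the square and
  not only the disk, because that is all that is known about the frame of an arbitrary path.\<close>

lemma abs_arch_fun_time_diff_le:
  assumes "\<bar>fst p\<bar> \<le> 1" "\<bar>snd p\<bar> \<le> 1"
  shows "\<bar>arch_fun p s - arch_fun p t\<bar> \<le> 2 * pi * \<bar>s - t\<bar>"
proof -
  have half: "\<bar>sin ((pi * s - pi * t) / 2)\<bar> \<le> pi * \<bar>s - t\<bar> / 2"
    using abs_sin_x_le_abs_x[of "(pi * s - pi * t) / 2"]
    by (simp add: right_diff_distrib[symmetric] abs_mult)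
  have "\<bar>cos (pi * s) - cos (pi * t)\<bar> = 2 * \<bar>sin ((pi * s + pi * t) / 2)\<bar> * \<bar>sin ((pi * s - pi * t) / 2)\<bar>"
    by (simp add: cos_diff_cos abs_mult) (metis abs_minus_cancel minus_diff_eq minus_divide_left sin_minus)
  also have "\<dots> \<le> 2 * 1 * (pi * \<bar>s - t\<bar> / 2)" using half by (intro mult_mono) auto
  finally have c: "\<bar>cos (pi * s) - cos (pi * t)\<bar> \<le> pi * \<bar>s - t\<bar>" by simp
  have "\<bar>sin (pi * s) - sin (pi * t)\<bar> = 2 * \<bar>sin ((pi * s - pi * t) / 2)\<bar> * \<bar>cos ((pi * s + pi * t) / 2)\<bar>"
    by (simp add: sin_diff_sin abs_mult)
  also have "\<dots> \<le> 2 * (pi * \<bar>s - t\<bar> / 2) * 1" using half by (intro mult_mono) auto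
  finally have s: "\<bar>sin (pi * s) - sin (pi * t)\<bar> \<le> pi * \<bar>s - t\<bar>" by simp
  have "arch_fun p s - arch_fun p t = (cos (pi * s) - cos (pi * t)) * fst p + (sin (pi * s) - sin (pi * t)) * snd p"
    by (simp add: arch_fun_def algebra_simps)
  also have "\<bar>\<dots>\<bar> \<le> \<bar>cos (pi * s) - cos (pi * t)\<bar> * \<bar>fst p\<bar> + \<bar>sin (pi * s) - sin (pi * t)\<bar> * \<bar>snd p\<bar>"
    by (metis abs_mult abs_triangle_ineq)
  also have "\<dots> \<le> pi * \<bar>s - t\<bar> * 1 + pi * \<bar>s - t\<bar> * 1"
    using c s assms by (intro add_mono mult_mono) auto
  finally show ?thesis by simp
qed

text \<open>The values at times 0 and 1/2 are the coordinates of p in \<open>arch_fun p\<close>, so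
  \<open>arch_path (frame x)\<close> is the only great-circle path that x can be close to.\<close>

definition frame :: "trajectory \<Rightarrow> real \<times> real" where
  "frame x = (path x 0, path x (1/2))"

lemma frame_mem: "frame x \<in> {-1..1} \<times> {-1..1}"
  using path_range[of 0 x] path_range[of "1/2" x] by (auto simp: frame_def)

lemma continuous_on_frame: "continuous_on S frame"
  unfolding frame_def by (intro continuous_intros continuous_on_path_eval) auto

lemma abs_frame_le: "\<bar>fst (frame x)\<bar> \<le> 1" "\<bar>snd (frame x)\<bar> \<le> 1"
  by (simp_all add: frame_def abs_path_le)

text \<open>Compare at the grid time s just before t, then move both paths from s to t. A sum over
  the grid replaces the maximum so that its integral splits into finitely many terms, each
  controlled at one fixed time.\<close>

lemma dist_arch_path_frame_le:
  assumes m: "m \<ge> (1::nat)"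
  shows "dist x (arch_path (frame x)) \<le>
    (\<Sum>j\<le>m. \<bar>path x (real j / real m) - arch_fun (frame x) (real j / real m)\<bar>)
      + modulus (1 / real m) x + 2 * pi / real m"
proof (rule dist_trajectory_le)
  fix t :: real assume t: "t \<in> {0..1}"
  define j where "j = nat \<lfloor>t * real m\<rfloor>"
  define s where "s = real j / real m"
  have tm: "0 \<le> t * real m" "t * real m \<le> real m" using t by (auto simp: mult_left_le_one_le)
  then have j: "j \<le> m" by (simp add: j_def nat_le_iff floor_le_iff)
  have "real j \<le> t * real m" "t * real m \<le> real j + 1" using tm by (auto simp: j_def of_nat_nat)
  then have "s \<le> t" "t \<le> (real j + 1) / real m"
    using m by (simp_all add: s_def pos_divide_le_eq pos_le_divide_eq)
  then have st: "s \<le> t" "t - s \<le> 1 / real m" by (simp_all add: s_def add_divide_distrib)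
  have s: "s \<in> {0..1}" using st t by (auto simp: s_def)
  have "\<bar>path x t - path x s\<bar> \<le> modulus (1 / real m) x"
    using s t st by (intro modulus_upper) auto
  moreover have "\<bar>path x s - path (arch_path (frame x)) s\<bar>
     \<le> (\<Sum>j\<le>m. \<bar>path x (real j / real m) - arch_fun (frame x) (real j / real m)\<bar>)"
  proof -
    \<comment> \<open>Clipping fixes the values of x and is 1-Lipschitz, so clipping the great
      circle cannot increase its distance from x.\<close>
    have "path x s = max (-1) (min 1 (path x s))" using path_range[OF s, of x] by auto
    then have "\<bar>path x s - path (arch_path (frame x)) s\<bar> \<le> \<bar>path x s - arch_fun (frame x) s\<bar>"
      using clip_diff_le[of "path x s" "arch_fun (frame x) s"] by (simp add: path_arch_path[OF s])
    also have "\<dots> \<le> (\<Sum>j\<le>m. \<bar>path x (real j / real m) - arch_fun (frame x) (real j / real m)\<bar>)"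
      unfolding s_def using j by (intro member_le_sum[of j "{..m}"]) auto
    finally show ?thesis .
  qed
  moreover have "\<bar>path (arch_path (frame x)) s - path (arch_path (frame x)) t\<bar> \<le> 2 * pi / real m"
  proof -
    have "\<bar>path (arch_path (frame x)) s - path (arch_path (frame x)) t\<bar> \<le> \<bar>arch_fun (frame x) s - arch_fun (frame x) t\<bar>"
      using clip_diff_le by (simp add: path_arch_path[OF s] path_arch_path[OF t])
    also have "\<dots> \<le> 2 * pi * \<bar>s - t\<bar>" by (intro abs_arch_fun_time_diff_le abs_frame_le)
    also have "\<dots> \<le> 2 * pi * (1 / real m)" using st by (intro mult_left_mono) auto
    finally show ?thesis by simp
  qed
  ultimately show "\<bar>path x t - path (arch_path (frame x)) t\<bar>
     \<le> (\<Sum>j\<le>m. \<bar>path x (real j / real m) - arch_fun (frame x) (real j / real m)\<bar>)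
      + modulus (1 / real m) x + 2 * pi / real m" by linarith
qed

lemma continuous_on_box_bound:
  fixes g :: "real \<times> real \<Rightarrow> real"
  assumes "continuous_on UNIV g"
  obtains B where "\<And>p. p \<in> {-1..1} \<times> {-1..1} \<Longrightarrow> \<bar>g p\<bar> \<le> B"
proof -
  have "bounded (g ` ({-1..1} \<times> {-1..1}))"
    by (intro compact_imp_bounded compact_continuous_image continuous_on_subset[OF assms] compact_Times) auto
  then obtain B where "\<forall>y\<in>g ` ({-1..1} \<times> {-1..1}). norm y \<le> B" unfolding bounded_iff by blast
  then show thesis using that[of B] by auto
qed

lemma AE_archimedean_box: "AE p in archimedean_measure. p \<in> {-1..1} \<times> {-1..1}"
  using AE_archimedean_disk
proof eventually_elim
  case (elim p)
  then have "(fst p)\<^sup>2 \<le> 1" "(snd p)\<^sup>2 \<le> 1"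
    using zero_le_power2[of "fst p"] zero_le_power2[of "snd p"] by linarith+
  then have "\<bar>fst p\<bar> \<le> 1" "\<bar>snd p\<bar> \<le> 1" by (simp_all add: abs_square_le_1)
  then show ?case by (simp add: mem_Times_iff abs_le_iff minus_le_iff)
qed

lemma integrable_archimedean:
  fixes g :: "real \<times> real \<Rightarrow> real"
  assumes "continuous_on UNIV g"
  shows "integrable archimedean_measure g"
proof -
  interpret prob_space archimedean_measure by (rule prob_space_archimedean_measure)
  obtain B where "\<And>p. p \<in> {-1..1} \<times> {-1..1} \<Longrightarrow> \<bar>g p\<bar> \<le> B"
    using continuous_on_box_bound[OF assms] by blast
  then have "AE p in archimedean_measure. norm (g p) \<le> B"
    using AE_archimedean_box by (auto elim: eventually_mono)
  then show ?thesis
    using borel_measurable_continuous_onI[OF assms]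
    by (intro integrable_const_bound[where B=B]) (auto cong: measurable_cong_sets)
qed

text \<open>Replaces the map in the definition, which jumps to a default path, by the continuous
  clipped map. The two agree on the closed set A of points whose great circle stays in [-1,1], and A
  contains the unit disk.\<close>

lemma archimedean_process_eq: "archimedean_process = distr archimedean_measure borel arch_path"
  unfolding archimedean_process_def
proof (rule distr_cong_AE)
  have eq: "(\<lambda>(a, b). trajectory_of (\<lambda>t. cos (pi * t) * a + sin (pi * t) * b)) = (\<lambda>p. trajectory_of (arch_fun p))"
    by (simp add: fun_eq_iff arch_fun_def[abs_def])
  define A where "A = {p. \<forall>t\<in>{0..1}. \<bar>arch_fun p t\<bar> \<le> 1}"
  have A_iff: "p \<in> A \<longleftrightarrow> is_trajectory (arch_fun p)" for p
    using continuous_on_arch_fun by (auto simp: A_def is_trajectory_def abs_le_iff minus_le_iff)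
  have on_A: "trajectory_of (arch_fun p) = arch_path p" if "p \<in> A" for p
    unfolding arch_path_def using that by (intro trajectory_of_cong) (auto simp: A_def abs_le_iff minus_le_iff)
  have "A = (\<Inter>t\<in>{0..1}. {p. \<bar>arch_fun p t\<bar> \<le> 1})" by (auto simp: A_def)
  moreover have "closed {p. \<bar>arch_fun p t\<bar> \<le> 1}" for t
    unfolding arch_fun_def by (intro closed_Collect_le continuous_intros)
  ultimately have "closed A" by auto
  have "(\<lambda>p. trajectory_of (arch_fun p)) \<in> borel_measurable borel"
  proof (rule borel_measurable_closed_piecewise[OF \<open>closed A\<close>])
    show "continuous_on A (\<lambda>p. trajectory_of (arch_fun p))"
      by (rule continuous_on_eq[OF continuous_on_arch_path]) (simp add: on_A)
    show "trajectory_of (arch_fun p) = Abs_trajectory (\<lambda>t\<in>{0..1}. 0)" if "p \<notin> A" for p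
      using that A_iff by (simp add: trajectory_of_def)
  qed
  then show "(\<lambda>(a, b). trajectory_of (\<lambda>t. cos (pi * t) * a + sin (pi * t) * b)) \<in> archimedean_measure \<rightarrow>\<^sub>M borel"
    unfolding eq by (simp cong: measurable_cong_sets)
  show "arch_path \<in> archimedean_measure \<rightarrow>\<^sub>M borel"
    using borel_measurable_continuous_onI[OF continuous_on_arch_path] by (simp cong: measurable_cong_sets)
  show "AE p in archimedean_measure. (case p of (a, b) \<Rightarrow> trajectory_of (\<lambda>t. cos (pi * t) * a + sin (pi * t) * b)) = arch_path p"
    using AE_archimedean_disk
  proof eventually_elim
    case (elim p)
    \<comment> \<open>\<open>arch_fun p t\<close> is one coordinate of a rotated copy of p, so its
      square is at most the squared norm of p.\<close>
    have rotate: "(c * x + s * y)\<^sup>2 + (c * y - s * x)\<^sup>2 = (s\<^sup>2 + c\<^sup>2) * (x\<^sup>2 + y\<^sup>2)" for c s x y :: real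
      by (simp add: power2_eq_square algebra_simps)
    have "(arch_fun p t)\<^sup>2 \<le> 1" for t
    proof -
      have "(arch_fun p t)\<^sup>2 + (cos (pi * t) * snd p - sin (pi * t) * fst p)\<^sup>2
          = ((sin (pi * t))\<^sup>2 + (cos (pi * t))\<^sup>2) * ((fst p)\<^sup>2 + (snd p)\<^sup>2)"
        unfolding arch_fun_def by (rule rotate)
      then show ?thesis using elim zero_le_power2[of "cos (pi * t) * snd p - sin (pi * t) * fst p"]
        unfolding sin_cos_squared_add mult_1 by linarith
    qed
    then have "p \<in> A" by (simp add: A_def abs_square_le_1)
    then show ?case using on_A fun_cong[OF eq, of p] by simp
  qed
qed (simp_all)

lemma archimedean_process_prob_algebra: "archimedean_process \<in> space (prob_algebra borel)"
  unfolding archimedean_process_eq space_prob_algebra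
  using borel_measurable_continuous_onI[OF continuous_on_arch_path]
  by (auto intro!: prob_space.prob_space_distr prob_space_archimedean_measure cong: measurable_cong_sets)

lemma integral_archimedean_process:
  fixes f :: "trajectory \<Rightarrow> real"
  assumes "continuous_on UNIV f"
  shows "(\<integral>x. f x \<partial>archimedean_process) = (\<integral>p. f (arch_path p) \<partial>archimedean_measure)"
  unfolding archimedean_process_eq
  using borel_measurable_continuous_onI[OF continuous_on_arch_path] borel_measurable_continuous_onI[OF assms]
  by (intro integral_distr) (auto cong: measurable_cong_sets)

section \<open>Exponential test functions on the square\<close>

inductive_set exp_span :: "(real \<times> real \<Rightarrow> real) set" where
  exp: "(\<lambda>p. c * exp (a * fst p + b * snd p)) \<in> exp_span"
| add: "f \<in> exp_span \<Longrightarrow> g \<in> exp_span \<Longrightarrow> (\<lambda>p. f p + g p) \<in> exp_span"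

text \<open>Exponents add, so the span is an algebra. The coefficient c in the generators already
  supplies constants and scalar multiples.\<close>

lemma exp_span_mult:
  assumes "f \<in> exp_span" "g \<in> exp_span"
  shows "(\<lambda>p. f p * g p) \<in> exp_span"
  using assms(1)
proof induction
  case (exp c a b)
  show ?case using assms(2)
  proof induction
    case (exp c' a' b')
    have "(\<lambda>p. c * exp (a * fst p + b * snd p) * (c' * exp (a' * fst p + b' * snd p)))
        = (\<lambda>p. (c * c') * exp ((a + a') * fst p + (b + b') * snd p))"
      by (auto simp: exp_add[symmetric] algebra_simps)
    then show ?case by (simp only: exp_span.exp)
  next
    case (add f g)
    then show ?case using exp_span.add by (fastforce simp: distrib_left)
  qed
next
  case (add f h)
  then show ?case using exp_span.add by (fastforce simp: distrib_right)
qed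

lemma continuous_on_exp_span: "f \<in> exp_span \<Longrightarrow> continuous_on S f"
  by (induction rule: exp_span.induct) (auto intro!: continuous_intros)

text \<open>Stone-Weierstrass: zero exponents give the constants, and two distinct points are
  separated by the exponential of a coordinate in which they differ.\<close>

lemma exp_span_dense:
  fixes g :: "real \<times> real \<Rightarrow> real"
  assumes "continuous_on UNIV g" "0 < e"
  obtains r where "r \<in> exp_span" "\<And>p. p \<in> {-1..1} \<times> {-1..1} \<Longrightarrow> \<bar>g p - r p\<bar> < e"
proof -
  interpret function_ring_on exp_span "{-1..1} \<times> {-1..1}"
  proof
    show "compact ({-1..1} \<times> {-1..1} :: (real \<times> real) set)" by (intro compact_Times) auto
    show "(\<lambda>_. c) \<in> exp_span" for c using exp_span.exp[of c 0 0] by simp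
    show "\<exists>f\<in>exp_span. f x \<noteq> f y" if "x \<noteq> y" for x y
    proof (cases "fst x = fst y")
      case True
      then have "snd x \<noteq> snd y" using that by (simp add: prod_eq_iff)
      then show ?thesis using exp_span.exp[of 1 0 1] by (intro bexI[of _ "\<lambda>p. 1 * exp (0 * fst p + 1 * snd p)"]) auto
    next
      case False
      then show ?thesis using exp_span.exp[of 1 1 0] by (intro bexI[of _ "\<lambda>p. 1 * exp (1 * fst p + 0 * snd p)"]) auto
    qed
  qed (auto intro: continuous_on_exp_span exp_span.add exp_span_mult)
  show thesis
    using Stone_Weierstrass_basic[OF continuous_on_subset[OF assms(1)] assms(2)] that by auto
qed

lemma abs_exp_diff_le:
  fixes a b :: real
  assumes "\<bar>a\<bar> \<le> C" "\<bar>b\<bar> \<le> C"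
  shows "\<bar>exp a - exp b\<bar> \<le> exp C * \<bar>a - b\<bar>"
proof -
  have *: "exp u - exp v \<le> exp C * \<bar>u - v\<bar>" if "\<bar>u\<bar> \<le> C" for u v :: real
  proof -
    have "1 - exp (v - u) \<le> u - v" using exp_ge_add_one_self[of "v - u"] by linarith
    then have "exp u * (1 - exp (v - u)) \<le> exp u * (u - v)" by (intro mult_left_mono) auto
    also have "exp u * (u - v) \<le> exp u * \<bar>u - v\<bar>" by (intro mult_left_mono) auto
    also have "\<dots> \<le> exp C * \<bar>u - v\<bar>" using that by (intro mult_right_mono) auto
    finally show ?thesis by (simp add: right_diff_distrib mult_exp_exp)
  qed
  show ?thesis using *[OF assms(1), of b] *[OF assms(2), of a] by (simp add: abs_le_iff abs_minus_commute)
qed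

text \<open>A radius s of either sign lets the half circle of angles \<pi> t reach every linear
  form. The direction t = 1 is traded for t = 0 with the opposite sign of s, which avoids the angle
  excluded for rotations.\<close>

lemma polar_direction:
  fixes a b :: real
  obtains s t where "t \<in> {0..1}" "cos (pi * t) \<noteq> -1" "a = s * cos (pi * t)" "b = s * sin (pi * t)"
proof -
  have pos: "\<exists>s t. t \<in> {0..1} \<and> a = s * cos (pi * t) \<and> b = s * sin (pi * t)" if "b \<ge> 0" for a b :: real
  proof (cases "a = 0 \<and> b = 0")
    case True
    then show ?thesis by (intro exI[of _ 0]) auto
  next
    case False
    define s where "s = sqrt (a\<^sup>2 + b\<^sup>2)"
    have "s > 0" using False by (simp add: s_def sum_power2_gt_zero_iff)
    have "(a / s)\<^sup>2 + (b / s)\<^sup>2 = 1"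
      using \<open>s > 0\<close> by (simp add: power_divide add_divide_distrib[symmetric] s_def sum_power2_gt_zero_iff)
    moreover have "0 \<le> b / s" using that \<open>s > 0\<close> by simp
    ultimately obtain u where u: "0 \<le> u" "u \<le> pi" "a / s = cos u" "b / s = sin u"
      using sincos_total_pi[of "b / s" "a / s"] by auto
    then show ?thesis using \<open>s > 0\<close>
      by (intro exI[of _ s] exI[of _ "u / pi"]) (auto simp: field_simps)
  qed
  have "\<exists>s t. t \<in> {0..1} \<and> a = s * cos (pi * t) \<and> b = s * sin (pi * t)"
  proof (cases "b \<ge> 0")
    case False
    then obtain s t where "t \<in> {0..1}" "- a = s * cos (pi * t)" "- b = s * sin (pi * t)"
      using pos[of "- b" "- a"] by auto
    then show ?thesis by (intro exI[of _ "- s"] exI[of _ t]) auto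
  qed (rule pos)
  then obtain s t where st: "t \<in> {0..1}" "a = s * cos (pi * t)" "b = s * sin (pi * t)" by blast
  show thesis
  proof (cases "cos (pi * t) = -1")
    case True
    then have "sin (pi * t) = 0" using sin_cos_squared_add[of "pi * t"] by simp
    then show ?thesis using that[of 0 "- s"] st True by simp
  qed (use that st in auto)
qed

lemma exp_antiderivative:
  fixes s :: real
  obtains H where "\<And>u. (H has_real_derivative exp (s * u)) (at u)"
proof (cases "s = 0")
  case True
  then show ?thesis by (intro that[of "\<lambda>u. u"]) (auto intro!: derivative_eq_intros)
next
  case False
  then show ?thesis by (intro that[of "\<lambda>u. exp (s * u) / s"]) (auto intro!: derivative_eq_intros)
qed

text \<open>A continuous function on the path space need not be uniformly continuous, but it is so
  when one of the two points stays in a compact set: d is a Lebesgue number of the cover of Q by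
  sets where f varies by less than e/2 from a value f z.\<close>

lemma uniformly_continuous_near_compact:
  fixes f :: "'a::metric_space \<Rightarrow> real"
  assumes f: "continuous_on UNIV f" and Q: "compact Q" and "0 < e"
  obtains d where "0 < d" "\<And>x y. y \<in> Q \<Longrightarrow> dist y x < d \<Longrightarrow> \<bar>f x - f y\<bar> < e"
proof -
  define G where "G = (\<lambda>z. {x. \<bar>f x - f z\<bar> < e / 2}) ` Q"
  have op: "open U" if "U \<in> G" for U
    using that f unfolding G_def by (auto intro!: open_Collect_less continuous_intros)
  have "Q \<subseteq> \<Union>G" using \<open>0 < e\<close> by (auto simp: G_def)
  then obtain d where d: "0 < d" "\<And>y. y \<in> Q \<Longrightarrow> \<exists>U\<in>G. ball y d \<subseteq> U"
    using Heine_Borel_lemma[OF Q _ op] by metis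
  show thesis
  proof (rule that[OF d(1)])
    fix x y assume y: "y \<in> Q" "dist y x < d"
    then obtain z where z: "ball y d \<subseteq> {x. \<bar>f x - f z\<bar> < e / 2}" using d(2)[of y] by (auto simp: G_def)
    have "x \<in> ball y d" "y \<in> ball y d" using y d(1) by auto
    then have "x \<in> {x. \<bar>f x - f z\<bar> < e / 2}" "y \<in> {x. \<bar>f x - f z\<bar> < e / 2}" using z by blast+
    then have "\<bar>f x - f z\<bar> < e / 2" "\<bar>f y - f z\<bar> < e / 2" by auto
    then show "\<bar>f x - f y\<bar> < e" by linarith
  qed
qed

section \<open>The limit\<close>

locale stationary_trajectory_sequence =
  fixes M :: "nat \<Rightarrow> 'a measure"
    and X :: "nat \<Rightarrow> 'a \<Rightarrow> trajectory measure"
    and \<epsilon> :: "nat \<Rightarrow> real"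
    and c :: real
  assumes offset: "0 \<le> c" "c \<le> 1"
    and process: "\<And>n. n \<ge> 1 \<Longrightarrow> random_trajectory_process c n (M n) (X n)"
    and tight: "tight_sequence weak_topology M X"
    and eps_pos: "\<And>n. n \<ge> 1 \<Longrightarrow> \<epsilon> n > 0"
    and eps_lim: "\<epsilon> \<longlonglongrightarrow> 0"
    and stationary: "\<And>n. n \<ge> 1 \<Longrightarrow> stationary (\<epsilon> n) (M n) (X n)"
    and energy: "Limsup (at_right (0::real)) (\<lambda>t. limsup (\<lambda>n.
        ereal ((\<integral>\<omega>. (\<integral>x. (path x t - path x 0)\<^sup>2 \<partial>X n \<omega>) \<partial>M n) / t\<^sup>2)))
      \<le> ereal (pi\<^sup>2 / 3)"
begin

abbreviation \<nu> :: "nat \<Rightarrow> trajectory measure" where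
  "\<nu> n \<equiv> discrete_random_measure.annealed (M n) (X n)"

abbreviation seq_corr :: "nat \<Rightarrow> real \<Rightarrow> real \<Rightarrow> real" where
  "seq_corr n \<equiv> random_trajectories.corr (M n) (X n)"

lemma trajectories: "1 \<le> n \<Longrightarrow> random_trajectories (M n) (X n)"
  using random_trajectory_process_discrete[OF process] by (simp add: random_trajectories_def)

lemma discrete: "1 \<le> n \<Longrightarrow> discrete_random_measure (M n) (X n)"
  by (rule random_trajectory_process_discrete[OF process])

lemma eventually_stationary:
  "eventually (\<lambda>n. 1 \<le> n \<and> stationary_random_trajectories (M n) (X n) (\<epsilon> n)) sequentially"
  using order_tendstoD(2)[OF eps_lim, of 1, simplified] eventually_ge_at_top[of 1]
proof eventually_elim
  case (elim n)
  then show ?case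
    using trajectories stationary eps_pos
    by (auto simp: stationary_random_trajectories_def stationary_random_trajectories_axioms_def)
qed

text \<open>Tightness at level e/4 gives a compact set of measures on which the mean modulus is
  below e/2; outside it the modulus is at most 2, which adds at most 2 * e/4.\<close>

lemma uniform_modulus:
  assumes "0 < e"
  obtains h where "0 < h" "\<And>n. 1 \<le> n \<Longrightarrow> (\<integral>x. modulus h x \<partial>\<nu> n) \<le> e"
proof -
  obtain K where K: "compactin weak_topology K"
      "\<And>n. 1 \<le> n \<Longrightarrow> measure (M n) {\<omega> \<in> space (M n). X n \<omega> \<in> K} \<ge> 1 - e / 4"
    using tight \<open>0 < e\<close> unfolding tight_sequence_def by (metis divide_pos_pos zero_less_numeral)
  obtain h where h: "0 < h" "\<And>\<mu>. \<mu> \<in> K \<Longrightarrow> (\<integral>x. modulus h x \<partial>\<mu>) < e / 2"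
    using compactin_modulus[OF K(1), of "e / 2"] \<open>0 < e\<close> by auto
  show thesis
  proof (rule that[OF h(1)])
    fix n :: nat assume n: "1 \<le> n"
    interpret discrete_random_measure "M n" "X n" by (rule discrete[OF n])
    define A where "A = {\<omega> \<in> space (M n). X n \<omega> \<in> K}"
    have "A = X n -` (K \<inter> space (prob_algebra borel)) \<inter> space (M n)" using X_in by (auto simp: A_def)
    also have "\<dots> \<in> sets (M n)" by (rule measurable_sets[OF X_measurable]) simp
    finally have A: "A \<in> sets (M n)" .
    have bounds: "modulus h \<in> borel_measurable borel" "\<And>x. \<bar>modulus h x\<bar> \<le> 2"
      using h(1) by (auto simp: modulus_nonneg modulus_le_2)
    have "(\<integral>x. modulus h x \<partial>\<nu> n) = (\<integral>\<omega>. (\<integral>x. modulus h x \<partial>X n \<omega>) \<partial>M n)"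
      by (rule integral_annealed[OF bounds])
    also have "\<dots> \<le> (\<integral>\<omega>. e / 2 + 2 * (1 - indicator A \<omega>) \<partial>M n)"
    proof (rule integral_mono)
      fix \<omega> assume \<omega>: "\<omega> \<in> space (M n)"
      show "(\<integral>x. modulus h x \<partial>X n \<omega>) \<le> e / 2 + 2 * (1 - indicator A \<omega>)"
      proof (cases "\<omega> \<in> A")
        case True
        then show ?thesis using h(2)[of "X n \<omega>"] by (auto simp: A_def)
      next
        case False
        then show ?thesis using abs_integral_X_le[OF \<omega> bounds] \<open>0 < e\<close> by simp
      qed
    next
      show "integrable (M n) (\<lambda>\<omega>. \<integral>x. modulus h x \<partial>X n \<omega>)"
        by (rule integrable_integral_X[OF bounds])
      show "integrable (M n) (\<lambda>\<omega>. e / 2 + 2 * (1 - indicator A \<omega>))"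
        using A by (intro Bochner_Integration.integrable_add Bochner_Integration.integrable_diff integrable_mult_right) (auto simp: emeasure_eq_measure)
    qed
    also have "\<dots> = e / 2 + 2 * (1 - measure (M n) A)"
      using A by (simp add: prob_space emeasure_eq_measure)
    also have "\<dots> \<le> e" using K(2)[OF n] by (simp add: A_def)
    finally show "(\<integral>x. modulus h x \<partial>\<nu> n) \<le> e" .
  qed
qed

lemma modulus_eps_tendsto_0: "(\<lambda>n. \<integral>x. modulus (\<epsilon> n) x \<partial>\<nu> n) \<longlonglongrightarrow> 0"
proof (rule tendstoI)
  fix e :: real assume "0 < e"
  obtain h where h: "0 < h" "\<And>n. 1 \<le> n \<Longrightarrow> (\<integral>x. modulus h x \<partial>\<nu> n) \<le> e / 2"
    using uniform_modulus[of "e / 2"] \<open>0 < e\<close> by auto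
  show "eventually (\<lambda>n. dist (\<integral>x. modulus (\<epsilon> n) x \<partial>\<nu> n) 0 < e) sequentially"
    using order_tendstoD(2)[OF eps_lim h(1)] eventually_stationary
  proof eventually_elim
    case (elim n)
    interpret stationary_random_trajectories "M n" "X n" "\<epsilon> n" using elim by simp
    have "(\<integral>x. modulus (\<epsilon> n) x \<partial>\<nu> n) \<le> (\<integral>x. modulus h x \<partial>\<nu> n)"
      using elim \<epsilon> h by (intro integral_mono integrable_modulus modulus_mono) auto
    also have "\<dots> \<le> e / 2" using h(2) elim by simp
    finally show ?case using \<open>0 < e\<close> integral_modulus_nonneg[of "\<epsilon> n"] \<epsilon> by (simp add: dist_real_def)
  qed
qed

section \<open>Limits of marginals and of the second moment kernel\<close>

lemma marginal_convergence:
  fixes \<phi> \<Phi> :: "real \<Rightarrow> real"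
  assumes cont: "continuous_on UNIV \<phi>"
    and der: "\<And>u. -1 \<le> u \<Longrightarrow> u \<le> 1 \<Longrightarrow> (\<Phi> has_real_derivative \<phi> u) (at u)"
    and lip: "\<And>u v. u \<in> {-1..1} \<Longrightarrow> v \<in> {-1..1} \<Longrightarrow> \<bar>\<phi> u - \<phi> v\<bar> \<le> L * \<bar>u - v\<bar>" and "0 \<le> L"
    and t: "t \<in> {0..1}"
  shows "(\<lambda>n. \<integral>\<omega>. \<bar>(\<integral>x. \<phi> (path x t) \<partial>X n \<omega>) - (\<Phi> 1 - \<Phi> (-1)) / 2\<bar> \<partial>M n) \<longlonglongrightarrow> 0"
proof (rule tendsto_sandwich[OF _ _ tendsto_const])
  show "eventually (\<lambda>n. 0 \<le> (\<integral>\<omega>. \<bar>(\<integral>x. \<phi> (path x t) \<partial>X n \<omega>) - (\<Phi> 1 - \<Phi> (-1)) / 2\<bar> \<partial>M n)) sequentially"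
    by (simp add: Bochner_Integration.integral_nonneg)
  show "eventually (\<lambda>n. (\<integral>\<omega>. \<bar>(\<integral>x. \<phi> (path x t) \<partial>X n \<omega>) - (\<Phi> 1 - \<Phi> (-1)) / 2\<bar> \<partial>M n)
      \<le> 2 * L / real n + L * (\<integral>x. modulus (\<epsilon> n) x \<partial>\<nu> n)) sequentially"
    using eventually_stationary
  proof eventually_elim
    case (elim n)
    then interpret stationary_random_trajectories "M n" "X n" "\<epsilon> n" by simp
    show ?case
      by (rule marginal_deviation_le[OF process _ offset cont der lip]) (use elim t \<open>0 \<le> L\<close> in auto)
  qed
  have "(\<lambda>n. 2 * L / real n + L * (\<integral>x. modulus (\<epsilon> n) x \<partial>\<nu> n)) \<longlonglongrightarrow> 0 + L * 0"
    by (intro tendsto_add tendsto_mult tendsto_const modulus_eps_tendsto_0 lim_const_over_n)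
  then show "(\<lambda>n. 2 * L / real n + L * (\<integral>x. modulus (\<epsilon> n) x \<partial>\<nu> n)) \<longlonglongrightarrow> 0" by simp
qed

lemma corr_diag_tendsto:
  assumes t: "t \<in> {0..1}"
  shows "(\<lambda>n. seq_corr n t t) \<longlonglongrightarrow> 1/3"
proof -
  have "(\<lambda>n. \<integral>\<omega>. \<bar>(\<integral>x. (path x t)\<^sup>2 \<partial>X n \<omega>) - (1 ^ 3 / 3 - (-1) ^ 3 / 3) / 2\<bar> \<partial>M n) \<longlonglongrightarrow> 0"
  proof (rule marginal_convergence[where L=2, OF _ _ _ _ t])
    show "((\<lambda>u. u ^ 3 / 3) has_real_derivative u\<^sup>2) (at u)" for u :: real
      by (auto intro!: derivative_eq_intros)
    fix u v :: real assume uv: "u \<in> {-1..1}" "v \<in> {-1..1}"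
    have "\<bar>u\<^sup>2 - v\<^sup>2\<bar> = \<bar>u + v\<bar> * \<bar>u - v\<bar>"
      by (simp add: abs_mult[symmetric] power2_eq_square algebra_simps)
    also have "\<dots> \<le> 2 * \<bar>u - v\<bar>" using uv by (intro mult_right_mono) auto
    finally show "\<bar>u\<^sup>2 - v\<^sup>2\<bar> \<le> 2 * \<bar>u - v\<bar>" .
  qed (auto intro!: continuous_intros)
  then have lim: "(\<lambda>n. \<integral>\<omega>. \<bar>(\<integral>x. (path x t)\<^sup>2 \<partial>X n \<omega>) - 1/3\<bar> \<partial>M n) \<longlonglongrightarrow> 0" by simp
  show ?thesis
  proof (rule Lim_null_comparison[THEN LIM_zero_cancel, OF _ lim])
    show "eventually (\<lambda>n. norm (seq_corr n t t - 1/3) \<le> (\<integral>\<omega>. \<bar>(\<integral>x. (path x t)\<^sup>2 \<partial>X n \<omega>) - 1/3\<bar> \<partial>M n)) sequentially"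
      using eventually_ge_at_top[of 1]
    proof eventually_elim
      case (elim n)
      interpret random_trajectories "M n" "X n" by (rule trajectories[OF elim])
      have b: "(\<lambda>x. (path x t)\<^sup>2) \<in> borel_measurable borel" "\<And>x. \<bar>(path x t)\<^sup>2\<bar> \<le> 1"
        using t abs_path_le[OF t] by (auto simp: abs_square_le_1)
      have "seq_corr n t t - 1/3 = (\<integral>\<omega>. (\<integral>x. (path x t)\<^sup>2 \<partial>X n \<omega>) - 1/3 \<partial>M n)"
        using integral_annealed[OF b] integrable_integral_X[OF b]
        by (simp add: corr_def power2_eq_square prob_space)
      then show ?case using integral_abs_bound by simp
    qed
  qed
qed

lemma energy_bound:
  assumes "0 < \<eta>"
  shows "eventually (\<lambda>h. eventually (\<lambda>n.
      seq_corr n 0 0 + seq_corr n h h - 2 * seq_corr n 0 h \<le> (pi\<^sup>2 / 3 + \<eta>) * h\<^sup>2) sequentially) (at_right 0)"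
proof -
  have "Limsup (at_right (0::real)) (\<lambda>t. limsup (\<lambda>n.
        ereal ((\<integral>\<omega>. (\<integral>x. (path x t - path x 0)\<^sup>2 \<partial>X n \<omega>) \<partial>M n) / t\<^sup>2))) < ereal (pi\<^sup>2 / 3 + \<eta>)"
    by (rule le_less_trans[OF energy]) (use assms in simp)
  then have "eventually (\<lambda>t. limsup (\<lambda>n.
        ereal ((\<integral>\<omega>. (\<integral>x. (path x t - path x 0)\<^sup>2 \<partial>X n \<omega>) \<partial>M n) / t\<^sup>2)) < ereal (pi\<^sup>2 / 3 + \<eta>)) (at_right 0)"
    by (rule Limsup_lessD)
  moreover have "eventually (\<lambda>t::real. t \<in> {0<..<1}) (at_right 0)"
    by (rule eventually_at_right_real) simp
  ultimately show ?thesis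
  proof eventually_elim
    case (elim h)
    from Limsup_lessD[OF elim(1)] eventually_ge_at_top[of 1] show ?case
    proof eventually_elim
      case (elim n)
      interpret random_trajectories "M n" "X n" by (rule trajectories[OF elim(2)])
      have mem: "h \<in> {0..1}" "0 \<in> {0..1::real}" using \<open>h \<in> {0<..<1}\<close> by auto
      have "\<bar>(path x h - path x 0)\<^sup>2\<bar> \<le> 2\<^sup>2" for x
        using abs_path_le[OF mem(1), of x] abs_path_le[OF mem(2), of x]
        unfolding abs_power2 by (intro abs_le_square_iff[THEN iffD1]) auto
      then have "(\<integral>\<omega>. (\<integral>x. (path x h - path x 0)\<^sup>2 \<partial>X n \<omega>) \<partial>M n) = (\<integral>x. (path x h - path x 0)\<^sup>2 \<partial>\<nu> n)"
        using mem by (intro integral_annealed[symmetric]) auto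
      also have "\<dots> = seq_corr n 0 0 + seq_corr n h h - 2 * seq_corr n 0 h"
        \<comment> \<open>The third weight is 0, and the repeated time h only fills its
          slot.\<close>
        using integral_quadratic[OF mem(2) mem(1) mem(1), of "-1" 1 0] by simp
      finally show ?case using elim \<open>h \<in> {0<..<1}\<close> by (simp add: field_simps)
    qed
  qed
qed

lemma corr_tendsto:
  assumes st: "0 \<le> s" "s \<le> t" "t \<le> 1"
  shows "(\<lambda>n. seq_corr n s t) \<longlonglongrightarrow> cos (pi * (t - s)) / 3"
proof -
  \<comment> \<open>The data at n = 0 is unconstrained, whereas symmetry of the kernel is required
    for every n; setting the kernel to 0 there does not affect the limit.\<close>
  define c' where "c' n = (if 1 \<le> n then seq_corr n else (\<lambda>_ _. 0))" for n
  have c': "eventually (\<lambda>n. c' n = seq_corr n) sequentially"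
    using eventually_ge_at_top[of 1] by eventually_elim (simp add: c'_def)
  have "(\<lambda>n. c' n s t) \<longlonglongrightarrow> cos (pi * (t - s)) / 3"
  proof (rule stationary_kernel_limit[OF _ _ _ _ _ _ st])
    show "c' n s t = c' n t s" for n s t
      using random_trajectories.corr_commute[OF trajectories] by (simp add: c'_def)
    show "0 \<le> u\<^sup>2 * c' n r r + v\<^sup>2 * c' n s s + w\<^sup>2 * c' n t t
        + 2 * u * v * c' n r s + 2 * v * w * c' n s t + 2 * u * w * c' n r t"
      if "1 \<le> n" "{r, s, t} \<subseteq> {0..1}" for n r s t u v w
    proof -
      interpret random_trajectories "M n" "X n" by (rule trajectories[OF that(1)])
      have "0 \<le> (\<integral>x. (u * path x r + v * path x s + w * path x t)\<^sup>2 \<partial>annealed)"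
        by (intro Bochner_Integration.integral_nonneg) simp
      moreover have "r \<in> {0..1}" "s \<in> {0..1}" "t \<in> {0..1}" using that(2) by auto
      ultimately show ?thesis using that(1) by (simp only: integral_quadratic c'_def if_True)
    qed
    show "(\<lambda>n. c' n t t) \<longlonglongrightarrow> 1/3" if "t \<in> {0..1}" for t
      by (rule Lim_transform_eventually[OF corr_diag_tendsto[OF that]])
         (use c' in \<open>auto elim: eventually_mono\<close>)
    show "(\<lambda>n. c' n s (s + h) - c' n 0 h) \<longlonglongrightarrow> 0" if "0 \<le> s" "0 \<le> h" "s + h \<le> 1" for s h
    proof (rule Lim_null_comparison)
      show "eventually (\<lambda>n. norm (c' n s (s + h) - c' n 0 h) \<le> 2 * (\<integral>x. modulus (\<epsilon> n) x \<partial>\<nu> n)) sequentially"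
        using eventually_stationary c'
      proof eventually_elim
        case (elim n)
        then interpret stationary_random_trajectories "M n" "X n" "\<epsilon> n" by simp
        show ?case using corr_approx_stationary[OF that] elim by simp
      qed
      show "(\<lambda>n. 2 * (\<integral>x. modulus (\<epsilon> n) x \<partial>\<nu> n)) \<longlonglongrightarrow> 0"
        using tendsto_mult[OF tendsto_const modulus_eps_tendsto_0, of 2] by simp
    qed
    show "eventually (\<lambda>h. eventually (\<lambda>n. c' n 0 0 + c' n h h - 2 * c' n 0 h \<le> (pi\<^sup>2 / 3 + \<eta>) * h\<^sup>2) sequentially) (at_right 0)"
      if "0 < \<eta>" for \<eta>
      using energy_bound[OF that]
    proof eventually_elim
      case (elim h)
      from elim c' show ?case by eventually_elim simp
    qed
    show "eventually (\<lambda>n. c' n 0 1 = - c' n 0 0 \<and> c' n 1 1 = c' n 0 0) sequentially"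
      using eventually_stationary c'
    proof eventually_elim
      case (elim n)
      then interpret stationary_random_trajectories "M n" "X n" "\<epsilon> n" by simp
      show ?case using corr_antiperiodic elim by simp
    qed
  qed
  then show ?thesis
    by (rule Lim_transform_eventually) (use c' in \<open>auto elim: eventually_mono\<close>)
qed

text \<open>Expanding the square of X(t) - C X(0) - S X(1/2) gives, in the limit, (1 - C^2 - S^2) /
  3 = 0: the inner products with X(0) and X(1/2) tend to C/3 and S/3, and X(0), X(1/2) become
  orthogonal.\<close>

lemma frame_determines_square:
  assumes t: "t \<in> {0..1}"
  shows "(\<lambda>n. \<integral>x. (path x t - arch_fun (frame x) t)\<^sup>2 \<partial>\<nu> n) \<longlonglongrightarrow> 0"
proof -
  define C S where "C = cos (pi * t)" and "S = sin (pi * t)"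
  \<comment> \<open>The kernel limit is available for ordered times only, hence the two cases; both
    give cos (\<pi> (t - 1/2)) = sin (\<pi> t).\<close>
  have half: "(\<lambda>n. seq_corr n (1/2) t) \<longlonglongrightarrow> S / 3"
  proof (cases "t \<le> 1/2")
    case True
    have "(\<lambda>n. seq_corr n t (1/2)) \<longlonglongrightarrow> cos (pi * (1/2 - t)) / 3"
      using True t by (intro corr_tendsto) auto
    moreover have "eventually (\<lambda>n. seq_corr n t (1/2) = seq_corr n (1/2) t) sequentially"
      using eventually_ge_at_top[of 1] by eventually_elim (rule random_trajectories.corr_commute[OF trajectories])
    ultimately have "(\<lambda>n. seq_corr n (1/2) t) \<longlonglongrightarrow> cos (pi * (1/2 - t)) / 3"
      by (rule Lim_transform_eventually)
    moreover have "cos (pi * (1/2 - t)) = S"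
      by (simp add: S_def right_diff_distrib cos_diff)
    ultimately show ?thesis by simp
  next
    case False
    have "(\<lambda>n. seq_corr n (1/2) t) \<longlonglongrightarrow> cos (pi * (t - 1/2)) / 3"
      using False t by (intro corr_tendsto) auto
    moreover have "cos (pi * (t - 1/2)) = S"
      by (simp add: S_def right_diff_distrib cos_diff)
    ultimately show ?thesis by simp
  qed
  have zero_half: "(\<lambda>n. seq_corr n 0 (1/2)) \<longlonglongrightarrow> 0"
    using corr_tendsto[of 0 "1/2"] by simp
  have zero_t: "(\<lambda>n. seq_corr n 0 t) \<longlonglongrightarrow> C / 3"
    using corr_tendsto[of 0 t] t by (simp add: C_def)
  have SC: "S\<^sup>2 + C\<^sup>2 = 1" by (simp add: C_def S_def)
  have "(-C)\<^sup>2 * (1/3) + (-S)\<^sup>2 * (1/3) + 1\<^sup>2 * (1/3) + 2 * (-C) * (-S) * 0 + 2 * (-S) * 1 * (S/3) + 2 * (-C) * 1 * (C/3)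
      = (1 - (S\<^sup>2 + C\<^sup>2)) / 3"
    by (simp add: power2_eq_square field_simps)
  also have "\<dots> = 0" by (simp add: SC)
  finally have val: "(-C)\<^sup>2 * (1/3) + (-S)\<^sup>2 * (1/3) + 1\<^sup>2 * (1/3) + 2 * (-C) * (-S) * 0 + 2 * (-S) * 1 * (S/3) + 2 * (-C) * 1 * (C/3) = 0" .
  have "(\<lambda>n. (-C)\<^sup>2 * seq_corr n 0 0 + (-S)\<^sup>2 * seq_corr n (1/2) (1/2) + 1\<^sup>2 * seq_corr n t t
      + 2 * (-C) * (-S) * seq_corr n 0 (1/2) + 2 * (-S) * 1 * seq_corr n (1/2) t + 2 * (-C) * 1 * seq_corr n 0 t)
    \<longlonglongrightarrow> (-C)\<^sup>2 * (1/3) + (-S)\<^sup>2 * (1/3) + 1\<^sup>2 * (1/3) + 2 * (-C) * (-S) * 0 + 2 * (-S) * 1 * (S/3) + 2 * (-C) * 1 * (C/3)"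
    using t by (intro tendsto_add tendsto_mult tendsto_const corr_diag_tendsto zero_half half zero_t) auto
  then show ?thesis unfolding val
  proof (rule Lim_transform_eventually)
    show "eventually (\<lambda>n. (-C)\<^sup>2 * seq_corr n 0 0 + (-S)\<^sup>2 * seq_corr n (1/2) (1/2) + 1\<^sup>2 * seq_corr n t t
      + 2 * (-C) * (-S) * seq_corr n 0 (1/2) + 2 * (-S) * 1 * seq_corr n (1/2) t + 2 * (-C) * 1 * seq_corr n 0 t
      = (\<integral>x. (path x t - arch_fun (frame x) t)\<^sup>2 \<partial>\<nu> n)) sequentially"
      using eventually_ge_at_top[of 1]
    proof eventually_elim
      case (elim n)
      interpret random_trajectories "M n" "X n" by (rule trajectories[OF elim])
      have "(path x t - arch_fun (frame x) t)\<^sup>2 = ((-C) * path x 0 + (-S) * path x (1/2) + 1 * path x t)\<^sup>2" for x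
        by (simp add: arch_fun_def frame_def C_def S_def algebra_simps)
      then show ?case using integral_quadratic[of 0 "1/2" t "-C" "-S" 1] t by simp
    qed
  qed
qed

lemma borel_measurable_arch_fun_frame [measurable]:
  "(\<lambda>x. arch_fun (frame x) t) \<in> borel_measurable borel"
  unfolding arch_fun_def by (intro borel_measurable_continuous_onI continuous_intros continuous_on_frame)

lemma abs_arch_fun_frame_le: "\<bar>arch_fun (frame x) t\<bar> \<le> 2"
proof -
  have "\<bar>arch_fun (frame x) t\<bar> \<le> \<bar>cos (pi * t)\<bar> * \<bar>fst (frame x)\<bar> + \<bar>sin (pi * t)\<bar> * \<bar>snd (frame x)\<bar>"
    unfolding arch_fun_def by (metis abs_mult abs_triangle_ineq)
  also have "\<dots> \<le> 1 * 1 + 1 * 1" by (intro add_mono mult_mono abs_frame_le) auto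
  finally show ?thesis by simp
qed

lemma integrable_frame_error:
  assumes "1 \<le> n" "t \<in> {0..1}"
  shows "integrable (\<nu> n) (\<lambda>x. \<bar>path x t - arch_fun (frame x) t\<bar>)"
    and "integrable (\<nu> n) (\<lambda>x. (path x t - arch_fun (frame x) t)\<^sup>2)"
proof -
  interpret discrete_random_measure "M n" "X n" by (rule discrete[OF assms(1)])
  have b: "\<bar>path x t - arch_fun (frame x) t\<bar> \<le> 3" for x
    using abs_path_le[OF assms(2), of x] abs_arch_fun_frame_le[of x t] by linarith
  show "integrable (\<nu> n) (\<lambda>x. \<bar>path x t - arch_fun (frame x) t\<bar>)"
    using b assms by (intro integrable_annealed[where B=3]) auto
  have "(path x t - arch_fun (frame x) t)\<^sup>2 \<le> 3\<^sup>2" for x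
    using b[of x] by (intro abs_le_square_iff[THEN iffD1]) auto
  then show "integrable (\<nu> n) (\<lambda>x. (path x t - arch_fun (frame x) t)\<^sup>2)"
    using assms by (intro integrable_annealed[where B="3\<^sup>2"]) auto
qed

lemma frame_determines:
  assumes t: "t \<in> {0..1}"
  shows "(\<lambda>n. \<integral>x. \<bar>path x t - arch_fun (frame x) t\<bar> \<partial>\<nu> n) \<longlonglongrightarrow> 0"
proof (rule tendstoI)
  fix e :: real assume "0 < e"
  have "0 < e\<^sup>2" using \<open>0 < e\<close> by simp
  show "eventually (\<lambda>n. dist (\<integral>x. \<bar>path x t - arch_fun (frame x) t\<bar> \<partial>\<nu> n) 0 < e) sequentially"
    using order_tendstoD(2)[OF frame_determines_square[OF t] \<open>0 < e\<^sup>2\<close>] eventually_ge_at_top[of 1]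
  proof eventually_elim
    case (elim n)
    interpret discrete_random_measure "M n" "X n" by (rule discrete[OF elim(2)])
    interpret A: prob_space "\<nu> n" by (rule prob_space_annealed)
    note int = integrable_frame_error[OF elim(2) t]
    have "(\<integral>x. \<bar>path x t - arch_fun (frame x) t\<bar> \<partial>\<nu> n)
        \<le> (\<integral>x. e / 2 + (path x t - arch_fun (frame x) t)\<^sup>2 / (2 * e) \<partial>\<nu> n)"
    proof (rule integral_mono)
      fix x
      define d where "d = \<bar>path x t - arch_fun (frame x) t\<bar>"
      \<comment> \<open>Young's inequality d \<le> e/2 + d^2 / (2 e) passes from L^2 to L^1: a
        second moment below e^2 makes the mean smaller than e.\<close>
      have "0 \<le> (d - e)\<^sup>2" by simp
      then have "d * (2 * e) \<le> (e / 2) * (2 * e) + d\<^sup>2" by (simp add: power2_eq_square algebra_simps)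
      then have "d \<le> e / 2 + d\<^sup>2 / (2 * e)" using \<open>0 < e\<close> by (simp add: field_simps)
      then show "\<bar>path x t - arch_fun (frame x) t\<bar> \<le> e / 2 + (path x t - arch_fun (frame x) t)\<^sup>2 / (2 * e)"
        by (simp add: d_def)
    qed (use int in auto)
    also have "\<dots> = e / 2 + (\<integral>x. (path x t - arch_fun (frame x) t)\<^sup>2 \<partial>\<nu> n) / (2 * e)"
      using int by (simp add: A.prob_space)
    also have "\<dots> < e / 2 + e\<^sup>2 / (2 * e)" using elim \<open>0 < e\<close> by (intro add_strict_left_mono divide_strict_right_mono) auto
    also have "\<dots> = e" using \<open>0 < e\<close> by (simp add: power2_eq_square)
    finally show ?case by (simp add: dist_real_def Bochner_Integration.integral_nonneg)
  qed
qed

lemma continuous_on_dist_arch_path: "continuous_on S (\<lambda>x. dist x (arch_path (frame x)))"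
  by (intro continuous_intros continuous_on_compose2[OF continuous_on_arch_path continuous_on_frame]) auto

lemma dist_arch_path_bounds:
  "(\<lambda>x. dist x (arch_path (frame x))) \<in> borel_measurable borel" "\<bar>dist x (arch_path (frame x))\<bar> \<le> 2"
proof -
  show "(\<lambda>x. dist x (arch_path (frame x))) \<in> borel_measurable borel"
    by (rule borel_measurable_continuous_onI[OF continuous_on_dist_arch_path])
  have "dist x y \<le> 2" for x y :: trajectory
  proof (rule dist_trajectory_le)
    fix t :: real assume "t \<in> {0..1}"
    from abs_path_le[OF this, of x] abs_path_le[OF this, of y]
    show "\<bar>path x t - path y t\<bar> \<le> 2" by linarith
  qed
  then show "\<bar>dist x (arch_path (frame x))\<bar> \<le> 2" by simp
qed

text \<open>Upgrades convergence at each fixed time to uniform distance. The modulus scale h is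
  chosen from tightness before the grid size m, and n goes to infinity last, so only finitely many
  times are involved.\<close>

lemma dist_arch_path_tendsto_0: "(\<lambda>n. \<integral>x. dist x (arch_path (frame x)) \<partial>\<nu> n) \<longlonglongrightarrow> 0"
proof (rule tendstoI)
  fix e :: real assume "0 < e"
  obtain h where h: "0 < h" "\<And>n. 1 \<le> n \<Longrightarrow> (\<integral>x. modulus h x \<partial>\<nu> n) \<le> e / 3"
    using uniform_modulus[of "e / 3"] \<open>0 < e\<close> by auto
  have "eventually (\<lambda>m. 1 / real m < h) sequentially" "eventually (\<lambda>m. 2 * pi / real m < e / 3) sequentially"
    using order_tendstoD(2)[OF lim_const_over_n[of 1] h(1)] order_tendstoD(2)[OF lim_const_over_n[of "2 * pi"], of "e / 3"] \<open>0 < e\<close>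
    by auto
  then have "eventually (\<lambda>m. 1 / real m < h \<and> 2 * pi / real m < e / 3 \<and> 1 \<le> m) sequentially"
    using eventually_ge_at_top[of 1] by eventually_elim simp
  then obtain m :: nat where m: "1 / real m < h" "2 * pi / real m < e / 3" "1 \<le> m"
    by (auto dest: eventually_happens)
  have mem: "real j / real m \<in> {0..1}" if "j \<le> m" for j using that m by simp
  have "(\<lambda>n. \<Sum>j\<le>m. \<integral>x. \<bar>path x (real j / real m) - arch_fun (frame x) (real j / real m)\<bar> \<partial>\<nu> n) \<longlonglongrightarrow> (\<Sum>j\<le>m. 0)"
    using mem by (intro tendsto_sum frame_determines) auto
  then have "eventually (\<lambda>n. (\<Sum>j\<le>m. \<integral>x. \<bar>path x (real j / real m) - arch_fun (frame x) (real j / real m)\<bar> \<partial>\<nu> n) < e / 3) sequentially"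
    using \<open>0 < e\<close> by (intro order_tendstoD(2)) auto
  then show "eventually (\<lambda>n. dist (\<integral>x. dist x (arch_path (frame x)) \<partial>\<nu> n) 0 < e) sequentially"
    using eventually_ge_at_top[of 1]
  proof eventually_elim
    case (elim n)
    interpret discrete_random_measure "M n" "X n" by (rule discrete[OF elim(2)])
    interpret A: prob_space "\<nu> n" by (rule prob_space_annealed)
    have int_mod: "integrable (\<nu> n) (modulus k)" if "0 \<le> k" for k
      using that by (intro integrable_annealed[where B=2]) (auto simp: modulus_nonneg modulus_le_2)
    have int_sum: "integrable (\<nu> n) (\<lambda>x. \<Sum>j\<le>m. \<bar>path x (real j / real m) - arch_fun (frame x) (real j / real m)\<bar>)"
      using elim mem by (intro Bochner_Integration.integrable_sum integrable_frame_error) auto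
    have "(\<integral>x. dist x (arch_path (frame x)) \<partial>\<nu> n)
       \<le> (\<integral>x. (\<Sum>j\<le>m. \<bar>path x (real j / real m) - arch_fun (frame x) (real j / real m)\<bar>)
           + modulus (1 / real m) x + 2 * pi / real m \<partial>\<nu> n)"
      using int_sum int_mod
      by (intro integral_mono dist_arch_path_frame_le m integrable_annealed[OF dist_arch_path_bounds]) auto
    also have "\<dots> = (\<Sum>j\<le>m. \<integral>x. \<bar>path x (real j / real m) - arch_fun (frame x) (real j / real m)\<bar> \<partial>\<nu> n)
           + (\<integral>x. modulus (1 / real m) x \<partial>\<nu> n) + 2 * pi / real m"
    proof -
      have "(\<integral>x. (\<Sum>j\<le>m. \<bar>path x (real j / real m) - arch_fun (frame x) (real j / real m)\<bar>) \<partial>\<nu> n)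
         = (\<Sum>j\<le>m. \<integral>x. \<bar>path x (real j / real m) - arch_fun (frame x) (real j / real m)\<bar> \<partial>\<nu> n)"
        using elim mem by (intro Bochner_Integration.integral_sum integrable_frame_error) auto
      then show ?thesis using int_sum int_mod by (simp add: A.prob_space)
    qed
    also have "(\<integral>x. modulus (1 / real m) x \<partial>\<nu> n) \<le> (\<integral>x. modulus h x \<partial>\<nu> n)"
      using m h by (intro integral_mono int_mod modulus_mono) auto
    also have "\<dots> \<le> e / 3" using h(2) elim by simp
    finally show ?case using m elim by (simp add: dist_real_def Bochner_Integration.integral_nonneg)
  qed
qed

text \<open>The paths \<open>arch_path (frame x)\<close> stay in the compact image Q of the square,
  near which f is uniformly continuous.\<close>

lemma arch_path_replacement:
  fixes f :: "trajectory \<Rightarrow> real"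
  assumes cont: "continuous_on UNIV f" and bound: "\<And>x. \<bar>f x\<bar> \<le> B"
  shows "(\<lambda>n. \<integral>x. \<bar>f x - f (arch_path (frame x))\<bar> \<partial>\<nu> n) \<longlonglongrightarrow> 0"
proof (rule tendstoI)
  fix e :: real assume "0 < e"
  have "0 \<le> B" using bound order.trans abs_ge_zero by blast
  define Q where "Q = arch_path ` ({-1..1} \<times> {-1..1})"
  have "compact Q"
    unfolding Q_def by (intro compact_continuous_image continuous_on_arch_path compact_Times) auto
  then obtain d where d: "0 < d" "\<And>x y. y \<in> Q \<Longrightarrow> dist y x < d \<Longrightarrow> \<bar>f x - f y\<bar> < e / 2"
    using uniformly_continuous_near_compact[OF cont, of Q "e / 2"] \<open>0 < e\<close> by auto
  \<comment> \<open>Paths closer than d contribute at most e/2; beyond d the trivial bound 2 B is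
    dominated by a multiple of the distance, whose mean tends to 0.\<close>
  have pointwise: "\<bar>f x - f (arch_path (frame x))\<bar> \<le> e / 2 + 2 * B / d * dist x (arch_path (frame x))" for x
  proof (cases "dist x (arch_path (frame x)) < d")
    case True
    then have "\<bar>f x - f (arch_path (frame x))\<bar> < e / 2"
      using frame_mem by (intro d(2)) (auto simp: Q_def dist_commute)
    moreover have "0 \<le> 2 * B / d * dist x (arch_path (frame x))" using \<open>0 \<le> B\<close> d(1) by simp
    ultimately show ?thesis by linarith
  next
    case False
    have "\<bar>f x - f (arch_path (frame x))\<bar> \<le> 2 * B / d * d"
      using bound[of x] bound[of "arch_path (frame x)"] d(1) by simp
    also have "\<dots> \<le> 2 * B / d * dist x (arch_path (frame x))"
      using False \<open>0 \<le> B\<close> d(1) by (intro mult_left_mono) auto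
    finally show ?thesis using \<open>0 < e\<close> by linarith
  qed
  have "(\<lambda>n. e / 2 + 2 * B / d * (\<integral>x. dist x (arch_path (frame x)) \<partial>\<nu> n)) \<longlonglongrightarrow> e / 2 + 2 * B / d * 0"
    by (intro tendsto_intros dist_arch_path_tendsto_0)
  then have "eventually (\<lambda>n. e / 2 + 2 * B / d * (\<integral>x. dist x (arch_path (frame x)) \<partial>\<nu> n) < e) sequentially"
    by (rule order_tendstoD(2)) (use \<open>0 < e\<close> in simp)
  then show "eventually (\<lambda>n. dist (\<integral>x. \<bar>f x - f (arch_path (frame x))\<bar> \<partial>\<nu> n) 0 < e) sequentially"
    using eventually_ge_at_top[of 1]
  proof eventually_elim
    case (elim n)
    interpret discrete_random_measure "M n" "X n" by (rule discrete[OF elim(2)])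
    interpret A: prob_space "\<nu> n" by (rule prob_space_annealed)
    have cont2: "continuous_on UNIV (\<lambda>x. \<bar>f x - f (arch_path (frame x))\<bar>)"
      by (intro continuous_intros cont continuous_on_compose2[OF cont]
          continuous_on_compose2[OF continuous_on_arch_path continuous_on_frame]) auto
    have "integrable (\<nu> n) (\<lambda>x. \<bar>f x - f (arch_path (frame x))\<bar>)"
    proof (rule integrable_annealed[where B="2 * B"])
      show "\<bar>\<bar>f x - f (arch_path (frame x))\<bar>\<bar> \<le> 2 * B" for x
        using bound[of x] bound[of "arch_path (frame x)"] by linarith
    qed (rule borel_measurable_continuous_onI[OF cont2])
    then have "(\<integral>x. \<bar>f x - f (arch_path (frame x))\<bar> \<partial>\<nu> n) \<le> (\<integral>x. e / 2 + 2 * B / d * dist x (arch_path (frame x)) \<partial>\<nu> n)"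
      using integrable_annealed[OF dist_arch_path_bounds]
      by (intro integral_mono pointwise Bochner_Integration.integrable_add integrable_mult_right) auto
    also have "\<dots> = e / 2 + 2 * B / d * (\<integral>x. dist x (arch_path (frame x)) \<partial>\<nu> n)"
      using integrable_annealed[OF dist_arch_path_bounds] by (simp add: A.prob_space)
    also have "\<dots> < e" by (rule elim(1))
    finally show ?case by (simp add: dist_real_def Bochner_Integration.integral_nonneg)
  qed
qed

text \<open>The absolute value stands inside the integral over \<open>M n\<close>, so convergence to
  0 says that the random law of the frame concentrates, and not merely that its mean
  converges.\<close>

definition frame_deviation :: "nat \<Rightarrow> (real \<times> real \<Rightarrow> real) \<Rightarrow> real" where
  "frame_deviation n g =
     (\<integral>\<omega>. \<bar>(\<integral>x. g (frame x) \<partial>X n \<omega>) - (\<integral>p. g p \<partial>archimedean_measure)\<bar> \<partial>M n)"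

lemma frame_deviation_nonneg: "0 \<le> frame_deviation n g"
  by (simp add: frame_deviation_def Bochner_Integration.integral_nonneg)

lemma frame_comp_bounds:
  assumes "continuous_on UNIV g"
  shows "(\<lambda>x. g (frame x)) \<in> borel_measurable borel"
  by (rule borel_measurable_continuous_onI[OF continuous_on_compose2[OF assms continuous_on_frame]]) auto

text \<open>In polar form the exponent is s times a projection of the frame. This projection is
  L^1-close to the path at a single time t, whose quenched marginal is asymptotically uniform, as is
  the same projection of the Archimedean measure.\<close>

lemma frame_deviation_exp:
  "(\<lambda>n. frame_deviation n (\<lambda>p. exp (a * fst p + b * snd p))) \<longlonglongrightarrow> 0"
proof -
  obtain s t where st: "t \<in> {0..1}" "cos (pi * t) \<noteq> -1" "a = s * cos (pi * t)" "b = s * sin (pi * t)"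
    by (rule polar_direction)
  have eq: "a * fst p + b * snd p = s * arch_fun p t" for p
    by (simp add: st arch_fun_def algebra_simps)
  obtain H where H: "\<And>u. (H has_real_derivative exp (s * u)) (at u)"
    using exp_antiderivative[of s] by blast
  define l where "l = (H 1 - H (-1)) / 2"
  have arch: "(\<integral>p. exp (a * fst p + b * snd p) \<partial>archimedean_measure) = l"
    unfolding eq l_def arch_fun_def
    by (rule integral_archimedean_projection) (use H st in auto)
  \<comment> \<open>Projections of the frame are bounded by 2 and not by 1, since the frame is only
    known to lie in the square; this accounts for the factor 2 in the exponent.\<close>
  define L where "L = exp (2 * \<bar>s\<bar>) * \<bar>s\<bar>"
  have "0 \<le> L" by (simp add: L_def)
  have lip: "\<bar>exp (s * u) - exp (s * v)\<bar> \<le> L * \<bar>u - v\<bar>" if "\<bar>u\<bar> \<le> 2" "\<bar>v\<bar> \<le> 2" for u v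
  proof -
    have "\<bar>exp (s * u) - exp (s * v)\<bar> \<le> exp (2 * \<bar>s\<bar>) * \<bar>s * u - s * v\<bar>"
    proof (rule abs_exp_diff_le)
      show "\<bar>s * u\<bar> \<le> 2 * \<bar>s\<bar>" "\<bar>s * v\<bar> \<le> 2 * \<bar>s\<bar>"
        using that mult_left_mono[OF that(1), of "\<bar>s\<bar>"] mult_left_mono[OF that(2), of "\<bar>s\<bar>"]
        by (auto simp: abs_mult mult.commute)
    qed
    then show ?thesis by (simp add: L_def right_diff_distrib[symmetric] abs_mult mult.assoc)
  qed
  have marg: "(\<lambda>n. \<integral>\<omega>. \<bar>(\<integral>x. exp (s * path x t) \<partial>X n \<omega>) - l\<bar> \<partial>M n) \<longlonglongrightarrow> 0"
    unfolding l_def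
    by (rule marginal_convergence[where L=L]) (use H lip st \<open>0 \<le> L\<close> in \<open>auto intro!: continuous_intros\<close>)
  have bound: "\<bar>exp (s * u)\<bar> \<le> exp (2 * \<bar>s\<bar>)" if "\<bar>u\<bar> \<le> 2" for u
  proof -
    have "s * u \<le> \<bar>s\<bar> * \<bar>u\<bar>" by (metis abs_ge_self abs_mult)
    also have "\<dots> \<le> \<bar>s\<bar> * 2" using that by (intro mult_left_mono) auto
    finally show ?thesis by simp
  qed
  have upper: "(\<lambda>n. (\<integral>\<omega>. \<bar>(\<integral>x. exp (s * path x t) \<partial>X n \<omega>) - l\<bar> \<partial>M n)
      + L * (\<integral>x. \<bar>path x t - arch_fun (frame x) t\<bar> \<partial>\<nu> n)) \<longlonglongrightarrow> 0"
    using tendsto_add[OF marg tendsto_mult[OF tendsto_const frame_determines[OF st(1)], of L]] by simp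
  show ?thesis
  proof (rule tendsto_sandwich[OF _ _ tendsto_const upper])
    show "eventually (\<lambda>n. 0 \<le> frame_deviation n (\<lambda>p. exp (a * fst p + b * snd p))) sequentially"
      by (simp add: frame_deviation_nonneg)
    show "eventually (\<lambda>n. frame_deviation n (\<lambda>p. exp (a * fst p + b * snd p))
        \<le> (\<integral>\<omega>. \<bar>(\<integral>x. exp (s * path x t) \<partial>X n \<omega>) - l\<bar> \<partial>M n)
          + L * (\<integral>x. \<bar>path x t - arch_fun (frame x) t\<bar> \<partial>\<nu> n)) sequentially"
      using eventually_ge_at_top[of 1]
    proof eventually_elim
      case (elim n)
      interpret discrete_random_measure "M n" "X n" by (rule discrete[OF elim])
      have p2: "\<bar>path x t\<bar> \<le> 2" for x using abs_path_le[OF st(1), of x] by linarith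
      have "frame_deviation n (\<lambda>p. exp (a * fst p + b * snd p))
          \<le> (\<integral>\<omega>. \<bar>(\<integral>x. exp (s * path x t) \<partial>X n \<omega>) - l\<bar> \<partial>M n)
            + (\<integral>x. \<bar>exp (s * arch_fun (frame x) t) - exp (s * path x t)\<bar> \<partial>\<nu> n) + \<bar>l - l\<bar>"
        unfolding frame_deviation_def arch unfolding eq
        using st bound[OF abs_arch_fun_frame_le] bound[OF p2]
        by (intro mean_deviation_approx[where B="exp (2 * \<bar>s\<bar>)" and B'="exp (2 * \<bar>s\<bar>)"]) auto
      also have "(\<integral>x. \<bar>exp (s * arch_fun (frame x) t) - exp (s * path x t)\<bar> \<partial>\<nu> n)
          \<le> (\<integral>x. L * \<bar>path x t - arch_fun (frame x) t\<bar> \<partial>\<nu> n)"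
      proof (rule integral_mono)
        show "integrable (\<nu> n) (\<lambda>x. \<bar>exp (s * arch_fun (frame x) t) - exp (s * path x t)\<bar>)"
          using st bound[OF abs_arch_fun_frame_le] bound[OF p2]
          by (intro integrable_abs Bochner_Integration.integrable_diff integrable_annealed[where B="exp (2 * \<bar>s\<bar>)"]) auto
        show "\<bar>exp (s * arch_fun (frame x) t) - exp (s * path x t)\<bar> \<le> L * \<bar>path x t - arch_fun (frame x) t\<bar>" for x
          using lip[OF abs_arch_fun_frame_le[of x t] p2[of x]] by (simp add: abs_minus_commute)
      qed (use integrable_frame_error[OF elim st(1)] in auto)
      finally show ?case by simp
    qed
  qed
qed

lemma frame_deviation_add:
  assumes n: "1 \<le> n" and f: "continuous_on UNIV f" and g: "continuous_on UNIV g"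
  shows "frame_deviation n (\<lambda>p. f p + g p) \<le> frame_deviation n f + frame_deviation n g"
proof -
  interpret discrete_random_measure "M n" "X n" by (rule discrete[OF n])
  obtain B where "\<And>p. p \<in> {-1..1} \<times> {-1..1} \<Longrightarrow> \<bar>f p\<bar> \<le> B" using continuous_on_box_bound[OF f] by blast
  then have B: "(\<lambda>x. f (frame x)) \<in> borel_measurable borel" "\<And>x. \<bar>f (frame x)\<bar> \<le> B"
    using frame_mem frame_comp_bounds[OF f] by auto
  obtain B' where "\<And>p. p \<in> {-1..1} \<times> {-1..1} \<Longrightarrow> \<bar>g p\<bar> \<le> B'" using continuous_on_box_bound[OF g] by blast
  then have B': "(\<lambda>x. g (frame x)) \<in> borel_measurable borel" "\<And>x. \<bar>g (frame x)\<bar> \<le> B'"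
    using frame_mem frame_comp_bounds[OF g] by auto
  have fg: "(\<lambda>x. f (frame x) + g (frame x)) \<in> borel_measurable borel" "\<And>x. \<bar>f (frame x) + g (frame x)\<bar> \<le> B + B'"
    using B(1) B'(1) abs_triangle_ineq[THEN order.trans, OF add_mono[OF B(2) B'(2)]] by auto
  have int: "integrable (M n) (\<lambda>\<omega>. \<bar>(\<integral>x. h x \<partial>X n \<omega>) - a\<bar>)"
    if "h \<in> borel_measurable borel" "\<And>x. \<bar>h x\<bar> \<le> C" for h and C a :: real
    using that by (intro integrable_abs Bochner_Integration.integrable_diff integrable_integral_X[where B=C]) auto
  have "frame_deviation n (\<lambda>p. f p + g p) \<le>
      (\<integral>\<omega>. \<bar>(\<integral>x. f (frame x) \<partial>X n \<omega>) - (\<integral>p. f p \<partial>archimedean_measure)\<bar>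
         + \<bar>(\<integral>x. g (frame x) \<partial>X n \<omega>) - (\<integral>p. g p \<partial>archimedean_measure)\<bar> \<partial>M n)"
    unfolding frame_deviation_def
  proof (rule integral_mono)
    fix \<omega> assume \<omega>: "\<omega> \<in> space (M n)"
    have "(\<integral>x. f (frame x) + g (frame x) \<partial>X n \<omega>) = (\<integral>x. f (frame x) \<partial>X n \<omega>) + (\<integral>x. g (frame x) \<partial>X n \<omega>)"
      by (rule Bochner_Integration.integral_add[OF integrable_X[OF \<omega> B] integrable_X[OF \<omega> B']])
    moreover have "(\<integral>p. f p + g p \<partial>archimedean_measure) = (\<integral>p. f p \<partial>archimedean_measure) + (\<integral>p. g p \<partial>archimedean_measure)"
      by (rule Bochner_Integration.integral_add[OF integrable_archimedean[OF f] integrable_archimedean[OF g]])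
    ultimately show "\<bar>(\<integral>x. f (frame x) + g (frame x) \<partial>X n \<omega>) - (\<integral>p. f p + g p \<partial>archimedean_measure)\<bar>
      \<le> \<bar>(\<integral>x. f (frame x) \<partial>X n \<omega>) - (\<integral>p. f p \<partial>archimedean_measure)\<bar>
         + \<bar>(\<integral>x. g (frame x) \<partial>X n \<omega>) - (\<integral>p. g p \<partial>archimedean_measure)\<bar>" by linarith
  qed (use int[OF B] int[OF B'] int[OF fg] in auto)
  also have "\<dots> = frame_deviation n f + frame_deviation n g"
    unfolding frame_deviation_def by (rule Bochner_Integration.integral_add[OF int[OF B] int[OF B']])
  finally show ?thesis .
qed

lemma frame_deviation_exp_span:
  assumes "g \<in> exp_span"
  shows "(\<lambda>n. frame_deviation n g) \<longlonglongrightarrow> 0"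
  using assms
proof induction
  case (exp c a b)
  have "frame_deviation n (\<lambda>p. c * exp (a * fst p + b * snd p))
      = \<bar>c\<bar> * frame_deviation n (\<lambda>p. exp (a * fst p + b * snd p))" for n
    by (simp add: frame_deviation_def right_diff_distrib[symmetric] abs_mult)
  then show ?case using tendsto_mult[OF tendsto_const frame_deviation_exp, of "\<bar>c\<bar>"] by simp
next
  case (add f g)
  show ?case
  proof (rule tendsto_sandwich[OF _ _ tendsto_const])
    show "eventually (\<lambda>n. frame_deviation n (\<lambda>p. f p + g p) \<le> frame_deviation n f + frame_deviation n g) sequentially"
      using eventually_ge_at_top[of 1]
      by eventually_elim (intro frame_deviation_add continuous_on_exp_span add.hyps)
    show "(\<lambda>n. frame_deviation n f + frame_deviation n g) \<longlonglongrightarrow> 0"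
      using tendsto_add[OF add.IH] by simp
  qed (simp add: frame_deviation_nonneg)
qed

text \<open>Approximation on the square suffices, because it contains every frame and carries the
  Archimedean measure. The error enters once under the annealed law and once in the target
  value.\<close>

lemma frame_deviation_tendsto_0:
  assumes g: "continuous_on UNIV g"
  shows "(\<lambda>n. frame_deviation n g) \<longlonglongrightarrow> 0"
proof (rule tendstoI)
  fix e :: real assume "0 < e"
  then have e3: "0 < e / 3" by simp
  obtain r where r: "r \<in> exp_span" "\<And>p. p \<in> {-1..1} \<times> {-1..1} \<Longrightarrow> \<bar>g p - r p\<bar> < e / 3"
    using exp_span_dense[OF g, of "e / 3"] \<open>0 < e\<close> by auto
  have rc: "continuous_on UNIV r" by (rule continuous_on_exp_span[OF r(1)])
  obtain B where "\<And>p. p \<in> {-1..1} \<times> {-1..1} \<Longrightarrow> \<bar>g p\<bar> \<le> B" using continuous_on_box_bound[OF g] by blast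
  then have B: "(\<lambda>x. g (frame x)) \<in> borel_measurable borel" "\<And>x. \<bar>g (frame x)\<bar> \<le> B"
    using frame_mem frame_comp_bounds[OF g] by auto
  obtain B' where "\<And>p. p \<in> {-1..1} \<times> {-1..1} \<Longrightarrow> \<bar>r p\<bar> \<le> B'" using continuous_on_box_bound[OF rc] by blast
  then have B': "(\<lambda>x. r (frame x)) \<in> borel_measurable borel" "\<And>x. \<bar>r (frame x)\<bar> \<le> B'"
    using frame_mem frame_comp_bounds[OF rc] by auto
  have arch: "\<bar>(\<integral>p. g p \<partial>archimedean_measure) - (\<integral>p. r p \<partial>archimedean_measure)\<bar> \<le> e / 3"
  proof -
    interpret A: prob_space archimedean_measure by (rule prob_space_archimedean_measure)
    note int = integrable_archimedean[OF g] integrable_archimedean[OF rc]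
    have "\<bar>\<integral>p. g p - r p \<partial>archimedean_measure\<bar> \<le> (\<integral>p. \<bar>g p - r p\<bar> \<partial>archimedean_measure)"
      by (rule integral_abs_bound)
    also have "\<dots> \<le> (\<integral>p. e / 3 \<partial>archimedean_measure)"
    proof (rule integral_mono_AE)
      show "AE p in archimedean_measure. \<bar>g p - r p\<bar> \<le> e / 3"
        using AE_archimedean_box by eventually_elim (use r(2) less_imp_le in blast)
    qed (use int in auto)
    finally show ?thesis using int by (simp add: A.prob_space)
  qed
  show "eventually (\<lambda>n. dist (frame_deviation n g) 0 < e) sequentially"
    using order_tendstoD(2)[OF frame_deviation_exp_span[OF r(1)] e3] eventually_ge_at_top[of 1]
  proof eventually_elim
    case (elim n)
    interpret discrete_random_measure "M n" "X n" by (rule discrete) (use elim in simp)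
    interpret A: prob_space annealed by (rule prob_space_annealed)
    have "frame_deviation n g \<le> frame_deviation n r + (\<integral>x. \<bar>g (frame x) - r (frame x)\<bar> \<partial>annealed)
        + \<bar>(\<integral>p. g p \<partial>archimedean_measure) - (\<integral>p. r p \<partial>archimedean_measure)\<bar>"
      unfolding frame_deviation_def by (rule mean_deviation_approx[OF B B'])
    moreover have "(\<integral>x. \<bar>g (frame x) - r (frame x)\<bar> \<partial>annealed) \<le> (\<integral>x. e / 3 \<partial>annealed)"
      using less_imp_le[OF r(2)[OF frame_mem]]
      by (intro integral_mono integrable_abs Bochner_Integration.integrable_diff
          integrable_annealed[OF B] integrable_annealed[OF B']) auto
    ultimately show ?case using arch elim frame_deviation_nonneg[of n g] by (simp add: A.prob_space)
  qed
qed

text \<open>A test function on path space, evaluated at the great-circle path of a frame, is a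
  continuous test function of the frame, and the Archimedean process is the image of its planar
  measure under the same map.\<close>

lemma mean_deviation_tendsto_0:
  fixes f :: "trajectory \<Rightarrow> real"
  assumes cont: "continuous_on UNIV f" and bound: "\<And>x. \<bar>f x\<bar> \<le> B"
  shows "(\<lambda>n. \<integral>\<omega>. \<bar>(\<integral>x. f x \<partial>X n \<omega>) - (\<integral>x. f x \<partial>archimedean_process)\<bar> \<partial>M n) \<longlonglongrightarrow> 0"
proof -
  define g where "g p = f (arch_path p)" for p
  have g: "continuous_on UNIV g"
    unfolding g_def by (rule continuous_on_compose2[OF cont continuous_on_arch_path]) auto
  have upper: "(\<lambda>n. frame_deviation n g + (\<integral>x. \<bar>f x - f (arch_path (frame x))\<bar> \<partial>\<nu> n)) \<longlonglongrightarrow> 0"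
    using tendsto_add[OF frame_deviation_tendsto_0[OF g] arch_path_replacement[OF cont bound]] by simp
  show ?thesis
  proof (rule tendsto_sandwich[OF _ _ tendsto_const upper])
    show "eventually (\<lambda>n. (\<integral>\<omega>. \<bar>(\<integral>x. f x \<partial>X n \<omega>) - (\<integral>x. f x \<partial>archimedean_process)\<bar> \<partial>M n)
        \<le> frame_deviation n g + (\<integral>x. \<bar>f x - f (arch_path (frame x))\<bar> \<partial>\<nu> n)) sequentially"
      using eventually_ge_at_top[of 1]
    proof eventually_elim
      case (elim n)
      interpret discrete_random_measure "M n" "X n" by (rule discrete[OF elim])
      have "(\<integral>\<omega>. \<bar>(\<integral>x. f x \<partial>X n \<omega>) - (\<integral>p. g p \<partial>archimedean_measure)\<bar> \<partial>M n)
          \<le> frame_deviation n g + (\<integral>x. \<bar>f x - g (frame x)\<bar> \<partial>annealed)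
            + \<bar>(\<integral>p. g p \<partial>archimedean_measure) - (\<integral>p. g p \<partial>archimedean_measure)\<bar>"
        unfolding frame_deviation_def
        by (rule mean_deviation_approx[where B=B and B'=B, OF borel_measurable_continuous_onI[OF cont] bound frame_comp_bounds[OF g]])
           (simp add: g_def bound)
      then show ?case by (simp add: g_def integral_archimedean_process[OF cont])
    qed
  qed (simp add: Bochner_Integration.integral_nonneg)
qed

section \<open>From test functions to neighbourhoods in the weak topology\<close>

lemma subbasic_neighbourhood:
  fixes f :: "trajectory \<Rightarrow> real"
  assumes cont: "continuous_on UNIV f" and "bounded (range f)" and "open V"
    and lim: "(\<integral>x. f x \<partial>archimedean_process) \<in> V"
  shows "(\<lambda>n. measure (M n) {\<omega> \<in> space (M n). X n \<omega> \<notin> {\<mu> \<in> space (prob_algebra borel). (\<integral>x. f x \<partial>\<mu>) \<in> V}}) \<longlonglongrightarrow> 0"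
proof -
  define l where "l = (\<integral>x. f x \<partial>archimedean_process)"
  obtain B where B: "\<And>x. \<bar>f x\<bar> \<le> B" using \<open>bounded (range f)\<close> by (auto simp: bounded_iff)
  \<comment> \<open>Leaving the neighbourhood forces a deviation of at least d from the limit value,
    to which Markov's inequality applies.\<close>
  obtain d where d: "0 < d" "ball l d \<subseteq> V" using \<open>open V\<close> lim unfolding open_contains_ball l_def by blast
  have upper: "(\<lambda>n. (\<integral>\<omega>. \<bar>(\<integral>x. f x \<partial>X n \<omega>) - l\<bar> \<partial>M n) / d) \<longlonglongrightarrow> 0"
    using tendsto_divide[OF mean_deviation_tendsto_0[OF cont B] tendsto_const, of d] d(1) by (simp add: l_def)
  show ?thesis
  proof (rule tendsto_sandwich[OF _ _ tendsto_const upper])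
    show "eventually (\<lambda>n. measure (M n) {\<omega> \<in> space (M n). X n \<omega> \<notin> {\<mu> \<in> space (prob_algebra borel). (\<integral>x. f x \<partial>\<mu>) \<in> V}}
        \<le> (\<integral>\<omega>. \<bar>(\<integral>x. f x \<partial>X n \<omega>) - l\<bar> \<partial>M n) / d) sequentially"
      using eventually_ge_at_top[of 1]
    proof eventually_elim
      case (elim n)
      interpret discrete_random_measure "M n" "X n" by (rule discrete[OF elim])
      have int: "integrable (M n) (\<lambda>\<omega>. \<bar>(\<integral>x. f x \<partial>X n \<omega>) - l\<bar>)"
        using B borel_measurable_continuous_onI[OF cont]
        by (intro integrable_abs Bochner_Integration.integrable_diff integrable_integral_X) auto
      have "measure (M n) {\<omega> \<in> space (M n). X n \<omega> \<notin> {\<mu> \<in> space (prob_algebra borel). (\<integral>x. f x \<partial>\<mu>) \<in> V}}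
          \<le> measure (M n) {\<omega> \<in> space (M n). d \<le> \<bar>(\<integral>x. f x \<partial>X n \<omega>) - l\<bar>}"
      proof (rule finite_measure_mono)
        show "{\<omega> \<in> space (M n). X n \<omega> \<notin> {\<mu> \<in> space (prob_algebra borel). (\<integral>x. f x \<partial>\<mu>) \<in> V}}
            \<subseteq> {\<omega> \<in> space (M n). d \<le> \<bar>(\<integral>x. f x \<partial>X n \<omega>) - l\<bar>}"
          using X_in d(2) by (force simp: ball_def dist_real_def abs_minus_commute not_less[symmetric])
        show "{\<omega> \<in> space (M n). d \<le> \<bar>(\<integral>x. f x \<partial>X n \<omega>) - l\<bar>} \<in> events"
          using borel_measurable_integrable[OF int] by measurable
      qed
      also have "\<dots> \<le> (\<integral>\<omega>. \<bar>(\<integral>x. f x \<partial>X n \<omega>) - l\<bar> \<partial>M n) / d"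
        using int d(1) by (intro integral_Markov_inequality_measure[where A="{}"]) auto
      finally show ?case .
    qed
  qed simp
qed

lemma escape_measurable:
  assumes "1 \<le> n"
  shows "{\<omega> \<in> space (M n). X n \<omega> \<notin> U} \<in> sets (M n)"
proof -
  interpret discrete_random_measure "M n" "X n" by (rule discrete[OF assms])
  have "{\<omega> \<in> space (M n). X n \<omega> \<notin> U} = X n -` (space (prob_algebra borel) - U) \<inter> space (M n)"
    using X_in by blast
  also have "\<dots> \<in> sets (M n)" by (rule measurable_sets[OF X_measurable]) simp
  finally show ?thesis .
qed

text \<open>Induction on how an open set is generated from the subbasis: a union bound handles
  intersections, and for a union it suffices to stay in one member that contains the limit.\<close>

lemma weak_neighbourhood:
  assumes "openin weak_topology U" "archimedean_process \<in> U"
  shows "(\<lambda>n. measure (M n) {\<omega> \<in> space (M n). X n \<omega> \<notin> U}) \<longlonglongrightarrow> 0"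
proof -
  let ?S = "{{\<mu> \<in> space (prob_algebra borel). (\<integral>x. f x \<partial>\<mu>) \<in> V} | (f :: trajectory \<Rightarrow> real) V.
        continuous_on UNIV f \<and> bounded (range f) \<and> open V}"
  have "generate_topology_on ?S U"
    using assms(1) unfolding weak_topology_def openin_topology_generated_by_iff .
  then show ?thesis using assms(2)
  proof induction
    case (Int U V)
    have "(\<lambda>n. measure (M n) {\<omega> \<in> space (M n). X n \<omega> \<notin> U} + measure (M n) {\<omega> \<in> space (M n). X n \<omega> \<notin> V}) \<longlonglongrightarrow> 0 + 0"
      using Int.prems by (intro tendsto_add Int.IH) simp_all
    then have upper: "(\<lambda>n. measure (M n) {\<omega> \<in> space (M n). X n \<omega> \<notin> U} + measure (M n) {\<omega> \<in> space (M n). X n \<omega> \<notin> V}) \<longlonglongrightarrow> 0"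
      by simp
    show ?case
    proof (rule tendsto_sandwich[OF _ _ tendsto_const upper])
      show "eventually (\<lambda>n. measure (M n) {\<omega> \<in> space (M n). X n \<omega> \<notin> U \<inter> V}
          \<le> measure (M n) {\<omega> \<in> space (M n). X n \<omega> \<notin> U} + measure (M n) {\<omega> \<in> space (M n). X n \<omega> \<notin> V}) sequentially"
        using eventually_ge_at_top[of 1]
      proof eventually_elim
        case (elim n)
        interpret discrete_random_measure "M n" "X n" by (rule discrete[OF elim])
        have "{\<omega> \<in> space (M n). X n \<omega> \<notin> U \<inter> V} = {\<omega> \<in> space (M n). X n \<omega> \<notin> U} \<union> {\<omega> \<in> space (M n). X n \<omega> \<notin> V}" by auto
        then show ?case
          by (simp only:) (intro measure_Un_le escape_measurable[OF elim])
      qed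
    qed simp
  next
    case (UN K)
    then obtain U where U: "U \<in> K" "archimedean_process \<in> U" by blast
    have upper: "(\<lambda>n. measure (M n) {\<omega> \<in> space (M n). X n \<omega> \<notin> U}) \<longlonglongrightarrow> 0"
      using UN.IH U by blast
    show ?case
    proof (rule tendsto_sandwich[OF _ _ tendsto_const upper])
      show "eventually (\<lambda>n. measure (M n) {\<omega> \<in> space (M n). X n \<omega> \<notin> \<Union>K}
          \<le> measure (M n) {\<omega> \<in> space (M n). X n \<omega> \<notin> U}) sequentially"
        using eventually_ge_at_top[of 1]
      proof eventually_elim
        case (elim n)
        interpret discrete_random_measure "M n" "X n" by (rule discrete[OF elim])
        show ?case using U by (intro finite_measure_mono escape_measurable[OF elim]) auto
      qed
    qed simp
  next
    case (Basis U)
    then obtain f :: "trajectory \<Rightarrow> real" and V where f: "continuous_on UNIV f" "bounded (range f)" "open V"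
      and U: "U = {\<mu> \<in> space (prob_algebra borel). (\<integral>x. f x \<partial>\<mu>) \<in> V}" by blast
    have "(\<integral>x. f x \<partial>archimedean_process) \<in> V" using Basis.prems unfolding U by simp
    then show ?case unfolding U by (rule subbasic_neighbourhood[OF f])
  qed simp
qed

end

theorem corollary2p1:
  fixes M :: "nat \<Rightarrow> 'a measure"
    and X :: "nat \<Rightarrow> 'a \<Rightarrow> trajectory measure"
    and \<epsilon> :: "nat \<Rightarrow> real"
    and c :: real
  assumes offset: "0 \<le> c" "c \<le> 1"
    and process: "\<And>n. n \<ge> 1 \<Longrightarrow> random_trajectory_process c n (M n) (X n)"
    and tight: "tight_sequence weak_topology M X"
    and eps_pos: "\<And>n. n \<ge> 1 \<Longrightarrow> \<epsilon> n > 0"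
    and eps_lim: "\<epsilon> \<longlonglongrightarrow> 0"
    and stationary: "\<And>n. n \<ge> 1 \<Longrightarrow> stationary (\<epsilon> n) (M n) (X n)"
    and energy: "Limsup (at_right (0::real)) (\<lambda>t. limsup (\<lambda>n.
        ereal ((\<integral>\<omega>. (\<integral>x. (path x t - path x 0)\<^sup>2 \<partial>X n \<omega>) \<partial>M n) / t\<^sup>2)))
      \<le> ereal (pi\<^sup>2 / 3)"
  shows "converges_in_probability weak_topology M X archimedean_process"
proof -
  interpret stationary_trajectory_sequence M X \<epsilon> c
    by standard (fact assms)+
  show ?thesis
    unfolding converges_in_probability_def topspace_weak_topology
    using archimedean_process_prob_algebra weak_neighbourhood by blast
qed

end
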